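(* Let $n\geq1$, let $F:[0,+\infty)\rightarrow\mathbb R$ be a continuous function bounded from below satisfying $\inf F\le 0$ and $\liminf_{+\infty}F>-\inf F$, and let $\omega\subset\mathbb R^n$ be a measurable set. The evolution system $(E_F)$ associated with $F$ and $\omega$ is exponentially stabilizable from $\omega$ if and only if $\omega$ is thick.
   Context: $L^2(\mathbb R^n)$ is the space of complex-valued square-integrable functions, $\mathcal L(L^2(\mathbb R^n))$ the bounded linear operators on it, and $\mathbf 1_\omega$ the characteristic function of $\omega$, also viewed as a multiplication operator. For a continuous function $F:[0,+\infty)\to\mathbb R$ bounded from below, $F(|D_x|)$ is the Fourier multiplier with symbol $F(|\xi|)$, where $|\cdot|$ is the Euclidean norm, with domain $\{u\in L^2(\mathbb R^n): F(|D_x|)u\in L^2(\mathbb R^n)\}$. For $B\in\mathcal L(L^2(\mathbb R^n))$, $(e^{-t(F(|D_x|)+B)})_{t\geq0}$ denotes the strongly continuous semigroup generated by $-(F(|D_x|)+B)$ (it exists by bounded perturbation theory). The control system $(E_F)$ is $$\partial_tf(t,x)+F(|D_x|)f(t,x)=h(t,x)\mathbf 1_\omega(x),\quad t>0,\ x\in\mathbb R^n,\qquad f(0,\cdot)=f_0\in L^2(\mathbb R^n).$$ Exponential stabilizability: $(E_F)$ is exponentially stabilizable from $\omega$ at rate $\alpha>0$ if there exist $M_\alpha\geq1$ and a feedback $K_\alpha\in\mathcal L(L^2(\mathbb R^n))$ such that $\Vert e^{-t(F(|D_x|)+\mathbf 1_\omega K_\alpha)}\Vert_{\mathcal L(L^2(\mathbb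 R^n))}\le M_\alpha e^{-\alpha t}$ for all $t\geq0$. It is exponentially stabilizable from $\omega$ if this holds for some rate $\alpha>0$. Thickness: given $\gamma\in(0,1)$ and $L>0$, a set $\omega\subset\mathbb R^n$ is $\gamma$-thick at scale $L$ if it is measurable and $\operatorname{Leb}(\omega\cap(x+[0,L]^n))\geq\gamma L^n$ for all $x\in\mathbb R^n$, where $\operatorname{Leb}$ is Lebesgue measure. It is thick if it is $\gamma$-thick at scale $L$ for some $\gamma\in(0,1)$ and $L>0$. *)

theory Defs
  imports "HOL-Analysis.Analysis"
begin

definition sq_integrable :: "('a::euclidean_space \<Rightarrow> complex) \<Rightarrow> bool" where
  "sq_integrable f \<longleftrightarrow>
     f \<in> borel_measurable lebesgue \<and> integrable lebesgue (\<lambda>x. (cmod (f x))\<^sup>2)"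

lemma sq_integrable_zero: "sq_integrable (\<lambda>x. 0)"
  by (simp add: sq_integrable_def)

lemma sq_integrable_cmult: "sq_integrable f \<Longrightarrow> sq_integrable (\<lambda>x. c * f x)"
  by (auto simp: sq_integrable_def norm_mult power_mult_distrib)

lemma sq_integrable_uminus: "sq_integrable f \<Longrightarrow> sq_integrable (\<lambda>x. - f x)"
  by (auto simp: sq_integrable_def)

lemma sq_integrable_add:
  assumes "sq_integrable f" "sq_integrable g"
  shows "sq_integrable (\<lambda>x. f x + g x)"
proof -
  have [measurable]: "f \<in> borel_measurable lebesgue" "g \<in> borel_measurable lebesgue"
    using assms by (auto simp: sq_integrable_def)
  have "integrable lebesgue (\<lambda>x. 2 * (cmod (f x))\<^sup>2 + 2 * (cmod (g x))\<^sup>2)"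
    using assms by (auto simp: sq_integrable_def)
  then have "integrable lebesgue (\<lambda>x. (cmod (f x + g x))\<^sup>2)"
  proof (rule Bochner_Integration.integrable_bound)
    have "(cmod (a + b))\<^sup>2 \<le> 2 * (cmod a)\<^sup>2 + 2 * (cmod b)\<^sup>2" for a b
    proof -
      have "(cmod (a + b))\<^sup>2 \<le> (cmod a + cmod b)\<^sup>2"
        by (intro power_mono norm_triangle_ineq) auto
      moreover have "0 \<le> (cmod a - cmod b)\<^sup>2" by simp
      ultimately show ?thesis by (simp add: power2_sum power2_diff)
    qed
    then show "AE x in lebesgue. norm ((cmod (f x + g x))\<^sup>2)
        \<le> norm (2 * (cmod (f x))\<^sup>2 + 2 * (cmod (g x))\<^sup>2)"
      by (auto simp: abs_of_nonneg)
  qed measurable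
  then show ?thesis by (simp add: sq_integrable_def)
qed

lemma sq_integrable_diff:
  "sq_integrable f \<Longrightarrow> sq_integrable g \<Longrightarrow> sq_integrable (\<lambda>x. f x - g x)"
  using sq_integrable_add[OF _ sq_integrable_uminus, of f g] by simp

lemma sq_integrable_indicator:
  assumes "sq_integrable f" "A \<in> sets lebesgue"
  shows "sq_integrable (\<lambda>x. indicator A x * f x)"
proof -
  have [measurable]: "f \<in> borel_measurable lebesgue" "A \<in> sets lebesgue"
    using assms by (auto simp: sq_integrable_def)
  have "integrable lebesgue (\<lambda>x. (cmod (f x))\<^sup>2)"
    using assms by (simp add: sq_integrable_def)
  then have "integrable lebesgue (\<lambda>x. (cmod (indicator A x * f x))\<^sup>2)"
    by (rule Bochner_Integration.integrable_bound) (measurable, auto simp: indicator_def)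
  then show ?thesis by (simp add: sq_integrable_def)
qed

lemma sq_integrable_inner:
  assumes "sq_integrable f" "sq_integrable g"
  shows "integrable lebesgue (\<lambda>x. f x \<bullet> g x)"
proof -
  have [measurable]: "f \<in> borel_measurable lebesgue" "g \<in> borel_measurable lebesgue"
    using assms by (auto simp: sq_integrable_def)
  have "integrable lebesgue (\<lambda>x. (cmod (f x))\<^sup>2 + (cmod (g x))\<^sup>2)"
    using assms by (auto simp: sq_integrable_def)
  then show ?thesis
  proof (rule Bochner_Integration.integrable_bound)
    have "\<bar>a \<bullet> b\<bar> \<le> (cmod a)\<^sup>2 + (cmod b)\<^sup>2" for a b
    proof -
      have "\<bar>a \<bullet> b\<bar> \<le> cmod a * cmod b" by (rule Cauchy_Schwarz_ineq2)
      moreover have "0 \<le> (cmod a - cmod b)\<^sup>2" by simp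
      moreover have "0 \<le> cmod a * cmod b" by simp
      ultimately show ?thesis by (simp add: power2_diff)
    qed
    then show "AE x in lebesgue. norm (f x \<bullet> g x) \<le> norm ((cmod (f x))\<^sup>2 + (cmod (g x))\<^sup>2)"
      by (auto simp: abs_of_nonneg)
  qed measurable
qed

definition L2_rel :: "('a::euclidean_space \<Rightarrow> complex) \<Rightarrow> ('a \<Rightarrow> complex) \<Rightarrow> bool" where
  "L2_rel f g \<longleftrightarrow> sq_integrable f \<and> sq_integrable g \<and> (AE x in lebesgue. f x = g x)"

lemma part_equivp_L2_rel: "part_equivp (L2_rel :: ('a::euclidean_space \<Rightarrow> complex) \<Rightarrow> _)"
proof (rule part_equivpI)
  show "\<exists>f :: 'a \<Rightarrow> complex. L2_rel f f"
    by (rule exI[of _ "\<lambda>_. 0"]) (simp add: L2_rel_def sq_integrable_zero)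
  show "symp (L2_rel :: ('a \<Rightarrow> complex) \<Rightarrow> _)"
    by (rule sympI) (auto simp: L2_rel_def eq_commute)
  show "transp (L2_rel :: ('a \<Rightarrow> complex) \<Rightarrow> _)"
  proof (rule transpI)
    fix f g h :: "'a \<Rightarrow> complex"
    assume "L2_rel f g" and "L2_rel g h"
    moreover from this have "AE x in lebesgue. f x = h x"
      unfolding L2_rel_def by (elim conjE) (rule AE_mp, assumption, rule AE_mp, assumption, auto)
    ultimately show "L2_rel f h" by (simp add: L2_rel_def)
  qed
qed

quotient_type (overloaded) 'a L2 = "'a::euclidean_space \<Rightarrow> complex" / partial: L2_rel
  by (rule part_equivp_L2_rel)

lemma rep_L2_sq_integrable: "sq_integrable (rep_L2 u)"
  using Quotient3_rep_reflp[OF Quotient3_L2, of u] by (simp add: L2_rel_def)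

lemma rep_abs_L2:
  assumes "sq_integrable f"
  shows "AE x in lebesgue. rep_L2 (abs_L2 f) x = f x"
proof -
  have "L2_rel f f" using assms by (simp add: L2_rel_def)
  from Quotient3_rep_abs[OF Quotient3_L2, OF this] show ?thesis by (simp add: L2_rel_def)
qed

lemma L2_eqI:
  assumes "AE x in lebesgue. rep_L2 u x = rep_L2 v x"
  shows "u = v"
  using Quotient3_rel_rep[OF Quotient3_L2, of u v] assms
  by (simp add: L2_rel_def rep_L2_sq_integrable)

text \<open>The inner product below is the real part of the Hermitian one; it induces the usual
  norm. The complex structure is carried separately by \<open>scaleC_L2\<close>.\<close>

instantiation L2 :: (euclidean_space) real_inner
begin

lift_definition zero_L2 :: "'a L2" is "\<lambda>x. 0"
  by (simp add: L2_rel_def sq_integrable_zero)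

lift_definition plus_L2 :: "'a L2 \<Rightarrow> 'a L2 \<Rightarrow> 'a L2" is "\<lambda>f g x. f x + g x"
  by (auto simp: L2_rel_def intro: sq_integrable_add)

lift_definition minus_L2 :: "'a L2 \<Rightarrow> 'a L2 \<Rightarrow> 'a L2" is "\<lambda>f g x. f x - g x"
  by (auto simp: L2_rel_def intro: sq_integrable_diff)

lift_definition uminus_L2 :: "'a L2 \<Rightarrow> 'a L2" is "\<lambda>f x. - f x"
  by (auto simp: L2_rel_def intro: sq_integrable_uminus)

lift_definition scaleR_L2 :: "real \<Rightarrow> 'a L2 \<Rightarrow> 'a L2" is "\<lambda>c f x. complex_of_real c * f x"
  by (auto simp: L2_rel_def intro: sq_integrable_cmult)

lift_definition inner_L2 :: "'a L2 \<Rightarrow> 'a L2 \<Rightarrow> real" is "\<lambda>f g. LINT x|lebesgue. f x \<bullet> g x"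
proof -
  fix f f' g g' :: "'a \<Rightarrow> complex"
  assume "L2_rel f f'" "L2_rel g g'"
  then have [measurable]: "f \<in> borel_measurable lebesgue" "f' \<in> borel_measurable lebesgue"
      "g \<in> borel_measurable lebesgue" "g' \<in> borel_measurable lebesgue"
    and "AE x in lebesgue. f x = f' x" "AE x in lebesgue. g x = g' x"
    by (auto simp: L2_rel_def sq_integrable_def)
  then show "(LINT x|lebesgue. f x \<bullet> g x) = (LINT x|lebesgue. f' x \<bullet> g' x)"
    by (intro integral_cong_AE) auto
qed

lift_definition norm_L2 :: "'a L2 \<Rightarrow> real" is "\<lambda>f. sqrt (LINT x|lebesgue. (cmod (f x))\<^sup>2)"
proof -
  fix f f' :: "'a \<Rightarrow> complex"
  assume "L2_rel f f'"
  then have [measurable]: "f \<in> borel_measurable lebesgue" "f' \<in> borel_measurable lebesgue"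
    and "AE x in lebesgue. f x = f' x"
    by (auto simp: L2_rel_def sq_integrable_def)
  then have "(LINT x|lebesgue. (cmod (f x))\<^sup>2) = (LINT x|lebesgue. (cmod (f' x))\<^sup>2)"
    by (intro integral_cong_AE) auto
  then show "sqrt (LINT x|lebesgue. (cmod (f x))\<^sup>2) = sqrt (LINT x|lebesgue. (cmod (f' x))\<^sup>2)"
    by simp
qed

definition "sgn_L2 (u :: 'a L2) = inverse (norm u) *\<^sub>R u"

definition "dist_L2 (u :: 'a L2) v = norm (u - v)"

definition uniformity_L2 :: "('a L2 \<times> 'a L2) filter" where
  "uniformity_L2 = (INF e\<in>{0<..}. principal {(u, v). dist u v < e})"

definition open_L2 :: "'a L2 set \<Rightarrow> bool" where
  "open_L2 U \<longleftrightarrow> (\<forall>x\<in>U. \<forall>\<^sub>F (x', y) in uniformity. x' = x \<longrightarrow> y \<in> U)"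

instance
proof
  fix u v w :: "'a L2" and a b :: real
  show "u + v + w = u + (v + w)"
    by transfer (auto simp: L2_rel_def add.assoc intro!: sq_integrable_add)
  show "u + v = v + u"
    by transfer (auto simp: L2_rel_def add.commute intro!: sq_integrable_add)
  show "0 + u = u"
    by transfer (auto simp: L2_rel_def)
  show "- u + u = 0"
    by transfer (auto simp: L2_rel_def sq_integrable_zero)
  show "u - v = u + - v"
    by transfer (auto simp: L2_rel_def intro!: sq_integrable_diff)
  show "a *\<^sub>R (u + v) = a *\<^sub>R u + a *\<^sub>R v"
    by transfer
      (auto simp: L2_rel_def distrib_left intro!: sq_integrable_add sq_integrable_cmult)
  show "(a + b) *\<^sub>R u = a *\<^sub>R u + b *\<^sub>R u"
    by transfer
      (auto simp: L2_rel_def distrib_right intro!: sq_integrable_add sq_integrable_cmult)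
  show "a *\<^sub>R b *\<^sub>R u = (a * b) *\<^sub>R u"
    by transfer (auto simp: L2_rel_def mult.assoc intro!: sq_integrable_cmult)
  show "1 *\<^sub>R u = u"
    by transfer (auto simp: L2_rel_def)
  show "dist u v = norm (u - v)" by (rule dist_L2_def)
  show "sgn u = inverse (norm u) *\<^sub>R u" by (rule sgn_L2_def)
  show "uniformity = (INF e\<in>{0<..}. principal {(u::'a L2, v). dist u v < e})"
    by (rule uniformity_L2_def)
  show "open U \<longleftrightarrow> (\<forall>x\<in>U. \<forall>\<^sub>F (x', y) in uniformity. x' = x \<longrightarrow> y \<in> U)" for U :: "'a L2 set"
    by (rule open_L2_def)
  show "u \<bullet> v = v \<bullet> u"
    by transfer (simp add: inner_commute)
  show "(u + v) \<bullet> w = u \<bullet> w + v \<bullet> w"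
    by transfer (auto simp: L2_rel_def inner_add_left sq_integrable_inner)
  show "(a *\<^sub>R u) \<bullet> v = a * (u \<bullet> v)"
    by transfer (simp flip: scaleR_conv_of_real)
  show "0 \<le> u \<bullet> u"
    by transfer simp
  show "u \<bullet> u = 0 \<longleftrightarrow> u = 0"
  proof transfer
    fix f :: "'a \<Rightarrow> complex"
    assume "L2_rel f f"
    then have f: "sq_integrable f" by (simp add: L2_rel_def)
    have "(LINT x|lebesgue. f x \<bullet> f x) = 0 \<longleftrightarrow> (AE x in lebesgue. f x \<bullet> f x = 0)"
      by (rule integral_nonneg_eq_0_iff_AE) (auto intro: sq_integrable_inner f)
    then show "(LINT x|lebesgue. f x \<bullet> f x) = 0 \<longleftrightarrow> L2_rel f (\<lambda>x. 0)"
      using f by (simp add: L2_rel_def sq_integrable_zero)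
  qed
  show "norm u = sqrt (u \<bullet> u)"
    by transfer (simp add: power2_norm_eq_inner)
qed

end

lift_definition scaleC_L2 :: "complex \<Rightarrow> 'a::euclidean_space L2 \<Rightarrow> 'a L2" is "\<lambda>c f x. c * f x"
  by (auto simp: L2_rel_def intro: sq_integrable_cmult)

definition L2_operators :: "('a::euclidean_space L2 \<Rightarrow> 'a L2) set" where
  "L2_operators = {B. bounded_linear B \<and> (\<forall>c u. B (scaleC_L2 c u) = scaleC_L2 c (B u))}"

text \<open>Multiplication by the characteristic function of a Lebesgue measurable set; the value
  on non-measurable sets is a dummy.\<close>

lift_definition mult_indicator :: "'a::euclidean_space set \<Rightarrow> 'a L2 \<Rightarrow> 'a L2" is
  "\<lambda>\<omega> f. if \<omega> \<in> sets lebesgue then (\<lambda>x. indicator \<omega> x * f x) else (\<lambda>x. 0)"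
  by (auto simp: L2_rel_def sq_integrable_zero intro: sq_integrable_indicator)

definition fourier_integral :: "('a::euclidean_space \<Rightarrow> complex) \<Rightarrow> 'a \<Rightarrow> complex" where
  "fourier_integral f \<xi> = (LINT x|lebesgue. cis (- (x \<bullet> \<xi>)) * f x)"

text \<open>Plancherel's transform: \<open>w\<close> is the limit in mean square, as \<open>R\<close> tends to infinity, of
  the Fourier integrals of the truncations of \<open>u\<close> to the ball of radius \<open>R\<close>, which are
  integrable functions. The limit is written with the nonnegative integral, so that no
  integrability of the difference is presupposed.\<close>

definition has_fourier_transform ::
    "'a::euclidean_space L2 \<Rightarrow> 'a L2 \<Rightarrow> bool" where
  "has_fourier_transform u w \<longleftrightarrow>
     ((\<lambda>R::real. \<integral>\<^sup>+ \<xi>. ennreal ((cmod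
          (fourier_integral (\<lambda>x. indicator (cball 0 R) x * rep_L2 u x) \<xi> - rep_L2 w \<xi>))\<^sup>2)
        \<partial>lebesgue) \<longlongrightarrow> 0) at_top"

text \<open>Unbounded operators are represented by their graphs. Since the Plancherel transform is
  onto, \<open>u\<close> is in the domain of the multiplier exactly if the product of the symbol with the
  transform of \<open>u\<close> is square integrable.\<close>

definition fourier_multiplier ::
    "('a::euclidean_space \<Rightarrow> real) \<Rightarrow> ('a L2 \<times> 'a L2) set" where
  "fourier_multiplier m =
     {(u, v). \<exists>u' v'. has_fourier_transform u u' \<and> has_fourier_transform v v' \<and>
        (AE \<xi> in lebesgue. rep_L2 v' \<xi> = complex_of_real (m \<xi>) * rep_L2 u' \<xi>)}"

text \<open>Only the values of \<open>T t\<close> for nonnegative \<open>t\<close> are relevant.\<close>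

definition c0_semigroup :: "(real \<Rightarrow> 'a::euclidean_space L2 \<Rightarrow> 'a L2) \<Rightarrow> bool" where
  "c0_semigroup T \<longleftrightarrow>
     (\<forall>t\<ge>0. T t \<in> L2_operators) \<and>
     T 0 = id \<and>
     (\<forall>s\<ge>0. \<forall>t\<ge>0. T (s + t) = T s \<circ> T t) \<and>
     (\<forall>u. ((\<lambda>t. T t u) \<longlongrightarrow> u) (at_right 0))"

definition semigroup_generator ::
    "(real \<Rightarrow> 'a::euclidean_space L2 \<Rightarrow> 'a L2) \<Rightarrow> ('a L2 \<times> 'a L2) set" where
  "semigroup_generator T = {(u, v). ((\<lambda>t. (T t u - u) /\<^sub>R t) \<longlongrightarrow> v) (at_right 0)}"

text \<open>\<open>T\<close> is the semigroup generated by \<open>- (A + B)\<close>, where \<open>A\<close> is given by its graph and \<open>B\<close>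
  is everywhere defined. There is at most one such \<open>T\<close> on the nonnegative half-line.\<close>

definition generates_perturbed ::
    "('a::euclidean_space L2 \<times> 'a L2) set \<Rightarrow> ('a L2 \<Rightarrow> 'a L2) \<Rightarrow>
     (real \<Rightarrow> 'a L2 \<Rightarrow> 'a L2) \<Rightarrow> bool" where
  "generates_perturbed A B T \<longleftrightarrow>
     c0_semigroup T \<and> semigroup_generator T = {(u, - (v + B u)) |u v. (u, v) \<in> A}"

definition exp_stabilizable_at_rate ::
    "(real \<Rightarrow> real) \<Rightarrow> 'a::euclidean_space set \<Rightarrow> real \<Rightarrow> bool" where
  "exp_stabilizable_at_rate F \<omega> \<alpha> \<longleftrightarrow>
     (\<exists>M\<ge>1. \<exists>K\<in>L2_operators. \<exists>T.
        generates_perturbed (fourier_multiplier (\<lambda>\<xi>. F (norm \<xi>))) (mult_indicator \<omega> \<circ> K) T \<and>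
        (\<forall>t\<ge>0. onorm (T t) \<le> M * exp (- \<alpha> * t)))"

definition exp_stabilizable :: "(real \<Rightarrow> real) \<Rightarrow> 'a::euclidean_space set \<Rightarrow> bool" where
  "exp_stabilizable F \<omega> \<longleftrightarrow> (\<exists>\<alpha>>0. exp_stabilizable_at_rate F \<omega> \<alpha>)"

definition thick_at_scale :: "real \<Rightarrow> real \<Rightarrow> (real ^ 'n) set \<Rightarrow> bool" where
  "thick_at_scale \<gamma> L \<omega> \<longleftrightarrow>
     \<omega> \<in> sets lebesgue \<and>
     (\<forall>x. measure lebesgue (\<omega> \<inter> (+) x ` cbox 0 (\<chi> i. L)) \<ge> \<gamma> * L ^ CARD('n))"

definition thick :: "(real ^ 'n) set \<Rightarrow> bool" where
  "thick \<omega> \<longleftrightarrow> (\<exists>\<gamma> L. 0 < \<gamma> \<and> \<gamma> < 1 \<and> 0 < L \<and> thick_at_scale \<gamma> L \<omega>)"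

end

theory Submission
  imports Defs "HOL-Probability.Characteristic_Functions" "HOL-Computational_Algebra.Polynomial"
begin

text \<open>
  Write \<open>A\<close> for the multiplier \<open>F(|D|)\<close>, \<open>m \<le> 0\<close> for the infimum of \<open>F\<close>, and \<open>1\<^sub>\<omega>\<close> for
  multiplication by the indicator of \<open>\<omega>\<close>.

  Stabilizable implies thick. Let \<open>T\<close> be the exponentially stable semigroup of
  \<open>- (A + 1\<^sub>\<omega> K)\<close> and let \<open>g\<close> lie in the domain of \<open>A\<close>. The derivative of \<open>exp (m t) \<langle>T t g, g\<rangle>\<close>
  only involves the pairings of the orbit with \<open>(A - m) g\<close> and of its image under \<open>K\<close> with
  \<open>1\<^sub>\<omega> g\<close>, while the function itself is at most half its initial value at a suitable time,
  because \<open>m \<le> 0\<close> and \<open>T\<close> decays. Hence \<open>|g| \<le> C (|(A - m) g| + |1\<^sub>\<omega> g|)\<close>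
  (\<open>stabilizable_imp_observable\<close>). If the transform of \<open>g\<close> lives in a small ball on which
  \<open>F(|\<xi>|)\<close> is close to \<open>m\<close>, the first term is absorbed by the left-hand side. All translates
  of such a wave packet therefore keep a fixed part of their mass in \<open>\<omega>\<close>, and as the packet is
  bounded and square integrable, \<open>\<omega>\<close> has a fixed amount of measure in each translate of a large
  cube (\<open>stabilizable_imp_uniform_mass\<close>).

  Thick implies stabilizable. Choose \<open>\<mu> > 0\<close> and \<open>R\<close> with \<open>F \<ge> 2 \<mu>\<close> beyond \<open>R\<close>, and let \<open>P\<close> and \<open>Q\<close>
  project onto the frequencies in and outside the ball of radius \<open>R\<close>. By the Logvinenko--Sereda
  inequality (\<open>logvinenko_sereda\<close>), \<open>P 1\<^sub>\<omega> P\<close> is invertible on the range of \<open>P\<close>, so there is a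
  bounded \<open>K = K P\<close> with \<open>P 1\<^sub>\<omega> K = (\<mu> - A) P\<close>: the low frequencies now decay exactly at rate
  \<open>\<mu>\<close>. They still drive the high ones through \<open>Q 1\<^sub>\<omega> K\<close>, but this coupling is removed by a
  similarity: with \<open>G = (A - \<mu>)\<^sup>-\<^sup>1 Q 1\<^sub>\<omega> K\<close>, which is bounded and satisfies \<open>G G = 0\<close>,
  \<open>A + 1\<^sub>\<omega> K = (1 - G) (\<mu> P + A Q) (1 + G)\<close>.
  The closed-loop semigroup is thus conjugate to an explicit multiplier semigroup with symbol
  at least \<open>\<mu>\<close> (\<open>stabilizable_if_low_frequencies_observable\<close>).

  The Logvinenko--Sereda inequality is obtained from a Remez-type bound on cubes: on a line, a
  function with spectrum in a ball is extremely well approximated by its Lagrange interpolation at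
  separated points of a set of positive measure, and this passes to cubes coordinate by
  coordinate (\<open>cube_induction\<close>, \<open>band_limited_remez\<close>). To use it near a given cube, the function
  is multiplied by a decaying window whose transform has compact support; this keeps it
  band-limited, and averaging over all positions of the cube recovers the global estimate.

  All of this rests on the Fourier transform as a multiple of a unitary operator. It is built
  from Plancherel's identity for bounded integrable functions (\<open>plancherel_bounded\<close>), completeness
  of \<open>L\<^sup>2\<close> and truncation, and is identified with the transform defined by mean-square limits in
  \<open>has_fourier_transform_iff\<close>.
\<close>

section \<open>The Hilbert space of square-integrable functions\<close>

lemma rep_L2_measurable [measurable]: "rep_L2 u \<in> borel_measurable lebesgue"
  using rep_L2_sq_integrable[of u] by (simp add: sq_integrable_def)

lemma rep_L2_integrable: "integrable lebesgue (\<lambda>x. (cmod (rep_L2 u x))\<^sup>2)"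
  using rep_L2_sq_integrable[of u] by (simp add: sq_integrable_def)

lemma inner_L2_eq: "u \<bullet> v = (LINT x|lebesgue. rep_L2 u x \<bullet> rep_L2 v x)"
  by (simp add: inner_L2_def)

lemma norm_L2_eq: "norm u = sqrt (LINT x|lebesgue. (cmod (rep_L2 u x))\<^sup>2)"
  by (simp add: norm_L2_def)

lemma norm_L2_power2: "(norm u)\<^sup>2 = (LINT x|lebesgue. (cmod (rep_L2 u x))\<^sup>2)"
  by (simp add: norm_L2_eq)

lemma norm_L2_nn: "ennreal ((norm u)\<^sup>2) = (\<integral>\<^sup>+x. ennreal ((cmod (rep_L2 u x))\<^sup>2) \<partial>lebesgue)"
  unfolding norm_L2_power2 by (rule nn_integral_eq_integral[symmetric]) (auto simp: rep_L2_integrable)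

lemma rep_L2_add: "AE x in lebesgue. rep_L2 (u + v) x = rep_L2 u x + rep_L2 v x"
  unfolding plus_L2_def
  using rep_abs_L2[OF sq_integrable_add[OF rep_L2_sq_integrable rep_L2_sq_integrable]] by simp

lemma rep_L2_diff: "AE x in lebesgue. rep_L2 (u - v) x = rep_L2 u x - rep_L2 v x"
  unfolding minus_L2_def
  using rep_abs_L2[OF sq_integrable_diff[OF rep_L2_sq_integrable rep_L2_sq_integrable]] by simp

lemma rep_L2_zero: "AE x in lebesgue. rep_L2 0 x = 0"
  unfolding zero_L2_def using rep_abs_L2[OF sq_integrable_zero] by simp

lemma rep_L2_scaleR: "AE x in lebesgue. rep_L2 (c *\<^sub>R u) x = complex_of_real c * rep_L2 u x"
  unfolding scaleR_L2_def
  using rep_abs_L2[OF sq_integrable_cmult[OF rep_L2_sq_integrable]] by simp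

lemma rep_L2_scaleC: "AE x in lebesgue. rep_L2 (scaleC_L2 c u) x = c * rep_L2 u x"
  unfolding scaleC_L2_def
  using rep_abs_L2[OF sq_integrable_cmult[OF rep_L2_sq_integrable]] by simp

lemma scaleC_L2_of_real: "scaleC_L2 (complex_of_real c) u = c *\<^sub>R u"
  by (rule L2_eqI, use rep_L2_scaleC[of "complex_of_real c" u] rep_L2_scaleR[of c u] in eventually_elim) auto

lemma rep_mult_indicator:
  assumes "\<omega> \<in> sets lebesgue"
  shows "AE x in lebesgue. rep_L2 (mult_indicator \<omega> u) x = indicator \<omega> x * rep_L2 u x"
  unfolding mult_indicator_def
  using rep_abs_L2[OF sq_integrable_indicator[OF rep_L2_sq_integrable assms]] assms by simp

lemma sq_integrable_bound:
  assumes "sq_integrable g" "f \<in> borel_measurable lebesgue" "AE x in lebesgue. cmod (f x) \<le> c * cmod (g x)"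
  shows "sq_integrable f"
proof -
  have [measurable]: "f \<in> borel_measurable lebesgue" using assms by simp
  have "integrable lebesgue (\<lambda>x. c\<^sup>2 * (cmod (g x))\<^sup>2)"
    using assms by (simp add: sq_integrable_def)
  then have "integrable lebesgue (\<lambda>x. (cmod (f x))\<^sup>2)"
  proof (rule Bochner_Integration.integrable_bound)
    show "AE x in lebesgue. norm ((cmod (f x))\<^sup>2) \<le> norm (c\<^sup>2 * (cmod (g x))\<^sup>2)"
      using assms(3) by eventually_elim (metis abs_ge_zero abs_power2 norm_ge_zero power_mono power_mult_distrib real_norm_def)
  qed measurable
  then show ?thesis using assms by (simp add: sq_integrable_def)
qed

lemma norm_L2_le:
  assumes "AE x in lebesgue. cmod (rep_L2 u x) \<le> c * cmod (rep_L2 v x)" "c \<ge> 0"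
  shows "norm u \<le> c * norm v"
proof -
  have "(norm u)\<^sup>2 \<le> (LINT x|lebesgue. c\<^sup>2 * (cmod (rep_L2 v x))\<^sup>2)"
    unfolding norm_L2_power2
  proof (rule integral_mono_AE)
    show "AE x in lebesgue. (cmod (rep_L2 u x))\<^sup>2 \<le> c\<^sup>2 * (cmod (rep_L2 v x))\<^sup>2"
      using assms(1) by eventually_elim (metis norm_ge_zero power_mono power_mult_distrib)
  qed (auto simp: rep_L2_integrable)
  also have "\<dots> = (c * norm v)\<^sup>2" by (simp add: norm_L2_power2 power_mult_distrib)
  finally show ?thesis by (rule power2_le_imp_le) (use assms in auto)
qed

lemma norm_L2_cong:
  assumes "AE x in lebesgue. cmod (rep_L2 u x) = cmod (rep_L2 v x)"
  shows "norm u = norm v"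
proof (rule antisym)
  have "AE x in lebesgue. cmod (rep_L2 u x) \<le> 1 * cmod (rep_L2 v x)"
    using assms by eventually_elim simp
  from norm_L2_le[OF this] show "norm u \<le> norm v" by simp
  have "AE x in lebesgue. cmod (rep_L2 v x) \<le> 1 * cmod (rep_L2 u x)"
    using assms by eventually_elim simp
  from norm_L2_le[OF this] show "norm v \<le> norm u" by simp
qed

lemma norm_scaleC_L2: "norm (scaleC_L2 c u) = cmod c * norm u"
proof -
  have "norm (scaleC_L2 c u) = norm (cmod c *\<^sub>R u)"
    by (rule norm_L2_cong, use rep_L2_scaleC[of c u] rep_L2_scaleR[of "cmod c" u] in eventually_elim) (auto simp: norm_mult)
  then show ?thesis by simp
qed

lemma scaleC_L2_add: "scaleC_L2 c (u + v) = scaleC_L2 c u + scaleC_L2 c v"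
  by (rule L2_eqI, use rep_L2_scaleC[of c "u+v"] rep_L2_scaleC[of c u] rep_L2_scaleC[of c v]
     rep_L2_add[of u v] rep_L2_add[of "scaleC_L2 c u" "scaleC_L2 c v"] in eventually_elim) (auto simp: distrib_left)

lemma scaleC_L2_diff: "scaleC_L2 c (u - v) = scaleC_L2 c u - scaleC_L2 c v"
  by (rule L2_eqI, use rep_L2_scaleC[of c "u-v"] rep_L2_scaleC[of c u] rep_L2_scaleC[of c v]
     rep_L2_diff[of u v] rep_L2_diff[of "scaleC_L2 c u" "scaleC_L2 c v"] in eventually_elim) (auto simp: right_diff_distrib)

lemma tendsto_L2_iff_nn_integral:
  "((\<lambda>i. X i) \<longlongrightarrow> u) F \<longleftrightarrow> ((\<lambda>i. \<integral>\<^sup>+x. ennreal ((cmod (rep_L2 (X i) x - rep_L2 u x))\<^sup>2) \<partial>lebesgue) \<longlongrightarrow> 0) F"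
proof -
  have eq: "(\<integral>\<^sup>+x. ennreal ((cmod (rep_L2 (X i) x - rep_L2 u x))\<^sup>2) \<partial>lebesgue) = ennreal ((norm (X i - u))\<^sup>2)" for i
    unfolding norm_L2_nn
    by (intro nn_integral_cong_AE, use rep_L2_diff[of "X i" u] in eventually_elim) auto
  have "((\<lambda>i. ennreal ((norm (X i - u))\<^sup>2)) \<longlongrightarrow> ennreal 0) F \<longleftrightarrow> ((\<lambda>i. (norm (X i - u))\<^sup>2) \<longlongrightarrow> 0) F"
    by (rule tendsto_ennreal_iff) auto
  also have "\<dots> \<longleftrightarrow> ((\<lambda>i. norm (X i - u)) \<longlongrightarrow> 0) F"
    using tendsto_power[of "\<lambda>i. norm (X i - u)" 0 F 2] tendsto_real_sqrt[of "\<lambda>i. (norm (X i - u))\<^sup>2" 0 F] by auto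
  also have "\<dots> \<longleftrightarrow> (X \<longlongrightarrow> u) F"
    by (metis LIM_zero_iff tendsto_norm_zero_iff)
  finally show ?thesis unfolding eq by simp
qed

lemma L2_dominated_convergence:
  assumes lim: "AE x in lebesgue. (\<lambda>i. rep_L2 (X i) x) \<longlonglongrightarrow> rep_L2 u x"
    and bd: "\<And>i. AE x in lebesgue. cmod (rep_L2 (X i) x - rep_L2 u x) \<le> c * cmod (rep_L2 w x)"
  shows "X \<longlonglongrightarrow> u"
  unfolding tendsto_L2_iff_nn_integral
proof -
  have "(\<lambda>i. \<integral>\<^sup>+x. ennreal ((cmod (rep_L2 (X i) x - rep_L2 u x))\<^sup>2) \<partial>lebesgue) \<longlonglongrightarrow> (\<integral>\<^sup>+x. (\<lambda>_::'a. 0) x \<partial>lebesgue)"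
  proof (rule nn_integral_dominated_convergence[where w = "\<lambda>x. ennreal (c\<^sup>2 * (cmod (rep_L2 w x))\<^sup>2)"])
    show "AE x in lebesgue. ennreal ((cmod (rep_L2 (X i) x - rep_L2 u x))\<^sup>2) \<le> ennreal (c\<^sup>2 * (cmod (rep_L2 w x))\<^sup>2)" for i
      using bd[of i] by eventually_elim (metis ennreal_leI norm_ge_zero power_mono power_mult_distrib)
    have "integrable lebesgue (\<lambda>x. c\<^sup>2 * (cmod (rep_L2 w x))\<^sup>2)" by (simp add: rep_L2_integrable)
    then show "(\<integral>\<^sup>+ x. ennreal (c\<^sup>2 * (cmod (rep_L2 w x))\<^sup>2) \<partial>lebesgue) < \<infinity>"
      by (subst nn_integral_eq_integral) auto
    show "AE x in lebesgue. (\<lambda>i. ennreal ((cmod (rep_L2 (X i) x - rep_L2 u x))\<^sup>2)) \<longlonglongrightarrow> 0"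
      using lim
    proof eventually_elim
      case (elim x)
      then have "(\<lambda>i. rep_L2 (X i) x - rep_L2 u x) \<longlonglongrightarrow> 0" by (simp add: LIM_zero_iff)
      then have "(\<lambda>i. (cmod (rep_L2 (X i) x - rep_L2 u x))\<^sup>2) \<longlonglongrightarrow> 0"
        by (metis tendsto_norm_zero tendsto_power zero_power2)
      then show ?case by (metis ennreal_0 tendsto_ennrealI)
    qed
  qed measurable
  then show "(\<lambda>i. \<integral>\<^sup>+x. ennreal ((cmod (rep_L2 (X i) x - rep_L2 u x))\<^sup>2) \<partial>lebesgue) \<longlonglongrightarrow> 0"
    by simp
qed

lemma L2_tendsto_AE_subseq:
  assumes "X \<longlonglongrightarrow> u"
  obtains r :: "nat \<Rightarrow> nat" where "strict_mono r" "AE x in lebesgue. (\<lambda>i. rep_L2 (X (r i)) x) \<longlonglongrightarrow> rep_L2 u x"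
proof -
  have "(\<lambda>n. (norm (X n - u))\<^sup>2) \<longlonglongrightarrow> 0"
    using assms by (metis LIM_zero tendsto_norm_zero tendsto_power zero_power2)
  then have "(\<lambda>n. LINT x|lebesgue. norm ((cmod (rep_L2 (X n - u) x))\<^sup>2)) \<longlonglongrightarrow> 0"
    by (simp add: norm_L2_power2)
  from tendsto_L1_AE_subseq[OF rep_L2_integrable this] obtain r where r: "strict_mono r"
    "AE x in lebesgue. (\<lambda>n. (cmod (rep_L2 (X (r n) - u) x))\<^sup>2) \<longlonglongrightarrow> 0" by auto
  have "AE x in lebesgue. \<forall>n. rep_L2 (X (r n) - u) x = rep_L2 (X (r n)) x - rep_L2 u x"
    unfolding AE_all_countable using rep_L2_diff by auto
  with r(2) have "AE x in lebesgue. (\<lambda>i. rep_L2 (X (r i)) x) \<longlonglongrightarrow> rep_L2 u x"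
  proof eventually_elim
    case (elim x)
    then have "(\<lambda>n. sqrt ((cmod (rep_L2 (X (r n)) x - rep_L2 u x))\<^sup>2)) \<longlonglongrightarrow> 0"
      using tendsto_real_sqrt[OF elim(1)] by simp
    then show ?case by (simp add: LIM_zero_iff tendsto_norm_zero_iff)
  qed
  with r that show ?thesis by blast
qed

lemma ennreal_le_suminf: "f k \<le> suminf f" for f :: "nat \<Rightarrow> ennreal"
  using sum_le_suminf[of f "{k}"] by simp

text \<open>Put \<open>d\<^sub>k = X\<^sub>k\<^sub>+\<^sub>1 - X\<^sub>k\<close>. The series \<open>\<Sum>k. 2\<^sup>k |d\<^sub>k|\<^sup>2\<close> has a finite integral, because the squared
  norms are at most \<open>1/4\<^sup>k\<close>. So almost everywhere \<open>|d\<^sub>k|\<close> is dominated by a geometric sequence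
  with ratio \<open>sqrt (1/2)\<close>.\<close>
lemma L2_summable_AE_convergent:
  fixes X :: "nat \<Rightarrow> 'a::euclidean_space L2"
  assumes "\<And>k. norm (X (Suc k) - X k) \<le> (1/2)^k"
  shows "AE x in lebesgue. convergent (\<lambda>k. rep_L2 (X k) x)"
proof -
  let ?d = "\<lambda>k x. cmod (rep_L2 (X (Suc k) - X k) x)"
  have "(\<integral>\<^sup>+x. (\<Sum>k. ennreal (2^k * (?d k x)\<^sup>2)) \<partial>lebesgue) = (\<Sum>k. \<integral>\<^sup>+x. ennreal (2^k * (?d k x)\<^sup>2) \<partial>lebesgue)"
    by (rule nn_integral_suminf) measurable
  also have "\<dots> = (\<Sum>k. ennreal (2^k * (norm (X (Suc k) - X k))\<^sup>2))"
    by (intro suminf_cong) (simp add: ennreal_mult nn_integral_cmult norm_L2_nn[symmetric])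
  also have "\<dots> \<le> (\<Sum>k. ennreal ((1/2)^k))"
  proof (rule suminf_le)
    fix k
    have "2^k * (norm (X (Suc k) - X k))\<^sup>2 \<le> 2^k * ((1/2)^k)\<^sup>2"
      by (intro mult_left_mono power_mono assms) auto
    also have "\<dots> = (1/2)^k"
      by (simp add: power2_eq_square flip: power_mult_distrib)
    finally show "ennreal (2^k * (norm (X (Suc k) - X k))\<^sup>2) \<le> ennreal ((1/2)^k)" by (rule ennreal_leI)
  qed auto
  also have "\<dots> < \<infinity>" by (subst suminf_ennreal2) auto
  finally have "AE x in lebesgue. (\<Sum>k. ennreal (2^k * (?d k x)\<^sup>2)) \<noteq> \<infinity>"
    by (intro nn_integral_PInf_AE) auto
  moreover have "AE x in lebesgue. \<forall>k. rep_L2 (X (Suc k) - X k) x = rep_L2 (X (Suc k)) x - rep_L2 (X k) x"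
    unfolding AE_all_countable using rep_L2_diff by auto
  ultimately show ?thesis
  proof eventually_elim
    case (elim x)
    define S where "S = enn2real (\<Sum>k. ennreal (2^k * (?d k x)\<^sup>2))"
    have b: "?d k x \<le> sqrt S * (sqrt (1/2))^k" for k
    proof -
      have "ennreal (2^k * (?d k x)\<^sup>2) \<le> (\<Sum>k. ennreal (2^k * (?d k x)\<^sup>2))"
        by (rule ennreal_le_suminf)
      then have "2^k * (?d k x)\<^sup>2 \<le> S"
        unfolding S_def using elim(1) enn2real_mono[of "ennreal (2^k * (?d k x)\<^sup>2)"]
        by (simp add: top.not_eq_extremum)
      then have "sqrt ((?d k x)\<^sup>2) \<le> sqrt (S * (1/2)^k)"
        by (intro real_sqrt_le_mono) (simp add: field_simps power_one_over)
      then show ?thesis by (simp add: real_sqrt_mult real_sqrt_power)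
    qed
    have "summable (\<lambda>k. rep_L2 (X (Suc k)) x - rep_L2 (X k) x)"
    proof (rule summable_comparison_test'[where N=0])
      have "norm (sqrt (1/2)) < 1" by (simp add: real_sqrt_divide)
      then show "summable (\<lambda>k. sqrt S * (sqrt (1/2))^k)"
        by (intro summable_mult summable_geometric)
      show "norm (rep_L2 (X (Suc k)) x - rep_L2 (X k) x) \<le> sqrt S * (sqrt (1/2))^k" for k
        using b[of k] elim(2) by simp
    qed
    then have "convergent (\<lambda>n. \<Sum>k<n. rep_L2 (X (Suc k)) x - rep_L2 (X k) x)"
      by (simp add: summable_iff_convergent)
    then have "convergent (\<lambda>n. rep_L2 (X n) x - rep_L2 (X 0) x)"
      by (subst (asm) sum_lessThan_telescope)
    then have "convergent (\<lambda>n. (rep_L2 (X n) x - rep_L2 (X 0) x) + rep_L2 (X 0) x)"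
      by (intro convergent_add convergent_const)
    then show ?case by simp
  qed
qed

lemma Cauchy_fast_subseq:
  fixes X :: "nat \<Rightarrow> 'a::real_normed_vector"
  assumes "Cauchy X"
  obtains r :: "nat \<Rightarrow> nat" where "strict_mono r" "\<And>k j. j \<ge> k \<Longrightarrow> norm (X (r j) - X (r k)) \<le> (1/2)^k"
proof -
  have "\<forall>k. \<exists>N. \<forall>m\<ge>N. \<forall>n\<ge>N. norm (X m - X n) < (1/2)^k"
    using assms unfolding Cauchy_iff by auto
  then obtain N where N: "\<And>k m n. m \<ge> N k \<Longrightarrow> n \<ge> N k \<Longrightarrow> norm (X m - X n) < (1/2)^k" by metis
  define r where "r = rec_nat (N 0) (\<lambda>k rk. max (Suc rk) (N (Suc k)))"
  have r: "r 0 = N 0" "r (Suc k) = max (Suc (r k)) (N (Suc k))" for k by (simp_all add: r_def)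
  have "strict_mono r" by (rule strict_mono_Suc_iff[THEN iffD2]) (simp add: r less_max_iff_disj)
  moreover have "r k \<ge> N k" for k by (cases k) (auto simp: r)
  ultimately show ?thesis
    using that[of r] N by (meson less_imp_le order_trans strict_mono_leD)
qed

text \<open>Riesz--Fischer: a rapidly converging subsequence converges almost everywhere, and Fatou's
  lemma shows that the pointwise limit is also its limit in mean.\<close>
instance L2 :: (euclidean_space) banach
proof
  fix X :: "nat \<Rightarrow> 'a L2"
  assume X: "Cauchy X"
  obtain r where r: "strict_mono r" and fast: "\<And>k j. j \<ge> k \<Longrightarrow> norm (X (r j) - X (r k)) \<le> (1/2)^k"
    using Cauchy_fast_subseq[OF X] by metis
  define Y where "Y k = X (r k)" for k
  have "AE x in lebesgue. convergent (\<lambda>k. rep_L2 (Y k) x)"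
    by (rule L2_summable_AE_convergent) (simp add: Y_def fast)
  then have lim: "AE x in lebesgue. (\<lambda>k. rep_L2 (Y k) x) \<longlonglongrightarrow> lim (\<lambda>k. rep_L2 (Y k) x)"
    by eventually_elim (simp add: convergent_LIMSEQ_iff)
  define f where "f x = lim (\<lambda>k. rep_L2 (Y k) x)" for x
  have [measurable]: "f \<in> borel_measurable lebesgue"
    unfolding f_def by measurable
  have fat: "(\<integral>\<^sup>+x. ennreal ((cmod (rep_L2 (Y k) x - f x))\<^sup>2) \<partial>lebesgue) \<le> ennreal (((1/2)^k)\<^sup>2)" for k
  proof -
    have "(\<integral>\<^sup>+x. ennreal ((cmod (rep_L2 (Y k) x - f x))\<^sup>2) \<partial>lebesgue)
       = (\<integral>\<^sup>+x. liminf (\<lambda>j. ennreal ((cmod (rep_L2 (Y k) x - rep_L2 (Y j) x))\<^sup>2)) \<partial>lebesgue)"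
    proof (rule nn_integral_cong_AE, use lim in eventually_elim)
      case (elim x)
      then have "(\<lambda>j. ennreal ((cmod (rep_L2 (Y k) x - rep_L2 (Y j) x))\<^sup>2)) \<longlonglongrightarrow> ennreal ((cmod (rep_L2 (Y k) x - f x))\<^sup>2)"
        unfolding f_def by (intro tendsto_ennrealI tendsto_intros)
      from lim_imp_Liminf[OF trivial_limit_sequentially this] show ?case by simp
    qed
    also have "\<dots> \<le> liminf (\<lambda>j. \<integral>\<^sup>+x. ennreal ((cmod (rep_L2 (Y k) x - rep_L2 (Y j) x))\<^sup>2) \<partial>lebesgue)"
      by (rule nn_integral_liminf) measurable
    also have "\<dots> = liminf (\<lambda>j. ennreal ((norm (Y k - Y j))\<^sup>2))"
    proof (rule arg_cong[where f=liminf], rule ext)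
      fix j
      show "(\<integral>\<^sup>+x. ennreal ((cmod (rep_L2 (Y k) x - rep_L2 (Y j) x))\<^sup>2) \<partial>lebesgue) = ennreal ((norm (Y k - Y j))\<^sup>2)"
        unfolding norm_L2_nn
        by (rule nn_integral_cong_AE, use rep_L2_diff[of "Y k" "Y j"] in eventually_elim) simp
    qed
    also have "\<dots> \<le> limsup (\<lambda>j. ennreal ((norm (Y k - Y j))\<^sup>2))"
      by (rule Liminf_le_Limsup) auto
    also have "\<dots> \<le> ennreal (((1/2)^k)\<^sup>2)"
    proof (rule Limsup_bounded, use eventually_ge_at_top[of k] in eventually_elim)
      case (elim j)
      show ?case using fast[OF elim] by (intro ennreal_leI power_mono) (auto simp: Y_def norm_minus_commute)
    qed
    finally show ?thesis .
  qed
  have "(\<integral>\<^sup>+x. ennreal ((cmod (rep_L2 (Y 0) x - f x))\<^sup>2) \<partial>lebesgue) < \<infinity>"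
    using fat[of 0] by (auto simp: le_less_trans)
  then have "sq_integrable (\<lambda>x. rep_L2 (Y 0) x - f x)"
    by (auto simp: sq_integrable_def integrable_iff_bounded)
  from sq_integrable_diff[OF rep_L2_sq_integrable[of "Y 0"] this] have f: "sq_integrable f"
    by simp
  have "Y \<longlonglongrightarrow> abs_L2 f"
    unfolding tendsto_L2_iff_nn_integral
  proof (rule tendsto_sandwich[of "\<lambda>_. 0"])
    have "(\<lambda>k. ennreal (((1/2)^k)\<^sup>2)) \<longlonglongrightarrow> ennreal (0\<^sup>2)"
      by (intro tendsto_ennrealI tendsto_power LIMSEQ_power_zero) auto
    then show "(\<lambda>k. ennreal (((1/2)^k)\<^sup>2)) \<longlonglongrightarrow> 0" by simp
    have "(\<integral>\<^sup>+x. ennreal ((cmod (rep_L2 (Y k) x - rep_L2 (abs_L2 f) x))\<^sup>2) \<partial>lebesgue)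
       = (\<integral>\<^sup>+x. ennreal ((cmod (rep_L2 (Y k) x - f x))\<^sup>2) \<partial>lebesgue)" for k
      by (intro nn_integral_cong_AE, use rep_abs_L2[OF f] in eventually_elim) auto
    then show "\<forall>\<^sub>F k in sequentially. (\<integral>\<^sup>+x. ennreal ((cmod (rep_L2 (Y k) x - rep_L2 (abs_L2 f) x))\<^sup>2) \<partial>lebesgue) \<le> ennreal (((1/2)^k)\<^sup>2)"
      using fat by auto
  qed auto
  then show "convergent X"
    using Cauchy_converges_subseq[OF X r] unfolding Y_def by (auto simp: convergent_def o_def)
qed

text \<open>Fubini's theorem will be applied to expressions such as \<open>f (x - y)\<close>, which are jointly Borel
  measurable when \<open>f\<close> is. Hence every class is represented by a Borel function.\<close>
lemma L2_borel_representative: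
  obtains f where "f \<in> borel_measurable borel" "AE x in lebesgue. rep_L2 u x = f x"
proof -
  have "(\<lambda>x. Re (rep_L2 u x)) \<in> borel_measurable (completion lborel)" by measurable
  from completion_ex_borel_measurable_real[OF this] obtain a where
    a: "a \<in> borel_measurable lborel" "AE x in lborel. Re (rep_L2 u x) = a x" by auto
  have "(\<lambda>x. Im (rep_L2 u x)) \<in> borel_measurable (completion lborel)" by measurable
  from completion_ex_borel_measurable_real[OF this] obtain b where
    b: "b \<in> borel_measurable lborel" "AE x in lborel. Im (rep_L2 u x) = b x" by auto
  have [measurable]: "a \<in> borel_measurable borel" "b \<in> borel_measurable borel"
    using a b by auto
  have "(\<lambda>x. Complex (a x) (b x)) \<in> borel_measurable borel"
    unfolding Complex_eq by measurable
  moreover have "AE x in lebesgue. rep_L2 u x = Complex (a x) (b x)"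
    using AE_completion[OF a(2)] AE_completion[OF b(2)]
    by eventually_elim (auto simp: complex_eq_iff)
  ultimately show ?thesis using that by blast
qed

lemma borel_imp_lebesgue_measurable:
  "f \<in> borel_measurable borel \<Longrightarrow> f \<in> borel_measurable lebesgue"
  by (simp add: measurable_completion)

lemma sq_integrable_borel:
  assumes "f \<in> borel_measurable borel"
  shows "sq_integrable f \<longleftrightarrow> integrable lborel (\<lambda>x. (cmod (f x))\<^sup>2)"
proof -
  have [measurable]: "f \<in> borel_measurable borel" by fact
  have "(\<lambda>x. (cmod (f x))\<^sup>2) \<in> lborel \<rightarrow>\<^sub>M borel" by measurable
  from integrable_completion[OF this] show ?thesis
    using borel_imp_lebesgue_measurable[OF assms] by (auto simp: sq_integrable_def)
qed

section \<open>Translations, dilations and coordinate products\<close>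
lemma lborel_distr_translate: "distr lborel borel (\<lambda>x. x - t) = (lborel :: 'a::euclidean_space measure)"
proof -
  have "(+) (- t) = (\<lambda>x. x - t)" by (auto simp: algebra_simps)
  then show ?thesis using lborel_distr_plus[of "- t"] by simp
qed

lemma integral_lborel_translate:
  fixes f :: "'a::euclidean_space \<Rightarrow> 'b::{banach, second_countable_topology}"
  assumes [measurable]: "f \<in> borel_measurable borel"
  shows "(LINT x|lborel. f (x - t)) = (LINT x|lborel. f x)"
  by (subst (2) lborel_distr_translate[of t, symmetric]) (simp add: integral_distr)

lemma integrable_lborel_translate:
  fixes f :: "'a::euclidean_space \<Rightarrow> 'b::{banach, second_countable_topology}"
  assumes [measurable]: "f \<in> borel_measurable borel" and "integrable lborel f"
  shows "integrable lborel (\<lambda>x. f (x - t))"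
proof -
  have "integrable (distr lborel borel (\<lambda>x. x - t)) f"
    using assms by (simp add: lborel_distr_translate)
  then show ?thesis by (subst (asm) integrable_distr_eq) auto
qed

lemma lborel_affine':
  assumes "a \<noteq> 0"
  shows "lborel = density (distr lborel borel (\<lambda>x. t + a *\<^sub>R x)) (\<lambda>_::'a::euclidean_space. ennreal (\<bar>a\<bar>^DIM('a)))"
  using lborel_affine[OF assms, of t] by simp

lemma integral_lborel_affine:
  fixes f :: "'a::euclidean_space \<Rightarrow> 'b::{banach, second_countable_topology}"
  assumes [measurable]: "f \<in> borel_measurable borel" and "a \<noteq> 0"
  shows "(LINT x|lborel. f x) = \<bar>a\<bar>^DIM('a) *\<^sub>R (LINT x|lborel. f (t + a *\<^sub>R x))"
  by (subst lborel_affine'[OF assms(2), of t])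
     (simp add: integral_density integral_distr)

lemma integrable_lborel_affine:
  fixes f :: "'a::euclidean_space \<Rightarrow> 'b::{banach, second_countable_topology}"
  assumes [measurable]: "f \<in> borel_measurable borel" and "a \<noteq> 0" and f: "integrable lborel f"
  shows "integrable lborel (\<lambda>x. f (t + a *\<^sub>R x))"
proof -
  have "integrable (density (distr lborel borel (\<lambda>x. t + a *\<^sub>R x)) (\<lambda>_::'a. ennreal (\<bar>a\<bar>^DIM('a)))) f"
    using f by (subst lborel_affine'[OF assms(2), of t, symmetric])
  then have "integrable (distr lborel borel (\<lambda>x. t + a *\<^sub>R x)) (\<lambda>x. (\<bar>a\<bar>^DIM('a)) *\<^sub>R f x)"
    by (subst (asm) integrable_density) auto
  then have "integrable lborel (\<lambda>x. (\<bar>a\<bar>^DIM('a)) *\<^sub>R f (t + a *\<^sub>R x))"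
    by (subst (asm) integrable_distr_eq) auto
  from integrable_scaleR_right[of "1 / \<bar>a\<bar>^DIM('a)", OF this] show ?thesis using \<open>a \<noteq> 0\<close> by simp
qed

lemma lborel_coordinate_product:
  fixes f :: "'a::euclidean_space \<Rightarrow> real \<Rightarrow> complex"
  assumes f: "\<And>b. b \<in> Basis \<Longrightarrow> integrable lborel (f b)"
  shows "integrable lborel (\<lambda>x::'a. \<Prod>b\<in>Basis. f b (x \<bullet> b))" (is ?I)
    and "(LINT x|lborel. (\<Prod>b\<in>Basis. f b ((x::'a) \<bullet> b))) = (\<Prod>b\<in>Basis. LINT y|lborel. f b y)" (is ?E)
proof -
  interpret product_sigma_finite "\<lambda>_::'a. lborel :: real measure" by standard
  have [measurable]: "f b \<in> borel_measurable borel" if "b \<in> Basis" for b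
    using f[OF that] by auto
  have eq: "(\<Prod>b\<in>Basis. f b ((\<Sum>c\<in>Basis. y c *\<^sub>R c) \<bullet> b)) = (\<Prod>b\<in>Basis. f b (y b))" for y :: "'a \<Rightarrow> real"
    by (intro prod.cong refl) (simp add: inner_sum_left inner_Basis if_distrib cong: if_cong)
  have m: "(\<lambda>x::'a. \<Prod>b\<in>Basis. f b (x \<bullet> b)) \<in> borel_measurable borel" by measurable
  have m2: "(\<lambda>y. \<Sum>c\<in>Basis. y c *\<^sub>R c :: 'a) \<in> PiM Basis (\<lambda>_. lborel) \<rightarrow>\<^sub>M borel" by measurable
  show ?I
    by (subst lborel_eq, subst integrable_distr_eq[OF m2 m])
       (simp only: eq, intro product_integrable_prod f, auto)
  show ?E
    by (subst lborel_eq, subst integral_distr[OF m2 m])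
       (simp only: eq, intro product_integral_prod f, auto)
qed

section \<open>Fourier integrals and the Gaussian\<close>

lemma cis_measurable [measurable (raw)]: "g \<in> borel_measurable M \<Longrightarrow> (\<lambda>x. cis (g x)) \<in> borel_measurable M"
  by (rule measurable_compose[OF _ borel_measurable_continuous_onI]) (auto intro!: continuous_intros)

lemma cnj_measurable [measurable (raw)]: "g \<in> borel_measurable M \<Longrightarrow> (\<lambda>x. cnj (g x)) \<in> borel_measurable M"
  by (rule measurable_compose[OF _ borel_measurable_continuous_onI]) (auto intro!: continuous_intros)

lemma fourier_integral_lborel:
  assumes [measurable]: "f \<in> borel_measurable borel"
  shows "fourier_integral f \<xi> = (LINT x|lborel. cis (- (x \<bullet> \<xi>)) * f x)"
  unfolding fourier_integral_def by (rule integral_completion) measurable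

lemma integrable_cis_mult:
  fixes f :: "'a::euclidean_space \<Rightarrow> complex"
  assumes [measurable]: "f \<in> borel_measurable borel" "g \<in> borel_measurable borel" and f: "integrable lborel f"
  shows "integrable lborel (\<lambda>x. cis (g x) * f x)"
  by (rule Bochner_Integration.integrable_bound[OF f]) (auto simp: norm_mult)

lemma fourier_integral_measurable [measurable]:
  fixes f :: "'a::euclidean_space \<Rightarrow> complex"
  assumes [measurable]: "f \<in> borel_measurable borel"
  shows "fourier_integral f \<in> borel_measurable borel"
proof -
  have "(\<lambda>\<xi>. LINT x|lborel. cis (- (x \<bullet> \<xi>)) * f x) \<in> borel_measurable borel"
    by measurable
  moreover have "fourier_integral f = (\<lambda>\<xi>. LINT x|lborel. cis (- (x \<bullet> \<xi>)) * f x)"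
    by (rule ext) (rule fourier_integral_lborel[OF assms])
  ultimately show ?thesis by simp
qed

lemma fourier_integral_bound:
  assumes [measurable]: "f \<in> borel_measurable borel"
  shows "cmod (fourier_integral f \<xi>) \<le> (LINT x|lborel. cmod (f x))"
  unfolding fourier_integral_lborel[OF assms]
  by (rule order_trans[OF integral_norm_bound]) (simp add: norm_mult)

lemma integrable_lborel_pair_mult:
  fixes f g :: "'a::euclidean_space \<Rightarrow> complex" and h :: "'a \<times> 'a \<Rightarrow> complex"
  assumes [measurable]: "h \<in> borel_measurable borel" and f: "integrable lborel f" and g: "integrable lborel g"
    and h: "\<And>x y. cmod (h (x, y)) \<le> cmod (f x) * cmod (g y)"
  shows "integrable (lborel \<Otimes>\<^sub>M lborel) h"
proof (rule lborel_pair.Fubini_integrable)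
  have [measurable]: "f \<in> borel_measurable borel" "g \<in> borel_measurable borel" using f g by auto
  show hm: "h \<in> borel_measurable (lborel \<Otimes>\<^sub>M lborel)"
    using assms(1) by (simp add: lborel_prod)
  have [measurable]: "h \<in> borel_measurable (borel \<Otimes>\<^sub>M borel)"
    using assms(1) by (simp add: borel_prod)
  have i: "integrable lborel (\<lambda>y. h (x, y))" for x
  proof (rule Bochner_Integration.integrable_bound)
    show "integrable lborel (\<lambda>y. cmod (f x) * cmod (g y))" using g by auto
    show "(\<lambda>y. h (x, y)) \<in> borel_measurable lborel" by measurable
  qed (use h in auto)
  then show "AE x in lborel. integrable lborel (\<lambda>y. h (x, y))" by simp
  have le: "(LINT y|lborel. norm (h (x, y))) \<le> cmod (f x) * (LINT y|lborel. cmod (g y))" for x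
  proof -
    have "(LINT y|lborel. norm (h (x, y))) \<le> (LINT y|lborel. cmod (f x) * cmod (g y))"
      by (intro integral_mono integrable_norm i integrable_mult_right g h)
    then show ?thesis by simp
  qed
  show "integrable lborel (\<lambda>x. LINT y|lborel. norm (h (x, y)))"
  proof (rule Bochner_Integration.integrable_bound)
    show "integrable lborel (\<lambda>x. cmod (f x) * (LINT y|lborel. cmod (g y)))" using f by auto
    show "(\<lambda>x. LINT y|lborel. norm (h (x, y))) \<in> borel_measurable lborel" by measurable
    show "AE x in lborel. norm (LINT y|lborel. norm (h (x, y))) \<le> norm (cmod (f x) * (LINT y|lborel. cmod (g y)))"
      using le by (auto simp: abs_mult)
  qed
qed

text \<open>The kernel \<open>cis (- (x \<bullet> \<xi>))\<close> is symmetric, so the transform is its own transpose.\<close>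
lemma fourier_integral_multiplication:
  fixes f g :: "'a::euclidean_space \<Rightarrow> complex"
  assumes [measurable]: "f \<in> borel_measurable borel" "g \<in> borel_measurable borel"
    and f: "integrable lborel f" and g: "integrable lborel g"
  shows "(LINT \<xi>|lborel. fourier_integral f \<xi> * g \<xi>) = (LINT x|lborel. f x * fourier_integral g x)"
proof -
  have I: "integrable (lborel \<Otimes>\<^sub>M lborel) (\<lambda>(x, \<xi>). cis (- (x \<bullet> \<xi>)) * f x * g \<xi>)"
    by (rule integrable_lborel_pair_mult[OF _ f g]) (auto simp: norm_mult case_prod_beta borel_prod[symmetric])
  have "(LINT \<xi>|lborel. fourier_integral f \<xi> * g \<xi>) = (LINT \<xi>|lborel. LINT x|lborel. cis (- (x \<bullet> \<xi>)) * f x * g \<xi>)"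
    by (simp add: fourier_integral_lborel)
  also have "\<dots> = (LINT x|lborel. LINT \<xi>|lborel. cis (- (x \<bullet> \<xi>)) * f x * g \<xi>)"
    using lborel_pair.Fubini_integral[OF I] by simp
  also have "\<dots> = (LINT x|lborel. f x * fourier_integral g x)"
  proof (intro Bochner_Integration.integral_cong refl)
    fix x :: 'a
    have "(LINT \<xi>|lborel. cis (- (x \<bullet> \<xi>)) * f x * g \<xi>) = (LINT \<xi>|lborel. f x * (cis (- (\<xi> \<bullet> x)) * g \<xi>))"
      by (intro Bochner_Integration.integral_cong refl) (simp add: inner_commute)
    then show "(LINT \<xi>|lborel. cis (- (x \<bullet> \<xi>)) * f x * g \<xi>) = f x * fourier_integral g x"
      by (simp add: fourier_integral_lborel)
  qed
  finally show ?thesis .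
qed

definition gaussian :: "'a::euclidean_space \<Rightarrow> complex" where
  "gaussian x = complex_of_real (exp (- (norm x)\<^sup>2 / 2))"

lemma gaussian_measurable [measurable]: "gaussian \<in> borel_measurable borel"
  unfolding gaussian_def by measurable

lemma gaussian_1d:
  "integrable lborel (\<lambda>y::real. cis (- (y * s)) * complex_of_real (exp (- y\<^sup>2 / 2)))" (is ?I)
  "(LINT y|lborel. cis (- (y * s)) * complex_of_real (exp (- y\<^sup>2 / 2))) = complex_of_real (sqrt (2 * pi) * exp (- s\<^sup>2 / 2))" (is ?E)
proof -
  have eq: "exp (- y\<^sup>2 / 2) = sqrt (2 * pi) * std_normal_density y" for y :: real
    by (simp add: std_normal_density_def)
  have "integrable lborel (\<lambda>y::real. exp (- y\<^sup>2 / 2))"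
    unfolding eq by (intro integrable_mult_right integrable_normal_density) auto
  then have "integrable lborel (\<lambda>y::real. complex_of_real (exp (- y\<^sup>2 / 2)))"
    by (rule integrable_of_real)
  then show ?I by (intro integrable_cis_mult) auto
  have "char std_normal_distribution (- s) = (LINT y|lborel. std_normal_density y *\<^sub>R iexp (- s * y))"
    unfolding char_def by (subst integral_density) (auto simp: normal_density_nonneg)
  also have "\<dots> = (LINT y|lborel. cis (- (y * s)) * complex_of_real (std_normal_density y))"
    by (intro Bochner_Integration.integral_cong refl) (simp add: cis_conv_exp scaleR_conv_of_real mult_ac)
  finally have c: "(LINT y|lborel. cis (- (y * s)) * complex_of_real (std_normal_density y)) = complex_of_real (exp (- s\<^sup>2 / 2))"
    by (simp add: char_std_normal_distribution)
  have "(LINT y|lborel. cis (- (y * s)) * complex_of_real (exp (- y\<^sup>2 / 2))) =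
    (LINT y|lborel. complex_of_real (sqrt (2 * pi)) * (cis (- (y * s)) * complex_of_real (std_normal_density y)))"
    by (intro Bochner_Integration.integral_cong refl) (simp only: eq of_real_mult mult_ac)
  then show ?E by (simp only: integral_mult_right_zero c of_real_mult)
qed

lemma norm_power2_Basis: "(norm (x::'a::euclidean_space))\<^sup>2 = (\<Sum>b\<in>Basis. (x \<bullet> b)\<^sup>2)"
  unfolding power2_norm_eq_inner by (subst euclidean_inner) (simp add: power2_eq_square)

lemma gaussian_eq_prod: "gaussian (x::'a::euclidean_space) = (\<Prod>b\<in>Basis. complex_of_real (exp (- (x \<bullet> b)\<^sup>2 / 2)))"
proof -
  have "exp (- (norm x)\<^sup>2 / 2) = (\<Prod>b\<in>Basis. exp (- (x \<bullet> b)\<^sup>2 / 2))"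
    unfolding norm_power2_Basis exp_sum[symmetric, OF finite_Basis]
    by (simp add: sum_divide_distrib sum_negf)
  then show ?thesis by (simp only: gaussian_def of_real_prod)
qed

lemma cis_inner_eq_prod: "cis (- (x \<bullet> \<xi>)) = (\<Prod>b\<in>Basis. cis (- ((x \<bullet> b) * (\<xi> \<bullet> b))))" for x :: "'a::euclidean_space"
  unfolding cis_conv_exp exp_sum[symmetric, OF finite_Basis]
  by (simp add: euclidean_inner[of x \<xi>] sum_distrib_left sum_negf)

lemma integrable_gaussian: "integrable lborel (gaussian :: 'a::euclidean_space \<Rightarrow> complex)"
  unfolding gaussian_eq_prod[abs_def]
  by (rule lborel_coordinate_product) (use gaussian_1d(1)[of 0] in simp)

text \<open>The Gaussian and the character both factor over the coordinates; in one variable this is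
  the characteristic function of the standard normal distribution.\<close>
lemma fourier_integral_gaussian:
  "fourier_integral gaussian \<xi> = complex_of_real (sqrt (2 * pi) ^ DIM('a)) * gaussian (\<xi>::'a::euclidean_space)"
proof -
  have "fourier_integral gaussian \<xi> =
    (LINT x|lborel. (\<Prod>b\<in>Basis. cis (- ((x \<bullet> b) * (\<xi> \<bullet> b))) * complex_of_real (exp (- (x \<bullet> b)\<^sup>2 / 2))))"
    by (subst fourier_integral_lborel)
       (auto simp: cis_inner_eq_prod gaussian_eq_prod prod.distrib)
  also have "\<dots> = (\<Prod>b\<in>Basis. LINT y|lborel. cis (- (y * (\<xi> \<bullet> b))) * complex_of_real (exp (- y\<^sup>2 / 2)))"
    by (rule lborel_coordinate_product(2)[of "\<lambda>b y. cis (- (y * (\<xi> \<bullet> b))) * complex_of_real (exp (- y\<^sup>2 / 2))"]) (rule gaussian_1d)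
  also have "\<dots> = (\<Prod>b\<in>Basis. complex_of_real (sqrt (2 * pi)) * complex_of_real (exp (- (\<xi> \<bullet> b)\<^sup>2 / 2)))"
    by (simp only: gaussian_1d(2) of_real_mult)
  also have "\<dots> = complex_of_real (sqrt (2 * pi) ^ DIM('a)) * gaussian \<xi>"
    by (simp add: gaussian_eq_prod prod.distrib)
  finally show ?thesis .
qed

lemma fourier_integral_dilated_gaussian:
  assumes "e > 0"
  shows "fourier_integral (\<lambda>\<xi>::'a::euclidean_space. gaussian (e *\<^sub>R \<xi>)) x = complex_of_real ((sqrt (2 * pi) / e) ^ DIM('a)) * gaussian (x /\<^sub>R e)"
proof -
  let ?g = "\<lambda>y. cis (- (y \<bullet> (x /\<^sub>R e))) * gaussian y"
  have "fourier_integral gaussian (x /\<^sub>R e) = (LINT y|lborel. ?g y)"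
    by (simp add: fourier_integral_lborel)
  also have "\<dots> = \<bar>e\<bar> ^ DIM('a) *\<^sub>R (LINT \<xi>|lborel. ?g (0 + e *\<^sub>R \<xi>))"
    by (rule integral_lborel_affine) (use assms in auto)
  also have "(LINT \<xi>|lborel. ?g (0 + e *\<^sub>R \<xi>)) = fourier_integral (\<lambda>\<xi>::'a. gaussian (e *\<^sub>R \<xi>)) x"
  proof -
    have "(e *\<^sub>R \<xi>) \<bullet> (x /\<^sub>R e) = \<xi> \<bullet> x" for \<xi> using assms by (simp add: field_simps)
    then show ?thesis by (simp add: fourier_integral_lborel del: inner_scaleR_left inner_scaleR_right)
  qed
  finally have "complex_of_real (e ^ DIM('a)) * fourier_integral (\<lambda>\<xi>::'a. gaussian (e *\<^sub>R \<xi>)) x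
    = complex_of_real (sqrt (2 * pi) ^ DIM('a)) * gaussian (x /\<^sub>R e)"
    using assms by (simp add: fourier_integral_gaussian scaleR_conv_of_real)
  then show ?thesis using assms by (simp add: field_simps)
qed

lemma gaussian_dilated_tendsto: "(\<lambda>k. gaussian (inverse (real (Suc k)) *\<^sub>R \<xi>)) \<longlonglongrightarrow> (1::complex)"
proof -
  have "(\<lambda>k. complex_of_real (exp (- (norm (inverse (real (Suc k)) *\<^sub>R \<xi>))\<^sup>2 / 2))) \<longlonglongrightarrow> complex_of_real (exp (- (norm (0 *\<^sub>R \<xi>))\<^sup>2 / 2))"
    by (intro tendsto_intros LIMSEQ_inverse_real_of_nat) auto
  then show ?thesis by (simp add: gaussian_def)
qed

section \<open>Continuity of translations in the mean\<close>

text \<open>Continuity at 0 of the translates in \<open>L\<^sup>1\<close>, stated with sequences because dominated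
  convergence is.\<close>
definition translation_continuous :: "('a::euclidean_space \<Rightarrow> complex) \<Rightarrow> bool" where
  "translation_continuous f \<longleftrightarrow>
     (\<forall>Z. Z \<longlonglongrightarrow> 0 \<longrightarrow> (\<lambda>k. LINT x|lborel. cmod (f (x - Z k) - f x)) \<longlonglongrightarrow> 0)"

text \<open>Translations are isometries of \<open>L\<^sup>1\<close>, so the property passes to limits in the mean.\<close>
lemma translation_continuous_approx:
  fixes f :: "'a::euclidean_space \<Rightarrow> complex"
  assumes f: "integrable lborel f"
    and approx: "\<And>e. e > 0 \<Longrightarrow> \<exists>g. integrable lborel g \<and> translation_continuous g \<and> (LINT x|lborel. cmod (f x - g x)) < e"
  shows "translation_continuous f"
  unfolding translation_continuous_def
proof (intro allI impI LIMSEQ_I)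
  fix Z :: "nat \<Rightarrow> 'a" and e :: real assume Z: "Z \<longlonglongrightarrow> 0" and "e > 0"
  from approx[of "e/3"] \<open>e > 0\<close> obtain g where g: "integrable lborel g" "translation_continuous g"
    and fg: "(LINT x|lborel. cmod (f x - g x)) < e/3" by auto
  have [measurable]: "f \<in> borel_measurable borel" "g \<in> borel_measurable borel" using f g by auto
  from g(2) Z have "(\<lambda>k. LINT x|lborel. cmod (g (x - Z k) - g x)) \<longlonglongrightarrow> 0"
    by (simp add: translation_continuous_def)
  from LIMSEQ_D[OF this, of "e/3"] \<open>e > 0\<close> obtain N where
    N: "\<And>k. k \<ge> N \<Longrightarrow> (LINT x|lborel. cmod (g (x - Z k) - g x)) < e/3" by auto
  show "\<exists>N. \<forall>k\<ge>N. norm ((LINT x|lborel. cmod (f (x - Z k) - f x)) - 0) < e"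
  proof (intro exI allI impI)
    fix k assume "k \<ge> N"
    note it = integrable_lborel_translate[where t = "Z k"]
    have tf: "integrable lborel (\<lambda>x. f (x - Z k))" and tg: "integrable lborel (\<lambda>x. g (x - Z k))"
      using f g by (auto intro: it)
    have "(LINT x|lborel. cmod (f (x - Z k) - f x)) \<le>
      (LINT x|lborel. cmod (f (x - Z k) - g (x - Z k)) + cmod (g (x - Z k) - g x) + cmod (f x - g x))"
    proof (rule integral_mono)
      fix x
      show "cmod (f (x - Z k) - f x) \<le> cmod (f (x - Z k) - g (x - Z k)) + cmod (g (x - Z k) - g x) + cmod (f x - g x)"
      proof -
        have "f (x - Z k) - f x = (f (x - Z k) - g (x - Z k)) + (g (x - Z k) - g x) - (f x - g x)" by simp
        then show ?thesis by (simp only:) (intro order_trans[OF norm_triangle_ineq4] add_right_mono norm_triangle_ineq)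
      qed
    qed (use f g tf tg in auto)
    also have "\<dots> = (LINT x|lborel. cmod (f (x - Z k) - g (x - Z k))) + (LINT x|lborel. cmod (g (x - Z k) - g x)) + (LINT x|lborel. cmod (f x - g x))"
      using f g tf tg by simp
    also have "(LINT x|lborel. cmod (f (x - Z k) - g (x - Z k))) = (LINT x|lborel. cmod (f x - g x))"
      by (rule integral_lborel_translate[of "\<lambda>x. cmod (f x - g x)"]) simp
    finally show "norm ((LINT x|lborel. cmod (f (x - Z k) - f x)) - 0) < e"
      using N[OF \<open>k \<ge> N\<close>] fg by simp
  qed
qed

text \<open>\<open>U\<close> and its translates have the same measure, so the distance of the indicators is twice the
  measure of the part of \<open>U\<close> missed by the translate. A point of an open set is missed only
  finitely often when the translations tend to 0, and dominated convergence applies.\<close>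
lemma translation_continuous_open:
  fixes U :: "'a::euclidean_space set"
  assumes U: "open U" "emeasure lborel U < \<infinity>"
  shows "translation_continuous (\<lambda>x. indicator U x *\<^sub>R c)"
  unfolding translation_continuous_def
proof (intro allI impI)
  fix Z :: "nat \<Rightarrow> 'a" assume Z: "Z \<longlonglongrightarrow> 0"
  have [measurable]: "U \<in> sets borel" using U by simp
  let ?a = "\<lambda>x. indicator U x :: real"
  have ia: "integrable lborel ?a" using U by (auto simp: integrable_indicator_iff less_top)
  have it: "integrable lborel (\<lambda>x. ?a (x - Z k))" for k
    by (rule integrable_lborel_translate) (auto simp: ia)
  have "(LINT x|lborel. cmod (indicator U (x - Z k) *\<^sub>R c - indicator U x *\<^sub>R c)) = 2 * cmod c * (LINT x|lborel. max 0 (?a x - ?a (x - Z k)))" for k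
  proof -
    have "(LINT x|lborel. cmod (indicator U (x - Z k) *\<^sub>R c - indicator U x *\<^sub>R c))
      = (LINT x|lborel. 2 * cmod c * max 0 (?a x - ?a (x - Z k)) + cmod c * (?a (x - Z k) - ?a x))"
      by (intro Bochner_Integration.integral_cong refl) (auto simp: indicator_def)
    also have "\<dots> = 2 * cmod c * (LINT x|lborel. max 0 (?a x - ?a (x - Z k))) + cmod c * ((LINT x|lborel. ?a (x - Z k)) - (LINT x|lborel. ?a x))"
      using ia it[of k] by (simp add: integrable_max)
    also have "(LINT x|lborel. ?a (x - Z k)) = (LINT x|lborel. ?a x)"
      by (rule integral_lborel_translate) simp
    finally show ?thesis by simp
  qed
  moreover have "(\<lambda>k. 2 * cmod c * (LINT x|lborel. max 0 (?a x - ?a (x - Z k)))) \<longlonglongrightarrow> 2 * cmod c * (LINT x::'a|lborel. 0)"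
  proof (intro tendsto_mult tendsto_const integral_dominated_convergence[where w = ?a])
    show "AE x in lborel. (\<lambda>k. max 0 (?a x - ?a (x - Z k))) \<longlonglongrightarrow> 0"
    proof (intro AE_I2)
      fix x
      show "(\<lambda>k. max 0 (?a x - ?a (x - Z k))) \<longlonglongrightarrow> 0"
      proof (cases "x \<in> U")
        case True
        have "(\<lambda>k. x - Z k) \<longlonglongrightarrow> x - 0" by (intro tendsto_diff tendsto_const Z)
        then have "\<forall>\<^sub>F k in sequentially. x - Z k \<in> U"
          using U(1) True by (auto dest: topological_tendstoD)
        then have "\<forall>\<^sub>F k in sequentially. max 0 (?a x - ?a (x - Z k)) = 0"
          by eventually_elim (auto simp: True)
        then show ?thesis by (rule tendsto_eventually)
      next
        case False
        then have "max 0 (?a x - ?a (x - Z k)) = 0" for k by (auto simp: indicator_def)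
        then show ?thesis by simp
      qed
    qed
    show "AE x in lborel. norm (max 0 (?a x - ?a (x - Z k))) \<le> ?a x" for k
      by (intro AE_I2) (auto simp: indicator_def)
  qed (auto simp: ia)
  ultimately show "(\<lambda>k. LINT x|lborel. cmod (indicator U (x - Z k) *\<^sub>R c - indicator U x *\<^sub>R c)) \<longlonglongrightarrow> 0"
    by simp
qed

text \<open>Outer regularity reduces indicators of measurable sets to indicators of open sets.\<close>
lemma translation_continuous_integrable:
  assumes "integrable lborel f"
  shows "translation_continuous f"
  using assms
proof (induction rule: integrable_induct)
  case (base A c)
  then have [measurable]: "A \<in> sets borel" by simp
  show ?case
  proof (rule translation_continuous_approx)
    show "integrable lborel (\<lambda>x. indicator A x *\<^sub>R c)"
      using base by (intro integrable_scaleR_left) (auto simp: integrable_indicator_iff less_top)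
    fix e :: real assume "e > 0"
    then have e': "e / (cmod c + 1) > 0" by (intro divide_pos_pos) (auto intro: add_nonneg_pos)
    from outer_regular_lborel[OF _ this, of A] base obtain U where
      U: "open U" "A \<subseteq> U" "emeasure lborel (U - A) < ennreal (e / (cmod c + 1))" by auto
    then have [measurable]: "U \<in> sets borel" by simp
    have "emeasure lborel U \<le> emeasure lborel (U - A) + emeasure lborel A"
      using U(2) emeasure_subadditive[of "U - A" lborel A] by (auto simp: Un_absorb2)
    also have "\<dots> < \<infinity>" using base U(3) by (auto simp: less_top[symmetric] dest: order_less_trans)
    finally have Uf: "emeasure lborel U < \<infinity>" .
    have "(LINT x|lborel. cmod (indicator A x *\<^sub>R c - indicator U x *\<^sub>R c)) = (LINT x|lborel. indicator (U - A) x * cmod c)"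
      by (intro Bochner_Integration.integral_cong refl) (use U(2) in \<open>auto simp: indicator_def\<close>)
    also have "\<dots> = measure lborel (U - A) * cmod c" by simp
    also have "\<dots> \<le> measure lborel (U - A) * (cmod c + 1)" by (intro mult_left_mono) auto
    also have "\<dots> < e"
    proof -
      have "measure lborel (U - A) < e / (cmod c + 1)"
        using U(3) e' by (simp add: measure_def) (metis enn2real_ennreal enn2real_less_iff ennreal_less_top le_less order_less_trans order_less_le)
      then show ?thesis by (simp add: pos_less_divide_eq add_nonneg_pos)
    qed
    finally have "(LINT x|lborel. cmod (indicator A x *\<^sub>R c - indicator U x *\<^sub>R c)) < e" .
    moreover have "integrable lborel (\<lambda>x. indicator U x *\<^sub>R c)"
      using Uf by (intro integrable_scaleR_left) (auto simp: integrable_indicator_iff less_top)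
    ultimately show "\<exists>g. integrable lborel g \<and> translation_continuous g \<and> (LINT x|lborel. cmod (indicator A x *\<^sub>R c - g x)) < e"
      using translation_continuous_open[OF U(1) Uf] by blast
  qed
next
  case (add f g)
  show ?case unfolding translation_continuous_def
  proof (intro allI impI)
    fix Z :: "nat \<Rightarrow> 'a" assume Z: "Z \<longlonglongrightarrow> 0"
    have [measurable]: "f \<in> borel_measurable borel" "g \<in> borel_measurable borel" using add by auto
    have i: "integrable lborel (\<lambda>x. f (x - Z k))" "integrable lborel (\<lambda>x. g (x - Z k))" for k
      using add by (auto intro: integrable_lborel_translate)
    have "(\<lambda>k. (LINT x|lborel. cmod (f (x - Z k) - f x)) + (LINT x|lborel. cmod (g (x - Z k) - g x))) \<longlonglongrightarrow> 0 + 0"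
      using add Z unfolding translation_continuous_def by (intro tendsto_add) auto
    then have s: "(\<lambda>k. (LINT x|lborel. cmod (f (x - Z k) - f x)) + (LINT x|lborel. cmod (g (x - Z k) - g x))) \<longlonglongrightarrow> 0"
      by simp
    show "(\<lambda>k. LINT x|lborel. cmod (f (x - Z k) + g (x - Z k) - (f x + g x))) \<longlonglongrightarrow> 0"
    proof (rule tendsto_sandwich[OF _ _ tendsto_const s])
      have "(LINT x|lborel. cmod (f (x - Z k) + g (x - Z k) - (f x + g x))) \<le>
          (LINT x|lborel. cmod (f (x - Z k) - f x) + cmod (g (x - Z k) - g x))" for k
        by (rule integral_mono) (use add i in \<open>auto simp: norm_diff_triangle_ineq\<close>)
      then show "\<forall>\<^sub>F k in sequentially. (LINT x|lborel. cmod (f (x - Z k) + g (x - Z k) - (f x + g x))) \<le>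
         (LINT x|lborel. cmod (f (x - Z k) - f x)) + (LINT x|lborel. cmod (g (x - Z k) - g x))"
        using add i by simp
    qed auto
  qed
next
  case (lim f s)
  have [measurable]: "f \<in> borel_measurable borel" "s i \<in> borel_measurable borel" for i
    using lim(4) lim(1)[of i] by auto
  show ?case
  proof (rule translation_continuous_approx[OF lim(4)])
    fix e :: real assume "e > 0"
    have "(\<lambda>i. LINT x|lborel. cmod (f x - s i x)) \<longlonglongrightarrow> (LINT x::'a|lborel. 0)"
    proof (rule integral_dominated_convergence[where w = "\<lambda>x. 3 * cmod (f x)"])
      show "AE x in lborel. (\<lambda>i. cmod (f x - s i x)) \<longlonglongrightarrow> 0"
      proof (intro AE_I2)
        fix x
        have "(\<lambda>i. f x - s i x) \<longlonglongrightarrow> f x - f x" using lim(2) by (intro tendsto_diff tendsto_const) simp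
        then show "(\<lambda>i. cmod (f x - s i x)) \<longlonglongrightarrow> 0" using tendsto_norm_zero by fastforce
      qed
      show "AE x in lborel. norm (cmod (f x - s i x)) \<le> 3 * cmod (f x)" for i
      proof (intro AE_I2)
        fix x
        have "cmod (s i x) \<le> 2 * cmod (f x)" using lim(3) by simp
        then show "norm (cmod (f x - s i x)) \<le> 3 * cmod (f x)"
          using norm_triangle_ineq4[of "f x" "s i x"] by simp
      qed
    qed (use lim(4) in auto)
    then have "(\<lambda>i. LINT x|lborel. cmod (f x - s i x)) \<longlonglongrightarrow> 0" by simp
    from LIMSEQ_D[OF this \<open>e > 0\<close>] obtain i where "(LINT x|lborel. cmod (f x - s i x)) < e" by auto
    with lim show "\<exists>g. integrable lborel g \<and> translation_continuous g \<and> (LINT x|lborel. cmod (f x - g x)) < e"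
      by blast
  qed
qed

section \<open>Plancherel's identity for bounded integrable functions\<close>

lemma norm_diff_swap_le: "cmod (a * cnj b - a * cnj c) \<le> cmod a * cmod (b - c)"
  by (metis complex_cnj_diff complex_mod_cnj norm_mult order_refl right_diff_distrib)

context
  fixes f :: "'a::euclidean_space \<Rightarrow> complex" and C :: real
  assumes f [measurable]: "f \<in> borel_measurable borel" and fi: "integrable lborel f"
    and fb: "\<And>x. cmod (f x) \<le> C"
begin

text \<open>The convolution of \<open>f\<close> with the reflection of its conjugate: its transform is the square of
  \<open>|fourier_integral f|\<close> and its value at 0 is the square of the \<open>L\<^sup>2\<close> norm of \<open>f\<close>. Plancherel's
  identity is therefore Fourier inversion for it at the single point 0.\<close>
definition autocorrelation :: "'a \<Rightarrow> complex" where
  "autocorrelation z = (LINT x|lborel. f x * cnj (f (x - z)))"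

lemma bound_nonneg: "0 \<le> C" using fb[of 0] norm_ge_zero order_trans by blast

lemma autocorrelation_measurable [measurable]: "autocorrelation \<in> borel_measurable borel"
  unfolding autocorrelation_def[abs_def] by measurable

lemma autocorrelation_summand_integrable: "integrable lborel (\<lambda>x. f x * cnj (f (x - z)))"
proof (rule Bochner_Integration.integrable_bound)
  show "integrable lborel (\<lambda>x. C * cmod (f x))" using fi by simp
  show "AE x in lborel. norm (f x * cnj (f (x - z))) \<le> norm (C * cmod (f x))"
  proof (intro AE_I2)
    fix x
    show "norm (f x * cnj (f (x - z))) \<le> norm (C * cmod (f x))"
      using mult_right_mono[OF fb[of "x - z"], of "cmod (f x)"] bound_nonneg by (simp add: norm_mult mult.commute)
  qed
qed measurable

lemma autocorrelation_bound: "cmod (autocorrelation z) \<le> C * (LINT x|lborel. cmod (f x))"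
proof -
  have "cmod (autocorrelation z) \<le> (LINT x|lborel. cmod (f x * cnj (f (x - z))))"
    unfolding autocorrelation_def by (rule integral_norm_bound)
  also have "\<dots> \<le> (LINT x|lborel. C * cmod (f x))"
  proof (rule integral_mono)
    show "integrable lborel (\<lambda>x. cmod (f x * cnj (f (x - z))))"
      using autocorrelation_summand_integrable by (rule integrable_norm)
    show "cmod (f x * cnj (f (x - z))) \<le> C * cmod (f x)" for x
      using mult_right_mono[OF fb[of "x - z"], of "cmod (f x)"] by (simp add: norm_mult mult.commute)
  qed (use fi in auto)
  finally show ?thesis by simp
qed

lemma autocorrelation_integrand_integrable:
  "integrable (lborel \<Otimes>\<^sub>M lborel) (\<lambda>(x, z). cis (- (z \<bullet> \<xi>)) * (f x * cnj (f (x - z))))"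
proof (rule lborel_pair.Fubini_integrable)
  have norm_eq: "(LINT z|lborel. norm (case (x, z) of (x, z) \<Rightarrow> cis (- (z \<bullet> \<xi>)) * (f x * cnj (f (x - z))))) = cmod (f x) * (LINT y|lborel. cmod (f y))" for x
  proof -
    have "(LINT z|lborel. cmod (f (x - z))) = (LINT y|lborel. cmod (f y))"
      using integral_lborel_affine[of "\<lambda>y. cmod (f y)" "-1" x] by simp
    then show ?thesis by (simp add: norm_mult)
  qed
  show "integrable lborel (\<lambda>x. LINT z|lborel. norm (case (x, z) of (x, z) \<Rightarrow> cis (- (z \<bullet> \<xi>)) * (f x * cnj (f (x - z)))))"
    unfolding norm_eq using fi by simp
  show "AE x in lborel. integrable lborel (\<lambda>z. case (x, z) of (x, z) \<Rightarrow> cis (- (z \<bullet> \<xi>)) * (f x * cnj (f (x - z))))"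
  proof (intro AE_I2)
    fix x
    have "integrable lborel (\<lambda>z. f (x - z))"
      using integrable_lborel_affine[OF f _ fi, of "-1" x] by simp
    then have "integrable lborel (\<lambda>z. f x * cnj (f (x - z)))" by simp
    then show "integrable lborel (\<lambda>z. case (x, z) of (x, z) \<Rightarrow> cis (- (z \<bullet> \<xi>)) * (f x * cnj (f (x - z))))"
      unfolding prod.case by (intro integrable_cis_mult) measurable
  qed
  have "(\<lambda>(x, z). cis (- (z \<bullet> \<xi>)) * (f x * cnj (f (x - z)))) \<in> borel_measurable (borel \<Otimes>\<^sub>M borel)"
    by measurable
  then show "(\<lambda>(x, z). cis (- (z \<bullet> \<xi>)) * (f x * cnj (f (x - z)))) \<in> borel_measurable (lborel \<Otimes>\<^sub>M lborel)"
    by (simp cong: measurable_cong_sets)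
qed

lemma autocorrelation_integrable: "integrable lborel autocorrelation"
proof -
  have "integrable lborel (\<lambda>z. LINT x|lborel. (case (x, z) of (x, z) \<Rightarrow> cis (- (z \<bullet> 0)) * (f x * cnj (f (x - z)))))"
    using lborel_pair.integrable_snd[OF autocorrelation_integrand_integrable[of 0]] by simp
  then show ?thesis by (simp add: autocorrelation_def[abs_def])
qed

lemma fourier_integral_autocorrelation:
  "fourier_integral autocorrelation \<xi> = complex_of_real ((cmod (fourier_integral f \<xi>))\<^sup>2)"
proof -
  have "fourier_integral autocorrelation \<xi> = (LINT z|lborel. LINT x|lborel. cis (- (z \<bullet> \<xi>)) * (f x * cnj (f (x - z))))"
    by (simp add: fourier_integral_lborel autocorrelation_def[abs_def])
  also have "\<dots> = (LINT x|lborel. LINT z|lborel. cis (- (z \<bullet> \<xi>)) * (f x * cnj (f (x - z))))"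
    using lborel_pair.Fubini_integral[OF autocorrelation_integrand_integrable] by simp
  also have "\<dots> = (LINT x|lborel. (cis (- (x \<bullet> \<xi>)) * f x) * cnj (fourier_integral f \<xi>))"
  proof (rule Bochner_Integration.integral_cong[OF refl])
    fix x :: 'a
    have "(LINT z|lborel. cis (- (z \<bullet> \<xi>)) * (f x * cnj (f (x - z)))) = (LINT y|lborel. cis (- ((x - y) \<bullet> \<xi>)) * (f x * cnj (f y)))"
      using integral_lborel_affine[of "\<lambda>z. cis (- (z \<bullet> \<xi>)) * (f x * cnj (f (x - z)))" "-1" x] by simp
    also have "\<dots> = (LINT y|lborel. (cis (- (x \<bullet> \<xi>)) * f x) * cnj (cis (- (y \<bullet> \<xi>)) * f y))"
    proof (rule Bochner_Integration.integral_cong[OF refl])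
      fix y
      have "cis (- ((x - y) \<bullet> \<xi>)) = cis (- (x \<bullet> \<xi>)) * cis (y \<bullet> \<xi>)"
        by (simp only: cis_mult) (simp add: inner_diff_left)
      then show "cis (- ((x - y) \<bullet> \<xi>)) * (f x * cnj (f y)) = (cis (- (x \<bullet> \<xi>)) * f x) * cnj (cis (- (y \<bullet> \<xi>)) * f y)"
        by (simp add: cis_cnj)
    qed
    also have "\<dots> = (cis (- (x \<bullet> \<xi>)) * f x) * cnj (fourier_integral f \<xi>)"
      unfolding integral_mult_right_zero fourier_integral_lborel[OF f]
      by (rule arg_cong[OF integral_bounded_linear[OF bounded_linear_cnj integrable_cis_mult[OF f _ fi]]]) measurable
    finally show "(LINT z|lborel. cis (- (z \<bullet> \<xi>)) * (f x * cnj (f (x - z)))) = (cis (- (x \<bullet> \<xi>)) * f x) * cnj (fourier_integral f \<xi>)" .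
  qed
  also have "\<dots> = fourier_integral f \<xi> * cnj (fourier_integral f \<xi>)"
    by (simp only: integral_mult_left_zero fourier_integral_lborel[OF f])
  finally show ?thesis by (simp only: complex_norm_square)
qed

text \<open>One factor is bounded, so continuity of translations in \<open>L\<^sup>1\<close> suffices.\<close>
lemma autocorrelation_tendsto:
  assumes "Z \<longlonglongrightarrow> 0"
  shows "(\<lambda>k. autocorrelation (Z k)) \<longlonglongrightarrow> autocorrelation 0"
proof -
  have *: "(\<lambda>k. C * (LINT x|lborel. cmod (f (x - Z k) - f x))) \<longlonglongrightarrow> C * 0"
    using translation_continuous_integrable[OF fi] assms
    by (intro tendsto_mult tendsto_const) (simp add: translation_continuous_def)
  have "(\<lambda>k. autocorrelation (Z k) - autocorrelation 0) \<longlonglongrightarrow> 0"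
  proof (rule Lim_null_comparison[OF always_eventually])
    show "\<forall>k. cmod (autocorrelation (Z k) - autocorrelation 0) \<le> C * (LINT x|lborel. cmod (f (x - Z k) - f x))"
    proof
      fix k
      have ti: "integrable lborel (\<lambda>x. f (x - Z k))" using fi by (intro integrable_lborel_translate) auto
      have "autocorrelation (Z k) - autocorrelation 0 = (LINT x|lborel. f x * cnj (f (x - Z k)) - f x * cnj (f x))"
        using autocorrelation_summand_integrable[of "Z k"] autocorrelation_summand_integrable[of 0]
        by (simp add: autocorrelation_def)
      also have "cmod \<dots> \<le> (LINT x|lborel. cmod (f x * cnj (f (x - Z k)) - f x * cnj (f x)))"
        by (rule integral_norm_bound)
      also have "\<dots> \<le> (LINT x|lborel. C * cmod (f (x - Z k) - f x))"
      proof (rule integral_mono)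
        show "integrable lborel (\<lambda>x. cmod (f x * cnj (f (x - Z k)) - f x * cnj (f x)))"
          using autocorrelation_summand_integrable[of "Z k"] autocorrelation_summand_integrable[of 0] by auto
        show "integrable lborel (\<lambda>x. C * cmod (f (x - Z k) - f x))" using ti fi by auto
        show "cmod (f x * cnj (f (x - Z k)) - f x * cnj (f x)) \<le> C * cmod (f (x - Z k) - f x)" for x
          using norm_diff_swap_le[of "f x" "f (x - Z k)" "f x"] fb[of x]
          by (meson mult_right_mono norm_ge_zero order_trans)
      qed
      finally show "cmod (autocorrelation (Z k) - autocorrelation 0) \<le> C * (LINT x|lborel. cmod (f (x - Z k) - f x))" by simp
    qed
    show "(\<lambda>k. C * (LINT x|lborel. cmod (f (x - Z k) - f x))) \<longlonglongrightarrow> 0" using * by simp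
  qed
  then show ?thesis by (simp add: LIM_zero_iff)
qed

text \<open>The transform of the autocorrelation is not known to be integrable, so inversion is replaced
  by the multiplication formula with a wide Gaussian as the second factor. After a change of
  variables this is a Gaussian mean of the autocorrelation at scale \<open>e\<close>.\<close>
lemma gaussian_regularized_plancherel:
  assumes "e > 0"
  shows "(LINT \<xi>|lborel. complex_of_real ((cmod (fourier_integral f \<xi>))\<^sup>2) * gaussian (e *\<^sub>R \<xi>))
    = (LINT w|lborel. autocorrelation (e *\<^sub>R w) * (complex_of_real (sqrt (2 * pi) ^ DIM('a)) * gaussian w))"
proof -
  have g: "integrable lborel (\<lambda>\<xi>::'a. gaussian (e *\<^sub>R \<xi>))"
    using integrable_lborel_affine[OF _ _ integrable_gaussian, of e 0] assms by simp
  have "(LINT \<xi>|lborel. complex_of_real ((cmod (fourier_integral f \<xi>))\<^sup>2) * gaussian (e *\<^sub>R \<xi>))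
    = (LINT x|lborel. autocorrelation x * fourier_integral (\<lambda>\<xi>. gaussian (e *\<^sub>R \<xi>)) x)"
    using fourier_integral_multiplication[OF _ _ autocorrelation_integrable g]
    by (simp add: fourier_integral_autocorrelation)
  also have "\<dots> = (LINT x|lborel. autocorrelation x * (complex_of_real ((sqrt (2 * pi) / e) ^ DIM('a)) * gaussian (x /\<^sub>R e)))"
    by (simp only: fourier_integral_dilated_gaussian[OF assms])
  also have "\<dots> = \<bar>e\<bar>^DIM('a) *\<^sub>R (LINT w|lborel. autocorrelation (0 + e *\<^sub>R w) * (complex_of_real ((sqrt (2 * pi) / e) ^ DIM('a)) * gaussian ((0 + e *\<^sub>R w) /\<^sub>R e)))"
    by (rule integral_lborel_affine) (use assms in auto)
  also have "\<dots> = (LINT w|lborel. complex_of_real (e ^ DIM('a)) * (autocorrelation (e *\<^sub>R w) * (complex_of_real ((sqrt (2 * pi) / e) ^ DIM('a)) * gaussian w)))"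
    using assms by (simp add: scaleR_conv_of_real)
  also have "\<dots> = (LINT w|lborel. autocorrelation (e *\<^sub>R w) * (complex_of_real (sqrt (2 * pi) ^ DIM('a)) * gaussian w))"
    by (rule Bochner_Integration.integral_cong[OF refl]) (use assms in \<open>simp add: power_divide\<close>)
  finally show ?thesis .
qed

text \<open>Let the scale \<open>e\<close> tend to 0, with monotone convergence for the frequency integral and
  dominated convergence for the mean. One factor \<open>sqrt (2 * pi) ^ DIM('a)\<close> comes from the
  transform of the Gaussian and another one from its mass.\<close>
theorem plancherel_bounded:
  "(\<integral>\<^sup>+\<xi>. ennreal ((cmod (fourier_integral f \<xi>))\<^sup>2) \<partial>lborel) = ennreal ((2 * pi) ^ DIM('a)) * (\<integral>\<^sup>+x. ennreal ((cmod (f x))\<^sup>2) \<partial>lborel)"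
proof -
  define e where "e k = inverse (real (Suc k))" for k
  have e: "e k > 0" for k by (simp add: e_def)
  define G where "G k \<xi> = exp (- (norm (e k *\<^sub>R \<xi>))\<^sup>2 / 2)" for k and \<xi> :: 'a
  have Gg: "gaussian (e k *\<^sub>R \<xi>) = complex_of_real (G k \<xi>)" for k \<xi> by (simp add: gaussian_def G_def)
  have [measurable]: "G k \<in> borel_measurable borel" for k unfolding G_def by measurable
  have f2i: "integrable lborel (\<lambda>x. (cmod (f x))\<^sup>2)"
    using integrable_norm[OF autocorrelation_summand_integrable[of 0]] by (simp add: norm_mult power2_eq_square)
  have c0: "autocorrelation 0 = complex_of_real (LINT x|lborel. (cmod (f x))\<^sup>2)"
    unfolding integral_complex_of_real[symmetric]
    by (simp only: autocorrelation_def diff_zero complex_norm_square)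
  let ?L = "\<lambda>k. LINT \<xi>|lborel. (cmod (fourier_integral f \<xi>))\<^sup>2 * G k \<xi>"
  have Li: "integrable lborel (\<lambda>\<xi>. (cmod (fourier_integral f \<xi>))\<^sup>2 * G k \<xi>)" for k
  proof (rule Bochner_Integration.integrable_bound)
    have "integrable lborel (\<lambda>\<xi>::'a. gaussian (e k *\<^sub>R \<xi>))"
      using integrable_lborel_affine[OF _ _ integrable_gaussian, of "e k" 0] e[of k] by simp
    then have "integrable lborel (\<lambda>\<xi>. complex_of_real (G k \<xi>))" by (simp add: Gg)
    then have "integrable lborel (G k)" by (rule complex_of_real_integrable_eq[THEN iffD1])
    then show "integrable lborel (\<lambda>\<xi>. (LINT x|lborel. cmod (f x))\<^sup>2 * G k \<xi>)" by simp
    show "AE \<xi> in lborel. norm ((cmod (fourier_integral f \<xi>))\<^sup>2 * G k \<xi>) \<le> norm ((LINT x|lborel. cmod (f x))\<^sup>2 * G k \<xi>)"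
      using fourier_integral_bound[OF f] by (auto simp: G_def abs_mult intro!: mult_right_mono power_mono)
  qed measurable
  have "(\<lambda>k. LINT w|lborel. autocorrelation (e k *\<^sub>R w) * (complex_of_real (sqrt (2 * pi) ^ DIM('a)) * gaussian w))
    \<longlonglongrightarrow> (LINT w|lborel. autocorrelation 0 * (complex_of_real (sqrt (2 * pi) ^ DIM('a)) * gaussian (w::'a)))"
  proof (rule integral_dominated_convergence[where w = "\<lambda>w. (C * (LINT x|lborel. cmod (f x)) * sqrt (2 * pi) ^ DIM('a)) * cmod (gaussian w)"])
    show "AE w in lborel. (\<lambda>k. autocorrelation (e k *\<^sub>R w) * (complex_of_real (sqrt (2 * pi) ^ DIM('a)) * gaussian w)) \<longlonglongrightarrow> autocorrelation 0 * (complex_of_real (sqrt (2 * pi) ^ DIM('a)) * gaussian w)"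
    proof (intro AE_I2 tendsto_mult tendsto_const autocorrelation_tendsto)
      fix w :: 'a
      have "(\<lambda>k. e k *\<^sub>R w) \<longlonglongrightarrow> 0 *\<^sub>R w"
        unfolding e_def by (intro tendsto_scaleR tendsto_const LIMSEQ_inverse_real_of_nat)
      then show "(\<lambda>k. e k *\<^sub>R w) \<longlonglongrightarrow> 0" by simp
    qed
    show "AE w in lborel. norm (autocorrelation (e k *\<^sub>R w) * (complex_of_real (sqrt (2 * pi) ^ DIM('a)) * gaussian w))
      \<le> (C * (LINT x|lborel. cmod (f x)) * sqrt (2 * pi) ^ DIM('a)) * cmod (gaussian w)" for k
    proof (intro AE_I2)
      fix w :: 'a
      have "cmod (autocorrelation (e k *\<^sub>R w)) * (sqrt (2 * pi) ^ DIM('a) * cmod (gaussian w)) \<le> (C * (LINT x|lborel. cmod (f x))) * (sqrt (2 * pi) ^ DIM('a) * cmod (gaussian w))"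
        by (intro mult_right_mono autocorrelation_bound) auto
      then show "norm (autocorrelation (e k *\<^sub>R w) * (complex_of_real (sqrt (2 * pi) ^ DIM('a)) * gaussian w))
      \<le> (C * (LINT x|lborel. cmod (f x)) * sqrt (2 * pi) ^ DIM('a)) * cmod (gaussian w)"
        by (simp add: norm_mult norm_power mult_ac)
    qed
  qed (use integrable_gaussian in auto)
  moreover have "(LINT w|lborel. autocorrelation 0 * (complex_of_real (sqrt (2 * pi) ^ DIM('a)) * gaussian (w::'a)))
    = complex_of_real ((LINT x|lborel. (cmod (f x))\<^sup>2) * (2 * pi) ^ DIM('a))"
  proof -
    have g: "(LINT w|lborel. gaussian (w::'a)) = complex_of_real (sqrt (2 * pi) ^ DIM('a))"
      using fourier_integral_gaussian[of 0] by (simp add: fourier_integral_lborel gaussian_def[of 0])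
    have s: "sqrt (2 * pi) ^ DIM('a) * sqrt (2 * pi) ^ DIM('a) = (2 * pi) ^ DIM('a)"
    proof -
      have "sqrt (2 * pi) * sqrt (2 * pi) = 2 * pi" by simp
      then show ?thesis by (simp only: power_mult_distrib[symmetric])
    qed
    show ?thesis by (simp only: integral_mult_right_zero g c0 of_real_mult[symmetric] s)
  qed
  moreover have "complex_of_real (?L k) = (LINT w|lborel. autocorrelation (e k *\<^sub>R w) * (complex_of_real (sqrt (2 * pi) ^ DIM('a)) * gaussian w))" for k
    unfolding gaussian_regularized_plancherel[OF e, symmetric] Gg
    by (simp flip: integral_complex_of_real)
  ultimately have "(\<lambda>k. complex_of_real (?L k)) \<longlonglongrightarrow> complex_of_real ((LINT x|lborel. (cmod (f x))\<^sup>2) * (2 * pi) ^ DIM('a))"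
    by (simp only:)
  then have Llim: "?L \<longlonglongrightarrow> (LINT x|lborel. (cmod (f x))\<^sup>2) * (2 * pi) ^ DIM('a)"
    by (simp only: tendsto_of_real_iff)
  have "(\<lambda>k. \<integral>\<^sup>+\<xi>. ennreal ((cmod (fourier_integral f \<xi>))\<^sup>2 * G k \<xi>) \<partial>lborel) \<longlonglongrightarrow> (\<integral>\<^sup>+\<xi>. ennreal ((cmod (fourier_integral f \<xi>))\<^sup>2) \<partial>lborel)"
  proof (rule nn_integral_LIMSEQ)
    show "incseq (\<lambda>k \<xi>. ennreal ((cmod (fourier_integral f \<xi>))\<^sup>2 * G k \<xi>))"
    proof (intro incseq_SucI le_funI ennreal_leI mult_left_mono)
      fix k and \<xi> :: 'a
      have "e (Suc k) \<le> e k" by (simp add: e_def field_simps)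
      then have "(e (Suc k) * norm \<xi>)\<^sup>2 \<le> (e k * norm \<xi>)\<^sup>2"
        using e[of "Suc k"] by (intro power_mono mult_right_mono) auto
      moreover have "norm (e j *\<^sub>R \<xi>) = e j * norm \<xi>" for j using e[of j] by simp
      ultimately show "G k \<xi> \<le> G (Suc k) \<xi>" by (simp only: G_def exp_le_cancel_iff)
    qed auto
    show "(\<lambda>k. ennreal ((cmod (fourier_integral f \<xi>))\<^sup>2 * G k \<xi>)) \<longlonglongrightarrow> ennreal ((cmod (fourier_integral f \<xi>))\<^sup>2)" for \<xi>
    proof -
      have "(\<lambda>k. complex_of_real (G k \<xi>)) \<longlonglongrightarrow> complex_of_real 1"
        using gaussian_dilated_tendsto[of \<xi>] by (simp add: Gg[symmetric] e_def)
      then have "(\<lambda>k. G k \<xi>) \<longlonglongrightarrow> 1" by (simp only: tendsto_of_real_iff)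
      then have "(\<lambda>k. ennreal ((cmod (fourier_integral f \<xi>))\<^sup>2 * G k \<xi>)) \<longlonglongrightarrow> ennreal ((cmod (fourier_integral f \<xi>))\<^sup>2 * 1)"
        by (intro tendsto_ennrealI tendsto_mult tendsto_const)
      then show ?thesis by simp
    qed
  qed measurable
  moreover have "(\<integral>\<^sup>+\<xi>. ennreal ((cmod (fourier_integral f \<xi>))\<^sup>2 * G k \<xi>) \<partial>lborel) = ennreal (?L k)" for k
    by (rule nn_integral_eq_integral[OF Li]) (auto simp: G_def)
  ultimately have "(\<integral>\<^sup>+\<xi>. ennreal ((cmod (fourier_integral f \<xi>))\<^sup>2) \<partial>lborel) = ennreal ((LINT x|lborel. (cmod (f x))\<^sup>2) * (2 * pi) ^ DIM('a))"
    using LIMSEQ_unique tendsto_ennrealI[OF Llim] by auto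
  also have "\<dots> = ennreal ((2 * pi) ^ DIM('a)) * (\<integral>\<^sup>+x. ennreal ((cmod (f x))\<^sup>2) \<partial>lborel)"
    by (subst nn_integral_eq_integral[OF f2i]) (auto simp: ennreal_mult mult.commute)
  finally show ?thesis .
qed

end

section \<open>The Fourier transform on square-integrable functions\<close>
text \<open>A dense subspace of \<open>L\<^sup>2\<close> on which the transform is an integral and Plancherel's identity is
  available; truncation leads into it.\<close>
definition bounded_integrable :: "('a::euclidean_space \<Rightarrow> complex) \<Rightarrow> bool" where
  "bounded_integrable f \<longleftrightarrow> f \<in> borel_measurable borel \<and> integrable lborel f \<and> (\<exists>C. \<forall>x. cmod (f x) \<le> C)"

lemma bounded_integrable_add: "bounded_integrable f \<Longrightarrow> bounded_integrable g \<Longrightarrow> bounded_integrable (\<lambda>x. f x + g x)"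
  unfolding bounded_integrable_def by (auto, meson add_mono norm_triangle_ineq order_trans)

lemma bounded_integrable_diff: "bounded_integrable f \<Longrightarrow> bounded_integrable g \<Longrightarrow> bounded_integrable (\<lambda>x. f x - g x)"
  unfolding bounded_integrable_def by (auto, meson add_mono norm_triangle_ineq4 order_trans)

lemma bounded_integrable_cmult:
  assumes "bounded_integrable f" shows "bounded_integrable (\<lambda>x. c * f x)"
proof -
  obtain C where "\<And>x. cmod (f x) \<le> C" using assms by (auto simp: bounded_integrable_def)
  then have "\<forall>x. cmod (c * f x) \<le> cmod c * C" by (auto simp: norm_mult intro: mult_left_mono)
  then show ?thesis using assms unfolding bounded_integrable_def by auto
qed

lemma sq_integrable_bounded_integrable:
  assumes "bounded_integrable f" shows "sq_integrable f"
proof -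
  obtain C where f [measurable]: "f \<in> borel_measurable borel" "integrable lborel f" and C: "\<And>x. cmod (f x) \<le> C"
    using assms by (auto simp: bounded_integrable_def)
  have "0 \<le> C" using C[of 0] norm_ge_zero order_trans by blast
  have "integrable lborel (\<lambda>x. (cmod (f x))\<^sup>2)"
  proof (rule Bochner_Integration.integrable_bound)
    show "integrable lborel (\<lambda>x. C * cmod (f x))" using f by simp
    show "AE x in lborel. norm ((cmod (f x))\<^sup>2) \<le> norm (C * cmod (f x))"
      using C \<open>0 \<le> C\<close> by (auto simp: power2_eq_square intro!: mult_right_mono)
  qed measurable
  then show ?thesis using f by (simp add: sq_integrable_borel)
qed

lemma nn_integral_lebesgue_eq: "(\<integral>\<^sup>+x. f x \<partial>lebesgue) = (\<integral>\<^sup>+x. f x \<partial>lborel)"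
  by (rule nn_integral_completion)

lemma plancherel_bounded_integrable:
  assumes "bounded_integrable (f :: 'a::euclidean_space \<Rightarrow> complex)"
  shows "sq_integrable (fourier_integral f)"
    and "norm (abs_L2 (fourier_integral f)) = sqrt ((2 * pi) ^ DIM('a)) * norm (abs_L2 f)"
proof -
  obtain C where f [measurable]: "f \<in> borel_measurable borel" "integrable lborel f" and C: "\<And>x. cmod (f x) \<le> C"
    using assms by (auto simp: bounded_integrable_def)
  note sf = sq_integrable_bounded_integrable[OF assms]
  have nf: "ennreal ((norm (abs_L2 f))\<^sup>2) = (\<integral>\<^sup>+x. ennreal ((cmod (f x))\<^sup>2) \<partial>lborel)"
    unfolding norm_L2_nn nn_integral_lebesgue_eq[symmetric]
    by (rule nn_integral_cong_AE, use rep_abs_L2[OF sf] in eventually_elim) simp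
  have p: "(\<integral>\<^sup>+\<xi>. ennreal ((cmod (fourier_integral f \<xi>))\<^sup>2) \<partial>lborel) = ennreal ((2 * pi) ^ DIM('a) * (norm (abs_L2 f))\<^sup>2)"
    using plancherel_bounded[OF f C] by (simp add: nf[symmetric] ennreal_mult)
  then have "integrable lborel (\<lambda>\<xi>. (cmod (fourier_integral f \<xi>))\<^sup>2)"
    by (intro integrableI_bounded) auto
  then show s: "sq_integrable (fourier_integral f)" by (simp add: sq_integrable_borel)
  have "ennreal ((norm (abs_L2 (fourier_integral f)))\<^sup>2) = (\<integral>\<^sup>+x. ennreal ((cmod (fourier_integral f x))\<^sup>2) \<partial>lborel)"
    unfolding norm_L2_nn nn_integral_lebesgue_eq[symmetric]
    by (rule nn_integral_cong_AE, use rep_abs_L2[OF s] in eventually_elim) simp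
  then have "(norm (abs_L2 (fourier_integral f)))\<^sup>2 = (2 * pi) ^ DIM('a) * (norm (abs_L2 f))\<^sup>2"
    unfolding p by (subst (asm) ennreal_inj) auto
  then have "sqrt ((norm (abs_L2 (fourier_integral f)))\<^sup>2) = sqrt ((2 * pi) ^ DIM('a) * (norm (abs_L2 f))\<^sup>2)" by simp
  then show "norm (abs_L2 (fourier_integral f)) = sqrt ((2 * pi) ^ DIM('a)) * norm (abs_L2 f)"
    by (simp add: real_sqrt_mult)
qed

lemma abs_L2_diff:
  assumes "sq_integrable f" "sq_integrable g"
  shows "abs_L2 (\<lambda>x. f x - g x) = abs_L2 f - abs_L2 g"
  by (rule L2_eqI, use rep_abs_L2[OF sq_integrable_diff[OF assms]] rep_abs_L2[OF assms(1)] rep_abs_L2[OF assms(2)]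
    rep_L2_diff[of "abs_L2 f" "abs_L2 g"] in eventually_elim) simp

lemma abs_L2_add:
  assumes "sq_integrable f" "sq_integrable g"
  shows "abs_L2 (\<lambda>x. f x + g x) = abs_L2 f + abs_L2 g"
  by (rule L2_eqI, use rep_abs_L2[OF sq_integrable_add[OF assms]] rep_abs_L2[OF assms(1)] rep_abs_L2[OF assms(2)]
    rep_L2_add[of "abs_L2 f" "abs_L2 g"] in eventually_elim) simp

lemma abs_L2_cmult:
  assumes "sq_integrable f"
  shows "abs_L2 (\<lambda>x. c * f x) = scaleC_L2 c (abs_L2 f)"
  by (rule L2_eqI, use rep_abs_L2[OF sq_integrable_cmult[OF assms]] rep_abs_L2[OF assms(1)]
    rep_L2_scaleC[of c "abs_L2 f"] in eventually_elim) simp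

lemma fourier_integral_add:
  assumes "integrable lborel f" "integrable lborel g" "f \<in> borel_measurable borel" "g \<in> borel_measurable borel"
  shows "fourier_integral (\<lambda>x. f x + g x) = (\<lambda>\<xi>. fourier_integral f \<xi> + fourier_integral g \<xi>)"
proof
  fix \<xi>
  note [measurable] = assms(3,4)
  have "integrable lborel (\<lambda>x. cis (- (x \<bullet> \<xi>)) * f x)" "integrable lborel (\<lambda>x. cis (- (x \<bullet> \<xi>)) * g x)"
    by (intro integrable_cis_mult assms; measurable)+
  then show "fourier_integral (\<lambda>x. f x + g x) \<xi> = fourier_integral f \<xi> + fourier_integral g \<xi>"
    by (simp add: fourier_integral_lborel distrib_left)
qed

lemma fourier_integral_cmult:
  assumes "f \<in> borel_measurable borel"
  shows "fourier_integral (\<lambda>x. c * f x) = (\<lambda>\<xi>. c * fourier_integral f \<xi>)"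
proof
  fix \<xi>
  note [measurable] = assms
  have "(LINT x|lborel. cis (- (x \<bullet> \<xi>)) * (c * f x)) = (LINT x|lborel. c * (cis (- (x \<bullet> \<xi>)) * f x))"
    by (simp add: mult_ac)
  then show "fourier_integral (\<lambda>x. c * f x) \<xi> = c * fourier_integral f \<xi>"
    by (simp add: fourier_integral_lborel)
qed

lemma fourier_integral_diff:
  assumes "integrable lborel f" "integrable lborel g" "f \<in> borel_measurable borel" "g \<in> borel_measurable borel"
  shows "fourier_integral (\<lambda>x. f x - g x) = (\<lambda>\<xi>. fourier_integral f \<xi> - fourier_integral g \<xi>)"
  using fourier_integral_add[of f "\<lambda>x. (-1) * g x"] fourier_integral_cmult[of g "-1"] assms by simp

lemma norm_fourier_integral_diff:
  fixes f g :: "'a::euclidean_space \<Rightarrow> complex"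
  assumes f: "bounded_integrable f" and g: "bounded_integrable g"
  shows "norm (abs_L2 (fourier_integral f) - abs_L2 (fourier_integral g)) = sqrt ((2 * pi) ^ DIM('a)) * norm (abs_L2 f - abs_L2 g)"
proof -
  have "fourier_integral (\<lambda>x. f x - g x) = (\<lambda>\<xi>. fourier_integral f \<xi> - fourier_integral g \<xi>)"
    using assms by (intro fourier_integral_diff) (auto simp: bounded_integrable_def)
  then show ?thesis
    using plancherel_bounded_integrable(2)[OF bounded_integrable_diff[OF f g]]
      plancherel_bounded_integrable(1)[OF f] plancherel_bounded_integrable(1)[OF g]
      sq_integrable_bounded_integrable[OF f] sq_integrable_bounded_integrable[OF g]
    by (simp add: abs_L2_diff)
qed

definition truncation :: "nat \<Rightarrow> ('a::euclidean_space \<Rightarrow> complex) \<Rightarrow> 'a \<Rightarrow> complex" where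
  "truncation k f = (\<lambda>x. if cmod (f x) \<le> real k \<and> norm x \<le> real k then f x else 0)"

lemma truncation_measurable [measurable]:
  assumes [measurable]: "f \<in> borel_measurable borel" shows "truncation k f \<in> borel_measurable borel"
  unfolding truncation_def by measurable

lemma truncation_le: "cmod (truncation k f x) \<le> cmod (f x)" "cmod (truncation k f x) \<le> real k"
  by (auto simp: truncation_def)

lemma truncation_diff_le: "cmod (truncation k f x - f x) \<le> cmod (f x)"
  by (auto simp: truncation_def)

lemma truncation_tendsto: "(\<lambda>k. truncation k f x) \<longlonglongrightarrow> f x"
proof (rule tendsto_eventually)
  obtain N where "max (cmod (f x)) (norm x) \<le> real N" using real_arch_simple by blast
  then have "truncation k f x = f x" if "k \<ge> N" for k using that by (auto simp: truncation_def)
  then show "\<forall>\<^sub>F k in sequentially. truncation k f x = f x" by (auto simp: eventually_sequentially)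
qed

lemma bounded_integrable_truncation:
  fixes f :: "'a::euclidean_space \<Rightarrow> complex"
  assumes [measurable]: "f \<in> borel_measurable borel" shows "bounded_integrable (truncation k f)"
  unfolding bounded_integrable_def
proof (intro conjI exI allI)
  show "truncation k f \<in> borel_measurable borel" by measurable
  show "integrable lborel (truncation k f)"
  proof (rule Bochner_Integration.integrable_bound)
    show "integrable lborel (\<lambda>x::'a. real k * indicator (cball 0 (real k)) x)"
      using emeasure_lborel_cball_finite[of "0::'a" "real k"] by (intro integrable_mult_right) (simp add: integrable_indicator_iff)
  qed (auto simp: truncation_def)
  show "cmod (truncation k f x) \<le> real k" for x by (rule truncation_le)
qed

definition borel_rep :: "'a::euclidean_space L2 \<Rightarrow> 'a \<Rightarrow> complex" where
  "borel_rep u = (SOME f. f \<in> borel_measurable borel \<and> (AE x in lebesgue. rep_L2 u x = f x))"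

lemma borel_rep_measurable [measurable]: "borel_rep u \<in> borel_measurable borel"
  and borel_rep_AE: "AE x in lebesgue. rep_L2 u x = borel_rep u x"
proof -
  have "\<exists>f. f \<in> borel_measurable borel \<and> (AE x in lebesgue. rep_L2 u x = f x)"
    using L2_borel_representative[of u] by metis
  from someI_ex[OF this] show "borel_rep u \<in> borel_measurable borel" "AE x in lebesgue. rep_L2 u x = borel_rep u x"
    unfolding borel_rep_def by auto
qed

lemma sq_integrable_borel_rep: "sq_integrable (borel_rep u)"
proof (rule sq_integrable_bound[OF rep_L2_sq_integrable[of u], where c=1])
  show "AE x in lebesgue. cmod (borel_rep u x) \<le> 1 * cmod (rep_L2 u x)"
    using borel_rep_AE[of u] by eventually_elim simp
qed (rule borel_imp_lebesgue_measurable, measurable)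

lemma abs_borel_rep: "abs_L2 (borel_rep u) = u"
  by (rule L2_eqI, use rep_abs_L2[OF sq_integrable_borel_rep[of u]] borel_rep_AE[of u] in eventually_elim) simp

lemma truncation_tendsto_L2:
  assumes [measurable]: "f \<in> borel_measurable borel" and f: "sq_integrable f"
  shows "(\<lambda>k. abs_L2 (truncation k f)) \<longlonglongrightarrow> abs_L2 f"
proof (rule L2_dominated_convergence[where c=1 and w="abs_L2 f"])
  have a: "AE x in lebesgue. \<forall>k. rep_L2 (abs_L2 (truncation k f)) x = truncation k f x"
    unfolding AE_all_countable
    using rep_abs_L2[OF sq_integrable_bounded_integrable[OF bounded_integrable_truncation[OF assms(1)]]] by blast
  then show "AE x in lebesgue. (\<lambda>k. rep_L2 (abs_L2 (truncation k f)) x) \<longlonglongrightarrow> rep_L2 (abs_L2 f) x"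
    using rep_abs_L2[OF f] by eventually_elim (simp add: truncation_tendsto)
  show "AE x in lebesgue. cmod (rep_L2 (abs_L2 (truncation k f)) x - rep_L2 (abs_L2 f) x) \<le> 1 * cmod (rep_L2 (abs_L2 f) x)" for k
    using a rep_abs_L2[OF f] by eventually_elim (simp add: truncation_diff_le)
qed

text \<open>By \<open>fourier_L2_lim\<close>, any other approximation by bounded integrable functions gives the same
  limit.\<close>
definition fourier_L2 :: "'a::euclidean_space L2 \<Rightarrow> 'a L2" where
  "fourier_L2 u = lim (\<lambda>k. abs_L2 (fourier_integral (truncation k (borel_rep u))))"

abbreviation fhat :: "'a::euclidean_space L2 \<Rightarrow> 'a \<Rightarrow> complex" where
  "fhat u \<equiv> rep_L2 (fourier_L2 u)"

text \<open>On bounded integrable functions the transform multiplies distances by a constant. So it maps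
  Cauchy sequences to Cauchy sequences, and two approximations of \<open>u\<close> to equivalent ones.\<close>
lemma fourier_L2_lim:
  fixes f :: "nat \<Rightarrow> 'a::euclidean_space \<Rightarrow> complex"
  assumes f: "\<And>k. bounded_integrable (f k)" and lim: "(\<lambda>k. abs_L2 (f k)) \<longlonglongrightarrow> u"
  shows "(\<lambda>k. abs_L2 (fourier_integral (f k))) \<longlonglongrightarrow> fourier_L2 u"
proof -
  let ?c = "sqrt ((2 * pi) ^ DIM('a))"
  have c0: "?c > 0" by simp
  have Cau: "Cauchy (\<lambda>k. abs_L2 (fourier_integral (g k)))"
    if g: "\<And>k. bounded_integrable (g k)" and gl: "(\<lambda>k. abs_L2 (g k)) \<longlonglongrightarrow> u" for g :: "nat \<Rightarrow> 'a \<Rightarrow> complex"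
  proof -
    have "Cauchy (\<lambda>k. abs_L2 (g k))" using gl by (rule LIMSEQ_imp_Cauchy)
    then have "\<exists>M. \<forall>m\<ge>M. \<forall>n\<ge>M. norm (abs_L2 (g m) - abs_L2 (g n)) < e / ?c" if "e > 0" for e
      using that c0 unfolding Cauchy_iff by (meson divide_pos_pos)
    then show ?thesis
      unfolding Cauchy_iff norm_fourier_integral_diff[OF g g] using c0 by (simp add: pos_less_divide_eq mult.commute)
  qed
  let ?g = "\<lambda>k. truncation k (borel_rep u)"
  have g: "bounded_integrable (?g k)" for k by (intro bounded_integrable_truncation) measurable
  have gl: "(\<lambda>k. abs_L2 (?g k)) \<longlonglongrightarrow> u"
    using truncation_tendsto_L2[OF borel_rep_measurable sq_integrable_borel_rep] by (simp add: abs_borel_rep)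
  have "(\<lambda>k. abs_L2 (fourier_integral (?g k))) \<longlonglongrightarrow> fourier_L2 u"
    unfolding fourier_L2_def using Cauchy_convergent[OF Cau[OF g gl]] by (simp add: convergent_LIMSEQ_iff)
  moreover have "(\<lambda>k. abs_L2 (fourier_integral (f k)) - abs_L2 (fourier_integral (?g k))) \<longlonglongrightarrow> 0"
  proof (rule tendsto_norm_zero_cancel)
    have "(\<lambda>k. abs_L2 (f k) - abs_L2 (?g k)) \<longlonglongrightarrow> u - u" by (intro tendsto_diff lim gl)
    then have "(\<lambda>k. ?c * norm (abs_L2 (f k) - abs_L2 (?g k))) \<longlonglongrightarrow> ?c * 0"
      by (intro tendsto_mult tendsto_const tendsto_norm_zero) simp
    then show "(\<lambda>k. norm (abs_L2 (fourier_integral (f k)) - abs_L2 (fourier_integral (?g k)))) \<longlonglongrightarrow> 0"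
      unfolding norm_fourier_integral_diff[OF f g] by simp
  qed
  ultimately show ?thesis using tendsto_add[of _ "fourier_L2 u" sequentially _ 0] by fastforce
qed

lemma bounded_integrable_approx:
  obtains f where "\<And>k. bounded_integrable (f k)" "(\<lambda>k. abs_L2 (f k)) \<longlonglongrightarrow> u"
proof
  show "bounded_integrable (truncation k (borel_rep u))" for k by (intro bounded_integrable_truncation) measurable
  show "(\<lambda>k. abs_L2 (truncation k (borel_rep u))) \<longlonglongrightarrow> u"
    using truncation_tendsto_L2[OF borel_rep_measurable sq_integrable_borel_rep] by (simp add: abs_borel_rep)
qed

lemma norm_fourier_L2: "norm (fourier_L2 u) = sqrt ((2 * pi) ^ DIM('a)) * norm (u :: 'a::euclidean_space L2)"
proof -
  obtain f where f: "\<And>k. bounded_integrable (f k)" "(\<lambda>k. abs_L2 (f k)) \<longlonglongrightarrow> u" using bounded_integrable_approx[of u] by metis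
  have "(\<lambda>k. norm (abs_L2 (fourier_integral (f k)))) \<longlonglongrightarrow> norm (fourier_L2 u)"
    by (intro tendsto_norm fourier_L2_lim f)
  moreover have "(\<lambda>k. norm (abs_L2 (fourier_integral (f k)))) \<longlonglongrightarrow> sqrt ((2 * pi) ^ DIM('a)) * norm u"
    unfolding plancherel_bounded_integrable(2)[OF f(1)] by (intro tendsto_mult tendsto_const tendsto_norm f)
  ultimately show ?thesis by (rule LIMSEQ_unique)
qed

lemma fourier_L2_add: "fourier_L2 (u + v) = fourier_L2 u + fourier_L2 v"
proof -
  obtain f where f: "\<And>k. bounded_integrable (f k)" "(\<lambda>k. abs_L2 (f k)) \<longlonglongrightarrow> u" using bounded_integrable_approx[of u] by metis
  obtain g where g: "\<And>k. bounded_integrable (g k)" "(\<lambda>k. abs_L2 (g k)) \<longlonglongrightarrow> v" using bounded_integrable_approx[of v] by metis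
  have "abs_L2 (\<lambda>x. f k x + g k x) = abs_L2 (f k) + abs_L2 (g k)" for k
    by (intro abs_L2_add sq_integrable_bounded_integrable f g)
  then have "(\<lambda>k. abs_L2 (\<lambda>x. f k x + g k x)) \<longlonglongrightarrow> u + v"
    using tendsto_add[OF f(2) g(2)] by simp
  from fourier_L2_lim[OF bounded_integrable_add[OF f(1) g(1)] this]
  have "(\<lambda>k. abs_L2 (fourier_integral (\<lambda>x. f k x + g k x))) \<longlonglongrightarrow> fourier_L2 (u + v)" .
  moreover have "abs_L2 (fourier_integral (\<lambda>x. f k x + g k x)) = abs_L2 (fourier_integral (f k)) + abs_L2 (fourier_integral (g k))" for k
  proof -
    have "fourier_integral (\<lambda>x. f k x + g k x) = (\<lambda>\<xi>. fourier_integral (f k) \<xi> + fourier_integral (g k) \<xi>)"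
      using f(1)[of k] g(1)[of k] by (intro fourier_integral_add) (auto simp: bounded_integrable_def)
    then show ?thesis using plancherel_bounded_integrable(1)[OF f(1)[of k]] plancherel_bounded_integrable(1)[OF g(1)[of k]]
      by (simp add: abs_L2_add)
  qed
  ultimately have "(\<lambda>k. abs_L2 (fourier_integral (f k)) + abs_L2 (fourier_integral (g k))) \<longlonglongrightarrow> fourier_L2 (u + v)" by simp
  moreover have "(\<lambda>k. abs_L2 (fourier_integral (f k)) + abs_L2 (fourier_integral (g k))) \<longlonglongrightarrow> fourier_L2 u + fourier_L2 v"
    by (intro tendsto_add fourier_L2_lim f g)
  ultimately show ?thesis by (rule LIMSEQ_unique)
qed

lemma tendsto_scaleC_L2:
  assumes "(X \<longlongrightarrow> u) F" shows "((\<lambda>k. scaleC_L2 c (X k)) \<longlongrightarrow> scaleC_L2 c u) F"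
proof -
  have "((\<lambda>k. cmod c * norm (X k - u)) \<longlongrightarrow> cmod c * 0) F"
    using assms by (intro tendsto_mult tendsto_const) (simp add: LIM_zero_iff tendsto_norm_zero_iff)
  then have "((\<lambda>k. norm (scaleC_L2 c (X k) - scaleC_L2 c u)) \<longlongrightarrow> 0) F"
    unfolding scaleC_L2_diff[symmetric] by (simp only: norm_scaleC_L2 mult_zero_right)
  then have "((\<lambda>k. scaleC_L2 c (X k) - scaleC_L2 c u) \<longlongrightarrow> 0) F"
    by (rule tendsto_norm_zero_cancel)
  then show ?thesis by (simp add: LIM_zero_iff)
qed

lemma fourier_L2_scaleC: "fourier_L2 (scaleC_L2 c u) = scaleC_L2 c (fourier_L2 u)"
proof -
  obtain f where f: "\<And>k. bounded_integrable (f k)" "(\<lambda>k. abs_L2 (f k)) \<longlonglongrightarrow> u" using bounded_integrable_approx[of u] by metis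
  have "abs_L2 (\<lambda>x. c * f k x) = scaleC_L2 c (abs_L2 (f k))" for k
    by (intro abs_L2_cmult sq_integrable_bounded_integrable f)
  then have "(\<lambda>k. abs_L2 (\<lambda>x. c * f k x)) \<longlonglongrightarrow> scaleC_L2 c u"
    using tendsto_scaleC_L2[OF f(2)] by simp
  from fourier_L2_lim[OF bounded_integrable_cmult[OF f(1)] this]
  have "(\<lambda>k. abs_L2 (fourier_integral (\<lambda>x. c * f k x))) \<longlonglongrightarrow> fourier_L2 (scaleC_L2 c u)" .
  moreover have "abs_L2 (fourier_integral (\<lambda>x. c * f k x)) = scaleC_L2 c (abs_L2 (fourier_integral (f k)))" for k
  proof -
    have "fourier_integral (\<lambda>x. c * f k x) = (\<lambda>\<xi>. c * fourier_integral (f k) \<xi>)"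
      using f(1)[of k] by (intro fourier_integral_cmult) (auto simp: bounded_integrable_def)
    then show ?thesis using plancherel_bounded_integrable(1)[OF f(1)[of k]] by (simp add: abs_L2_cmult)
  qed
  ultimately have "(\<lambda>k. scaleC_L2 c (abs_L2 (fourier_integral (f k)))) \<longlonglongrightarrow> fourier_L2 (scaleC_L2 c u)" by simp
  moreover have "(\<lambda>k. scaleC_L2 c (abs_L2 (fourier_integral (f k)))) \<longlonglongrightarrow> scaleC_L2 c (fourier_L2 u)"
    by (intro tendsto_scaleC_L2 fourier_L2_lim f)
  ultimately show ?thesis by (rule LIMSEQ_unique)
qed

lemma fourier_L2_scaleR: "fourier_L2 (c *\<^sub>R u) = c *\<^sub>R fourier_L2 u"
  using fourier_L2_scaleC[of "complex_of_real c" u] by (simp add: scaleC_L2_of_real)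

lemma bounded_linear_fourier_L2: "bounded_linear (fourier_L2 :: 'a::euclidean_space L2 \<Rightarrow> 'a L2)"
  by (rule bounded_linear_intro[where K = "sqrt ((2 * pi) ^ DIM('a))"])
     (auto simp: fourier_L2_add fourier_L2_scaleR norm_fourier_L2)

text \<open>The truncations of \<open>f\<close> converge to \<open>f\<close> both in \<open>L\<^sup>1\<close> and in \<open>L\<^sup>2\<close>; the transforms converge
  everywhere by the first and, along a subsequence, almost everywhere to \<open>fourier_L2\<close> by the
  second.\<close>
lemma fourier_L2_integrable:
  fixes f :: "'a::euclidean_space \<Rightarrow> complex"
  assumes f [measurable]: "f \<in> borel_measurable borel" and i: "integrable lborel f" and s: "sq_integrable f"
  shows "AE \<xi> in lebesgue. fhat (abs_L2 f) \<xi> = fourier_integral f \<xi>"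
proof -
  let ?f = "\<lambda>k. truncation k f"
  have b: "bounded_integrable (?f k)" for k by (rule bounded_integrable_truncation[OF f])
  have "(\<lambda>k. abs_L2 (fourier_integral (?f k))) \<longlonglongrightarrow> fourier_L2 (abs_L2 f)"
    by (rule fourier_L2_lim[OF b truncation_tendsto_L2[OF f s]])
  from L2_tendsto_AE_subseq[OF this] obtain r where r: "strict_mono r"
    "AE \<xi> in lebesgue. (\<lambda>k. rep_L2 (abs_L2 (fourier_integral (?f (r k)))) \<xi>) \<longlonglongrightarrow> fhat (abs_L2 f) \<xi>" .
  have a: "AE \<xi> in lebesgue. \<forall>k. rep_L2 (abs_L2 (fourier_integral (?f (r k)))) \<xi> = fourier_integral (?f (r k)) \<xi>"
    unfolding AE_all_countable using rep_abs_L2[OF plancherel_bounded_integrable(1)[OF b]] by blast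
  have p: "(\<lambda>k. fourier_integral (?f k) \<xi>) \<longlonglongrightarrow> fourier_integral f \<xi>" for \<xi>
    unfolding fourier_integral_lborel[OF f] fourier_integral_lborel[OF truncation_measurable[OF f]]
  proof (rule integral_dominated_convergence[where w = "\<lambda>x. cmod (f x)"])
    show "AE x in lborel. (\<lambda>k. cis (- (x \<bullet> \<xi>)) * ?f k x) \<longlonglongrightarrow> cis (- (x \<bullet> \<xi>)) * f x"
      by (intro AE_I2 tendsto_mult tendsto_const truncation_tendsto)
    show "AE x in lborel. norm (cis (- (x \<bullet> \<xi>)) * ?f k x) \<le> cmod (f x)" for k
      by (intro AE_I2) (simp add: norm_mult truncation_le)
  qed (use i in auto)
  show ?thesis using r(2) a
  proof eventually_elim
    case (elim \<xi>)
    then have "(\<lambda>k. fourier_integral (?f (r k)) \<xi>) \<longlonglongrightarrow> fhat (abs_L2 f) \<xi>" by simp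
    moreover have "(\<lambda>k. fourier_integral (?f (r k)) \<xi>) \<longlonglongrightarrow> fourier_integral f \<xi>"
      using LIMSEQ_subseq_LIMSEQ[OF p r(1)] by (simp add: o_def)
    ultimately show ?case by (rule LIMSEQ_unique)
  qed
qed

lemma integrable_bounded_support:
  fixes f :: "'a::euclidean_space \<Rightarrow> complex"
  assumes [measurable]: "f \<in> borel_measurable borel" "S \<in> sets borel"
    and s: "sq_integrable f" and z: "\<And>x. x \<notin> S \<Longrightarrow> f x = 0" and S: "emeasure lborel S < \<infinity>"
  shows "integrable lborel f"
proof (rule Bochner_Integration.integrable_bound)
  show "integrable lborel (\<lambda>x. indicator S x + (cmod (f x))\<^sup>2)"
    using s S sq_integrable_borel[of f] by (intro Bochner_Integration.integrable_add) (auto simp: integrable_indicator_iff)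
  show "AE x in lborel. norm (f x) \<le> norm (indicator S x + (cmod (f x))\<^sup>2)"
  proof (intro AE_I2)
    fix x
    have "0 \<le> (cmod (f x) - 1)\<^sup>2" by simp
    then have "cmod (f x) \<le> 1 + (cmod (f x))\<^sup>2"
      by (simp add: power2_diff) (smt (verit) norm_ge_zero)
    then show "norm (f x) \<le> norm (indicator S x + (cmod (f x))\<^sup>2)"
      using z[of x] by (cases "x \<in> S") (auto simp: indicator_def)
  qed
qed measurable

lemma fourier_integral_cong_AE:
  assumes "AE x in lebesgue. f x = g x" "f \<in> borel_measurable lebesgue" "g \<in> borel_measurable lebesgue"
  shows "fourier_integral f \<xi> = fourier_integral g \<xi>"
proof -
  note [measurable] = assms(2,3)
  have [measurable]: "(\<lambda>x. cis (- (x \<bullet> \<xi>))) \<in> borel_measurable lebesgue"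
    by (rule borel_imp_lebesgue_measurable) measurable
  show ?thesis unfolding fourier_integral_def
  proof (rule integral_cong_AE)
    show "AE x in lebesgue. cis (- (x \<bullet> \<xi>)) * f x = cis (- (x \<bullet> \<xi>)) * g x"
      using assms(1) by eventually_elim simp
  qed measurable
qed

text \<open>The truncations of \<open>u\<close> to balls are integrable and tend to \<open>u\<close> in mean; by continuity their
  transforms tend to \<open>fourier_L2 u\<close>, and mean limits are unique.\<close>
theorem has_fourier_transform_iff: "has_fourier_transform u w \<longleftrightarrow> w = fourier_L2 (u :: 'a::euclidean_space L2)"
proof -
  define v where "v R = abs_L2 (\<lambda>x. indicator (cball 0 R) x * borel_rep u x)" for R :: real
  have m: "(\<lambda>x. indicator (cball 0 R) x * borel_rep u x) \<in> borel_measurable borel" for R :: real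
  proof -
    have [measurable]: "cball (0::'a) R \<in> sets borel" by simp
    show ?thesis by measurable
  qed
  have sq: "sq_integrable (\<lambda>x. indicator (cball 0 R) x * borel_rep u x)" for R :: real
    by (rule sq_integrable_indicator[OF sq_integrable_borel_rep]) auto
  have i: "integrable lborel (\<lambda>x. indicator (cball 0 R) x * borel_rep u x)" for R :: real
    by (rule integrable_bounded_support[OF m _ sq, of "cball 0 R"]) (use emeasure_lborel_cball_finite[of "0::'a" R] in auto)
  have eq: "fourier_integral (\<lambda>x. indicator (cball 0 R) x * rep_L2 u x) \<xi> = fourier_integral (\<lambda>x. indicator (cball 0 R) x * borel_rep u x) \<xi>" for R :: real and \<xi>
  proof (rule fourier_integral_cong_AE)
    show "AE x in lebesgue. indicator (cball 0 R) x * rep_L2 u x = indicator (cball 0 R) x * borel_rep u x"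
      using borel_rep_AE[of u] by eventually_elim simp
    show "(\<lambda>x. indicator (cball 0 R) x * borel_rep u x) \<in> borel_measurable lebesgue" using sq by (simp add: sq_integrable_def)
    show "(\<lambda>x. indicator (cball 0 R) x * rep_L2 u x) \<in> borel_measurable lebesgue"
      using sq_integrable_indicator[OF rep_L2_sq_integrable[of u], of "cball 0 R"] by (simp add: sq_integrable_def)
  qed
  have "(\<integral>\<^sup>+ \<xi>. ennreal ((cmod (fourier_integral (\<lambda>x. indicator (cball 0 R) x * rep_L2 u x) \<xi> - rep_L2 w \<xi>))\<^sup>2) \<partial>lebesgue)
     = (\<integral>\<^sup>+ \<xi>. ennreal ((cmod (fhat (v R) \<xi> - rep_L2 w \<xi>))\<^sup>2) \<partial>lebesgue)" for R :: real
    unfolding eq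
    by (rule nn_integral_cong_AE, use fourier_L2_integrable[OF m i sq, of R, folded v_def] in eventually_elim) simp
  then have 1: "has_fourier_transform u w \<longleftrightarrow> ((\<lambda>R. fourier_L2 (v R)) \<longlongrightarrow> w) at_top"
    unfolding has_fourier_transform_def tendsto_L2_iff_nn_integral by simp
  have "(v \<longlongrightarrow> u) at_top"
  proof (rule tendsto_at_topI_sequentially)
    fix X :: "nat \<Rightarrow> real" assume X: "filterlim X at_top sequentially"
    show "(\<lambda>k. v (X k)) \<longlonglongrightarrow> u"
    proof (rule L2_dominated_convergence[where c=1 and w=u])
      have a: "AE x in lebesgue. \<forall>k. rep_L2 (v (X k)) x = indicator (cball 0 (X k)) x * borel_rep u x"
        unfolding AE_all_countable v_def using rep_abs_L2[OF sq] by blast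
      then show "AE x in lebesgue. (\<lambda>k. rep_L2 (v (X k)) x) \<longlonglongrightarrow> rep_L2 u x"
        using borel_rep_AE[of u]
      proof eventually_elim
        case (elim x)
        have "\<forall>\<^sub>F k in sequentially. X k \<ge> norm x" using X by (simp add: filterlim_at_top)
        then have "\<forall>\<^sub>F k in sequentially. rep_L2 (v (X k)) x = rep_L2 u x"
          by eventually_elim (use elim in simp)
        then show ?case by (rule tendsto_eventually)
      qed
      show "AE x in lebesgue. cmod (rep_L2 (v (X k)) x - rep_L2 u x) \<le> 1 * cmod (rep_L2 u x)" for k
        using a borel_rep_AE[of u] by eventually_elim (auto simp: indicator_def)
    qed
  qed
  then have "((\<lambda>R. fourier_L2 (v R)) \<longlongrightarrow> fourier_L2 u) at_top"
    by (rule bounded_linear.tendsto[OF bounded_linear_fourier_L2])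
  then show ?thesis unfolding 1 by (metis tendsto_unique trivial_limit_at_top_linorder)
qed

section \<open>Fourier inversion\<close>

lift_definition cnj_L2 :: "'a::euclidean_space L2 \<Rightarrow> 'a L2" is "\<lambda>f x. cnj (f x)"
  by (auto simp: L2_rel_def sq_integrable_def)

lemma sq_integrable_cnj: "sq_integrable f \<Longrightarrow> sq_integrable (\<lambda>x. cnj (f x))"
  by (auto simp: sq_integrable_def)

lemma rep_cnj_L2: "AE x in lebesgue. rep_L2 (cnj_L2 u) x = cnj (rep_L2 u x)"
  unfolding cnj_L2_def using rep_abs_L2[OF sq_integrable_cnj[OF rep_L2_sq_integrable]] by simp

lemma cnj_L2_cnj_L2 [simp]: "cnj_L2 (cnj_L2 u) = u"
  by (rule L2_eqI, use rep_cnj_L2[of u] rep_cnj_L2[of "cnj_L2 u"] in eventually_elim) simp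

lemma norm_cnj_L2 [simp]: "norm (cnj_L2 u) = norm u"
  by (rule norm_L2_cong, use rep_cnj_L2[of u] in eventually_elim) simp

lemma cnj_L2_diff: "cnj_L2 (u - v) = cnj_L2 u - cnj_L2 v"
  by (rule L2_eqI, use rep_cnj_L2[of u] rep_cnj_L2[of v] rep_cnj_L2[of "u - v"] rep_L2_diff[of u v] rep_L2_diff[of "cnj_L2 u" "cnj_L2 v"] in eventually_elim) simp

lemma cnj_L2_scaleR: "cnj_L2 (c *\<^sub>R u) = c *\<^sub>R cnj_L2 u"
  by (rule L2_eqI, use rep_cnj_L2[of u] rep_cnj_L2[of "c *\<^sub>R u"] rep_L2_scaleR[of c u] rep_L2_scaleR[of c "cnj_L2 u"] in eventually_elim) simp

lemma tendsto_cnj_L2: assumes "(X \<longlongrightarrow> u) F" shows "((\<lambda>k. cnj_L2 (X k)) \<longlongrightarrow> cnj_L2 u) F"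
proof -
  have "((\<lambda>k. norm (cnj_L2 (X k) - cnj_L2 u)) \<longlongrightarrow> 0) F"
    using assms unfolding cnj_L2_diff[symmetric] norm_cnj_L2 by (simp add: LIM_zero_iff tendsto_norm_zero_iff)
  then show ?thesis by (rule LIM_zero_cancel[OF tendsto_norm_zero_cancel])
qed

lemma inner_abs_L2:
  assumes f: "sq_integrable f" "f \<in> borel_measurable borel" and g: "sq_integrable g" "g \<in> borel_measurable borel"
  shows "abs_L2 f \<bullet> abs_L2 g = Re (LINT x|lborel. f x * cnj (g x))"
    and "integrable lborel (\<lambda>x. f x * cnj (g x))"
proof -
  have [measurable]: "f \<in> borel_measurable borel" "g \<in> borel_measurable borel" by fact+
  show i: "integrable lborel (\<lambda>x. f x * cnj (g x))"
  proof (rule Bochner_Integration.integrable_bound)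
    show "integrable lborel (\<lambda>x. (cmod (f x))\<^sup>2 + (cmod (g x))\<^sup>2)" using f g by (simp add: sq_integrable_borel)
    show "AE x in lborel. norm (f x * cnj (g x)) \<le> norm ((cmod (f x))\<^sup>2 + (cmod (g x))\<^sup>2)"
    proof (intro AE_I2)
      fix x
      have "0 \<le> (cmod (f x) - cmod (g x))\<^sup>2" "0 \<le> cmod (f x) * cmod (g x)" by auto
      then have "cmod (f x) * cmod (g x) \<le> (cmod (f x))\<^sup>2 + (cmod (g x))\<^sup>2"
        unfolding power2_diff by linarith
      then show "norm (f x * cnj (g x)) \<le> norm ((cmod (f x))\<^sup>2 + (cmod (g x))\<^sup>2)"
        by (simp add: norm_mult)
    qed
  qed measurable
  have "abs_L2 f \<bullet> abs_L2 g = (LINT x|lebesgue. f x \<bullet> g x)"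
    unfolding inner_L2_eq
  proof (rule integral_cong_AE)
    show "AE x in lebesgue. rep_L2 (abs_L2 f) x \<bullet> rep_L2 (abs_L2 g) x = f x \<bullet> g x"
      using rep_abs_L2[OF f(1)] rep_abs_L2[OF g(1)] by eventually_elim simp
    have [measurable]: "f \<in> borel_measurable lebesgue" "g \<in> borel_measurable lebesgue"
      using f g by (auto simp: sq_integrable_def)
    show "(\<lambda>x. f x \<bullet> g x) \<in> borel_measurable lebesgue" by measurable
  qed measurable
  also have "\<dots> = (LINT x|lborel. f x \<bullet> g x)" by (rule integral_completion) measurable
  also have "\<dots> = (LINT x|lborel. Re (f x * cnj (g x)))" by (simp add: inner_complex_def)
  also have "\<dots> = Re (LINT x|lborel. f x * cnj (g x))" by (rule integral_bounded_linear[OF bounded_linear_Re i])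
  finally show "abs_L2 f \<bullet> abs_L2 g = Re (LINT x|lborel. f x * cnj (g x))" .
qed

text \<open>The multiplication formula, extended by density. The real inner product of \<open>u\<close> and \<open>cnj_L2 v\<close>
  is the real part of the integral of \<open>u v\<close>, which is why the conjugations appear.\<close>
lemma fourier_L2_adjoint: "fourier_L2 u \<bullet> cnj_L2 v = u \<bullet> cnj_L2 (fourier_L2 v)"
proof -
  obtain f where f: "\<And>k. bounded_integrable (f k)" "(\<lambda>k. abs_L2 (f k)) \<longlonglongrightarrow> u" using bounded_integrable_approx[of u] by metis
  obtain g where g: "\<And>k. bounded_integrable (g k)" "(\<lambda>k. abs_L2 (g k)) \<longlonglongrightarrow> v" using bounded_integrable_approx[of v] by metis
  have fm [measurable]: "f k \<in> borel_measurable borel" and gm [measurable]: "g k \<in> borel_measurable borel"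
    and fi: "integrable lborel (f k)" and gi: "integrable lborel (g k)" for k
    using f(1)[of k] g(1)[of k] by (auto simp: bounded_integrable_def)
  note sf = sq_integrable_bounded_integrable[OF f(1)] plancherel_bounded_integrable(1)[OF f(1)]
  note sg = sq_integrable_bounded_integrable[OF g(1)] plancherel_bounded_integrable(1)[OF g(1)]
  have abs_cnj: "cnj_L2 (abs_L2 h) = abs_L2 (\<lambda>x. cnj (h x))" if "sq_integrable h" for h :: "'a \<Rightarrow> complex"
    by (rule L2_eqI, use rep_cnj_L2[of "abs_L2 h"] rep_abs_L2[OF that] rep_abs_L2[OF sq_integrable_cnj[OF that]] in eventually_elim) simp
  have "abs_L2 (fourier_integral (f k)) \<bullet> cnj_L2 (abs_L2 (g k)) = abs_L2 (f k) \<bullet> cnj_L2 (abs_L2 (fourier_integral (g k)))" for k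
  proof -
    have "abs_L2 (fourier_integral (f k)) \<bullet> cnj_L2 (abs_L2 (g k)) = Re (LINT x|lborel. fourier_integral (f k) x * g k x)"
      unfolding abs_cnj[OF sg(1)] by (subst inner_abs_L2) (auto intro: sf sg sq_integrable_cnj)
    also have "\<dots> = Re (LINT x|lborel. f k x * fourier_integral (g k) x)"
      using fourier_integral_multiplication[OF fm gm fi gi] by simp
    also have "\<dots> = abs_L2 (f k) \<bullet> cnj_L2 (abs_L2 (fourier_integral (g k)))"
      unfolding abs_cnj[OF sg(2)] by (subst inner_abs_L2) (auto intro: sf sg sq_integrable_cnj)
    finally show ?thesis .
  qed
  moreover have "(\<lambda>k. abs_L2 (fourier_integral (f k)) \<bullet> cnj_L2 (abs_L2 (g k))) \<longlonglongrightarrow> fourier_L2 u \<bullet> cnj_L2 v"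
    by (intro tendsto_inner fourier_L2_lim tendsto_cnj_L2 f g)
  moreover have "(\<lambda>k. abs_L2 (f k) \<bullet> cnj_L2 (abs_L2 (fourier_integral (g k)))) \<longlonglongrightarrow> u \<bullet> cnj_L2 (fourier_L2 v)"
    by (intro tendsto_inner fourier_L2_lim tendsto_cnj_L2 f g)
  ultimately show ?thesis by (simp add: LIMSEQ_unique)
qed

text \<open>Up to the constant, this is the adjoint of \<open>fourier_L2\<close>.\<close>
definition inverse_fourier_L2 :: "'a::euclidean_space L2 \<Rightarrow> 'a L2" where
  "inverse_fourier_L2 u = (1 / (2 * pi) ^ DIM('a)) *\<^sub>R cnj_L2 (fourier_L2 (cnj_L2 u))"

lemma fourier_L2_inner: "fourier_L2 u \<bullet> fourier_L2 v = (2 * pi) ^ DIM('a) * (u \<bullet> (v :: 'a::euclidean_space L2))"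
proof -
  have *: "a \<bullet> b = ((norm (a + b))\<^sup>2 - (norm a)\<^sup>2 - (norm b)\<^sup>2) / 2" for a b :: "'a L2"
    by (simp add: power2_norm_eq_inner inner_add inner_commute)
  show ?thesis
    unfolding * fourier_L2_add[symmetric] norm_fourier_L2 by (simp add: power_mult_distrib algebra_simps)
qed

text \<open>A multiple of an isometry is inverted, up to a constant, by its adjoint.\<close>
lemma inverse_fourier_L2_fourier_L2 [simp]: "inverse_fourier_L2 (fourier_L2 v) = (v :: 'a::euclidean_space L2)"
proof -
  have "u \<bullet> cnj_L2 (fourier_L2 (cnj_L2 (fourier_L2 v))) = u \<bullet> ((2 * pi) ^ DIM('a) *\<^sub>R v)" for u
    using fourier_L2_adjoint[of u "cnj_L2 (fourier_L2 v)"] fourier_L2_inner[of u v] by simp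
  then have "cnj_L2 (fourier_L2 (cnj_L2 (fourier_L2 v))) = (2 * pi) ^ DIM('a) *\<^sub>R v"
    by (rule vector_eq_ldot[THEN iffD1, OF allI])
  then show ?thesis by (simp add: inverse_fourier_L2_def)
qed

lemma fourier_L2_inverse_fourier_L2 [simp]: "fourier_L2 (inverse_fourier_L2 v) = (v :: 'a::euclidean_space L2)"
proof -
  have "cnj_L2 (fourier_L2 (inverse_fourier_L2 v)) = inverse_fourier_L2 (fourier_L2 (cnj_L2 v))"
    by (simp add: inverse_fourier_L2_def fourier_L2_scaleR cnj_L2_scaleR)
  then show ?thesis by (metis cnj_L2_cnj_L2 inverse_fourier_L2_fourier_L2)
qed

lemma fourier_L2_eq_iff: "fourier_L2 u = fourier_L2 v \<longleftrightarrow> u = v"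
  by (metis inverse_fourier_L2_fourier_L2)

lemma fourier_multiplier_iff:
  "(u, v) \<in> fourier_multiplier m \<longleftrightarrow>
     (AE \<xi> in lebesgue. fhat v \<xi> = complex_of_real (m \<xi>) * fhat u \<xi>)"
  unfolding fourier_multiplier_def has_fourier_transform_iff by auto

section \<open>Lagrange interpolation at separated points\<close>
text \<open>Greedy choice: take a point of \<open>E\<close> within \<open>d\<close> of the infimum and discard everything up to
  distance \<open>d\<close> to its right, which costs at most \<open>2 * d\<close> of the measure.\<close>
lemma separated_points:
  fixes E :: "real set"
  assumes "E \<in> sets borel" "E \<subseteq> {0..L}" "0 < d" "measure lborel E > 2 * d * real k"
  shows "\<exists>t. (\<forall>i\<le>k. t i \<in> E) \<and> (\<forall>i<k. t i + d \<le> t (Suc i))"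
  using assms
proof (induction k arbitrary: E)
  case 0
  then have "E \<noteq> {}" by auto
  then obtain x where "x \<in> E" by auto
  then show ?case by (intro exI[of _ "\<lambda>_. x"]) auto
next
  case (Suc k)
  have "0 \<le> 2 * d * real (Suc k)" using \<open>0 < d\<close> by simp
  with Suc.prems(4) have "measure lborel E > 0" by linarith
  then have ne: "E \<noteq> {}" by auto
  have bb: "bdd_below E" using Suc.prems(2) by (meson bdd_below_Icc bdd_below_mono)
  from cInf_lessD[OF ne, of "Inf E + d"] \<open>0 < d\<close> obtain t0 where t0: "t0 \<in> E" "t0 < Inf E + d" by auto
  define E' where "E' = E \<inter> {t0 + d..}"
  have E'm: "E' \<in> sets borel" using Suc.prems(1) by (simp add: E'_def)
  have sub: "E \<subseteq> E' \<union> {Inf E..Inf E + 2 * d}"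
    using t0(2) cInf_lower[OF _ bb] by (force simp: E'_def)
  have fm: "E' \<union> {Inf E..Inf E + 2 * d} \<in> fmeasurable lborel"
  proof (rule fmeasurableI2[of "{0..L} \<union> {Inf E..Inf E + 2 * d}"])
    show "{0..L} \<union> {Inf E..Inf E + 2 * d} \<in> fmeasurable lborel"
      using fmeasurable_cbox[of 0 L] fmeasurable_cbox[of "Inf E" "Inf E + 2 * d"] by (intro fmeasurable.Un) (simp_all add: cbox_interval)
  qed (use Suc.prems(2) E'm in \<open>auto simp: E'_def\<close>)
  have "measure lborel E \<le> measure lborel (E' \<union> {Inf E..Inf E + 2 * d})"
    by (rule measure_mono_fmeasurable[OF sub _ fm]) (use Suc.prems(1) in auto)
  also have "\<dots> \<le> measure lborel E' + measure lborel {Inf E..Inf E + 2 * d}"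
    by (rule measure_Un_le) (use E'm in auto)
  also have "measure lborel {Inf E..Inf E + 2 * d} = 2 * d" using \<open>0 < d\<close> by simp
  finally have m: "measure lborel E' > 2 * d * real k" using Suc.prems(4) by (simp add: algebra_simps)
  have "E' \<subseteq> {0..L}" using Suc.prems(2) by (auto simp: E'_def)
  from Suc.IH[OF E'm this \<open>0 < d\<close> m] obtain t where t: "\<And>i. i \<le> k \<Longrightarrow> t i \<in> E'" "\<And>i. i < k \<Longrightarrow> t i + d \<le> t (Suc i)" by auto
  show ?case
  proof (intro exI[of _ "case_nat t0 t"] conjI allI impI)
    fix i assume "i \<le> Suc k" then show "case_nat t0 t i \<in> E"
      using t0 t(1) by (cases i) (auto simp: E'_def)
  next
    fix i assume "i < Suc k" then show "case_nat t0 t i + d \<le> case_nat t0 t (Suc i)"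
      using t(1)[of 0] t(2) by (cases i) (auto simp: E'_def)
  qed
qed

lemma separated_diff:
  fixes t :: "nat \<Rightarrow> real"
  assumes t: "\<And>i. i < k \<Longrightarrow> t i + d \<le> t (Suc i)" and "0 < d" "i \<le> k" "j \<le> k"
  shows "d * \<bar>real i - real j\<bar> \<le> \<bar>t i - t j\<bar>"
proof -
  have "t i + d * real m \<le> t (i + m)" if "i + m \<le> k" for i m
    using that
  proof (induction m)
    case (Suc m)
    then have "t i + d * real m \<le> t (i + m)" "t (i + m) + d \<le> t (Suc (i + m))" using t[of "i + m"] by auto
    then show ?case by (simp add: algebra_simps)
  qed simp
  from this[of i "j - i"] this[of j "i - j"] show ?thesis
    using assms(2-4) by (cases "i \<le> j") (auto simp: of_nat_diff abs_if algebra_simps mult_less_0_iff)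
qed

definition lagrange_basis :: "nat \<Rightarrow> (nat \<Rightarrow> real) \<Rightarrow> nat \<Rightarrow> real \<Rightarrow> real" where
  "lagrange_basis k t j x = (\<Prod>i\<in>{..k} - {j}. (x - t i) / (t j - t i))"

text \<open>The difference of both sides is a polynomial of degree at most \<open>k\<close> with \<open>k + 1\<close> zeros.\<close>
lemma lagrange_exact:
  assumes inj: "inj_on t {..k}" and m: "m \<le> k"
  shows "(\<Sum>j\<le>k. lagrange_basis k t j x * t j ^ m) = x ^ m"
proof -
  define P where "P j = (\<Prod>i\<in>{..k} - {j}. smult (1 / (t j - t i)) [:- t i, 1:])" for j
  have P: "poly (P j) y = lagrange_basis k t j y" for j y
    unfolding P_def lagrange_basis_def poly_prod by (intro prod.cong refl) (simp add: diff_divide_distrib)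
  have dP: "degree (P j) \<le> k" if "j \<le> k" for j
  proof -
    have "degree (P j) \<le> (\<Sum>i\<in>{..k} - {j}. degree (smult (1 / (t j - t i)) [:- t i, 1:]))"
      unfolding P_def using degree_prod_sum_le[of "{..k} - {j}" "\<lambda>i. smult (1 / (t j - t i)) [:- t i, 1:]"] by (simp add: o_def)
    also have "\<dots> \<le> (\<Sum>i\<in>{..k} - {j}. 1)"
      by (intro sum_mono order_trans[OF degree_smult_le]) simp
    also have "\<dots> = k" using that by simp
    finally show ?thesis .
  qed
  define q where "q = (\<Sum>j\<le>k. smult (t j ^ m) (P j)) - monom 1 m"
  have dq: "degree q \<le> k" unfolding q_def
    by (intro degree_diff_le degree_sum_le order_trans[OF degree_smult_le] dP) (auto simp: degree_monom_eq m)
  have basis: "lagrange_basis k t j (t i) = (if i = j then 1 else 0)" if "i \<le> k" "j \<le> k" for i j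
  proof (cases "i = j")
    case True
    have "lagrange_basis k t j (t j) = 1" unfolding lagrange_basis_def
    proof (intro prod.neutral ballI)
      fix l assume l: "l \<in> {..k} - {j}"
      then have "t j \<noteq> t l" using inj that by (auto dest: inj_onD)
      then show "(t j - t l) / (t j - t l) = 1" by simp
    qed
    then show ?thesis using True by simp
  next
    case False
    then show ?thesis unfolding lagrange_basis_def using that by (auto intro!: prod_zero bexI[of _ i])
  qed
  have q0: "poly q (t i) = 0" if "i \<le> k" for i
  proof -
    have "(\<Sum>j\<le>k. t j ^ m * lagrange_basis k t j (t i)) = (\<Sum>j\<le>k. if j = i then t j ^ m else 0)"
      by (intro sum.cong refl) (use basis that in auto)
    also have "\<dots> = t i ^ m" using that by simp
    finally show ?thesis by (simp add: q_def poly_sum P poly_monom)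
  qed
  have "q = 0"
  proof (rule ccontr)
    assume "q \<noteq> 0"
    have "card (t ` {..k}) \<le> card {x. poly q x = 0}"
      using q0 by (intro card_mono poly_roots_finite[OF \<open>q \<noteq> 0\<close>]) auto
    also have "\<dots> \<le> degree q" using \<open>q \<noteq> 0\<close> by (rule card_poly_roots_bound)
    finally show False using dq by (simp add: card_image[OF inj])
  qed
  then have "poly q x = 0" by simp
  then show ?thesis by (simp add: q_def poly_sum P poly_monom mult.commute)
qed

lemma prod_index_distance:
  assumes "j \<le> k"
  shows "(\<Prod>i\<in>{..k} - {j}. \<bar>real j - real i\<bar>) = fact j * fact (k - j)"
proof -
  have split: "{..k} - {j} = {..<j} \<union> {j<..k}"
    using assms by (intro set_eqI) (simp only: Un_iff Diff_iff atMost_iff lessThan_iff greaterThanAtMost_iff singleton_iff, arith)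
  have dis: "{..<j} \<inter> {j<..k} = {}"
    by (intro equals0I) (simp only: Int_iff lessThan_iff greaterThanAtMost_iff, arith)
  have "(\<Prod>i\<in>{..k} - {j}. \<bar>real j - real i\<bar>) = (\<Prod>i<j. \<bar>real j - real i\<bar>) * (\<Prod>i\<in>{j<..k}. \<bar>real j - real i\<bar>)"
    unfolding split by (rule prod.union_disjoint[OF finite_lessThan finite_greaterThanAtMost dis])
  also have "(\<Prod>i<j. \<bar>real j - real i\<bar>) = (\<Prod>i\<in>{1..j}. real i)"
    by (rule prod.reindex_bij_witness[of _ "\<lambda>i. j - i" "\<lambda>i. j - i"]) (auto simp: of_nat_diff)
  also have "(\<Prod>i\<in>{j<..k}. \<bar>real j - real i\<bar>) = (\<Prod>i\<in>{1..k-j}. real i)"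
    by (rule prod.reindex_bij_witness[of _ "\<lambda>i. i + j" "\<lambda>i. i - j"]) (auto simp: of_nat_diff)
  finally show ?thesis by (simp add: fact_prod)
qed

text \<open>The nodes satisfy \<open>|t\<^sub>i - t\<^sub>j| \<ge> d |i - j|\<close>. Keeping the factors \<open>|i - j|\<close> produces the
  factorials; since \<open>d\<close> will be of order \<open>1 / k\<close>, they reduce the growth of the bound from that of
  \<open>k\<^sup>k\<close> to an exponential one.\<close>
lemma lagrange_basis_bound:
  fixes t :: "nat \<Rightarrow> real"
  assumes t: "\<And>i. i < k \<Longrightarrow> t i + d \<le> t (Suc i)" and d: "0 < d" and tL: "\<And>i. i \<le> k \<Longrightarrow> t i \<in> {0..L}"
    and x: "x \<in> {0..L}" and j: "j \<le> k"
  shows "\<bar>lagrange_basis k t j x\<bar> \<le> (L / d) ^ k / (fact j * fact (k - j))"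
proof -
  have "\<bar>lagrange_basis k t j x\<bar> = (\<Prod>i\<in>{..k} - {j}. \<bar>x - t i\<bar> / \<bar>t j - t i\<bar>)"
    by (simp add: lagrange_basis_def abs_prod)
  also have "\<dots> \<le> (\<Prod>i\<in>{..k} - {j}. (L / d) / \<bar>real j - real i\<bar>)"
  proof (rule prod_mono)
    fix i assume i: "i \<in> {..k} - {j}"
    then have s: "d * \<bar>real j - real i\<bar> \<le> \<bar>t j - t i\<bar>" using j by (intro separated_diff[where t=t and k=k and d=d, OF t d]) auto
    have p: "0 < d * \<bar>real j - real i\<bar>" using d i by auto
    have "\<bar>x - t i\<bar> \<le> L" using x tL[of i] i by auto
    then have "\<bar>x - t i\<bar> / \<bar>t j - t i\<bar> \<le> L / (d * \<bar>real j - real i\<bar>)"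
      using s p by (intro frac_le) auto
    then show "0 \<le> \<bar>x - t i\<bar> / \<bar>t j - t i\<bar> \<and> \<bar>x - t i\<bar> / \<bar>t j - t i\<bar> \<le> (L / d) / \<bar>real j - real i\<bar>"
      by simp
  qed
  also have "\<dots> = (L / d) ^ k / (fact j * fact (k - j))"
    unfolding prod_dividef prod_index_distance[OF j] using j by (simp add: power_divide)
  finally show ?thesis .
qed

lemma lagrange_basis_sum_bound:
  fixes t :: "nat \<Rightarrow> real"
  assumes t: "\<And>i. i < k \<Longrightarrow> t i + d \<le> t (Suc i)" and d: "0 < d" and tL: "\<And>i. i \<le> k \<Longrightarrow> t i \<in> {0..L}"
    and x: "x \<in> {0..L}"
  shows "(\<Sum>j\<le>k. \<bar>lagrange_basis k t j x\<bar>) \<le> (2 * L / d) ^ k / fact k"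
proof -
  have "(\<Sum>j\<le>k. \<bar>lagrange_basis k t j x\<bar>) \<le> (\<Sum>j\<le>k. (L / d) ^ k / fact k * real (k choose j))"
  proof (rule sum_mono)
    fix j assume "j \<in> {..k}"
    then show "\<bar>lagrange_basis k t j x\<bar> \<le> (L / d) ^ k / fact k * real (k choose j)"
      using lagrange_basis_bound[where t=t and k=k and d=d, OF t d tL x, of j] binomial_fact[of j k, where 'a=real] by simp
  qed
  also have "\<dots> = (L / d) ^ k / fact k * real (\<Sum>j\<le>k. k choose j)" by (simp only: sum_distrib_left of_nat_sum)
  also have "\<dots> = (2 * L / d) ^ k / fact k" by (simp add: choose_row_sum power_mult_distrib power_divide)
  finally show ?thesis .
qed

text \<open>Interpolation reproduces the Taylor polynomial of degree \<open>k\<close> exactly, so that only the Taylor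
  remainder is left, once directly and once amplified by the sum of the absolute values of the
  Lagrange basis.\<close>
lemma cis_interpolation_error:
  fixes t :: "nat \<Rightarrow> real"
  assumes t: "\<And>i. i < k \<Longrightarrow> t i + d \<le> t (Suc i)" and d: "0 < d" and tL: "\<And>i. i \<le> k \<Longrightarrow> t i \<in> {0..L}"
    and x: "x \<in> {0..L}" and s: "\<bar>s\<bar> \<le> S"
  shows "cmod (cis (x * s) - (\<Sum>j\<le>k. complex_of_real (lagrange_basis k t j x) * cis (t j * s)))
    \<le> (1 + (2 * L / d) ^ k / fact k) * (L * S) ^ Suc k / fact (Suc k)"
proof -
  let ?l = "\<lambda>j. lagrange_basis k t j x"
  let ?T = "\<lambda>y. \<Sum>m\<le>k. (\<i> * complex_of_real (y * s)) ^ m / fact m"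
  let ?e = "(L * S) ^ Suc k / fact (Suc k)"
  have inj: "inj_on t {..k}"
  proof (rule inj_onI)
    fix i j assume "i \<in> {..k}" "j \<in> {..k}" "t i = t j"
    with separated_diff[where t=t and k=k and d=d, OF t d, of i j] d show "i = j" by (auto simp: mult_le_0_iff)
  qed
  have err: "cmod (cis (y * s) - ?T y) \<le> ?e" if "y \<in> {0..L}" for y
  proof -
    have "cmod (cis (y * s) - ?T y) \<le> \<bar>y * s\<bar> ^ Suc k / fact (Suc k)"
      using iexp_approx1[of "y * s" k] by (simp add: cis_conv_exp)
    also have "\<dots> \<le> ?e"
      using that s by (intro divide_right_mono power_mono) (auto simp: abs_mult intro!: mult_mono)
    finally show ?thesis .
  qed
  have "(\<Sum>j\<le>k. complex_of_real (?l j) * ?T (t j)) = (\<Sum>m\<le>k. (\<i> * complex_of_real s) ^ m / fact m * complex_of_real (\<Sum>j\<le>k. ?l j * t j ^ m))"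
    unfolding sum_distrib_left of_real_sum
    by (subst sum.swap) (simp add: power_mult_distrib mult_ac)
  also have "\<dots> = ?T x"
  proof (intro sum.cong refl)
    fix m assume "m \<in> {..k}"
    then have "complex_of_real (\<Sum>j\<le>k. ?l j * t j ^ m) = complex_of_real (x ^ m)"
      using lagrange_exact[OF inj, of m x] by (simp only: atMost_iff)
    then show "(\<i> * complex_of_real s) ^ m / fact m * complex_of_real (\<Sum>j\<le>k. ?l j * t j ^ m) = (\<i> * complex_of_real (x * s)) ^ m / fact m"
      by (simp only:) (simp add: power_mult_distrib mult_ac)
  qed
  finally have exact: "(\<Sum>j\<le>k. complex_of_real (?l j) * ?T (t j)) = ?T x" .
  have split: "cis (x * s) - (\<Sum>j\<le>k. complex_of_real (?l j) * cis (t j * s)) =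
     (cis (x * s) - ?T x) - (\<Sum>j\<le>k. complex_of_real (?l j) * (cis (t j * s) - ?T (t j)))"
    by (simp only: right_diff_distrib sum_subtractf exact) simp
  have "cmod (cis (x * s) - (\<Sum>j\<le>k. complex_of_real (?l j) * cis (t j * s))) \<le> cmod (cis (x * s) - ?T x) + cmod (\<Sum>j\<le>k. complex_of_real (?l j) * (cis (t j * s) - ?T (t j)))"
    unfolding split by (rule norm_triangle_ineq4)
  also have "\<dots> \<le> ?e + (\<Sum>j\<le>k. \<bar>?l j\<bar> * ?e)"
  proof (intro add_mono err x order_trans[OF norm_sum] sum_mono)
    fix j assume "j \<in> {..k}"
    then show "cmod (complex_of_real (?l j) * (cis (t j * s) - ?T (t j))) \<le> \<bar>?l j\<bar> * ?e"
      using err[OF tL, of j] by (simp only: norm_mult norm_of_real) (intro mult_left_mono, auto)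
  qed
  also have "\<dots> = (1 + (\<Sum>j\<le>k. \<bar>?l j\<bar>)) * ?e" by (simp only: sum_distrib_right distrib_right mult_1)
  also have "\<dots> \<le> (1 + (2 * L / d) ^ k / fact k) * ?e"
    using lagrange_basis_sum_bound[where t=t and k=k and d=d, OF t d tL x] x s
    by (intro mult_right_mono add_left_mono) (auto intro!: divide_nonneg_nonneg zero_le_power mult_nonneg_nonneg)
  finally show ?thesis by simp
qed

section \<open>From intervals to cubes\<close>

text \<open>Suppose that along each coordinate line a bound on a set of measure \<open>c\<close> propagates to the
  interval \<open>{0..L}\<close>, with losses \<open>\<Lambda>\<close> and \<open>\<epsilon>\<close>. Then a bound on a subset \<open>E\<close> of the cube propagates
  to the cube. The induction adds a coordinate \<open>i\<close>: the points \<open>y\<close> of the smaller cube over which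
  the slice of \<open>E\<close> has measure at least \<open>c\<close> form a set \<open>E'\<close> that is again large, as the other
  slices contribute at most \<open>c\<close> times the volume of the smaller cube. Over \<open>E'\<close> the function is
  controlled for all values of the coordinate \<open>i\<close>, and for each fixed value the induction
  hypothesis applies to \<open>E'\<close>. Both sides of the lower bound on the measure of \<open>E\<close> are multiplied by
  \<open>L\<close>, so that it makes sense without coordinates.\<close>
lemma cube_induction:
  fixes V :: "('i \<Rightarrow> real) \<Rightarrow> complex" and L c \<Lambda> \<epsilon> :: real
  assumes "finite J" and L: "0 < L" and c: "0 < c" and \<Lambda>: "1 \<le> \<Lambda>" and \<epsilon>: "0 \<le> \<epsilon>"
    and line: "\<And>i y E M \<tau>. i \<in> J \<Longrightarrow> E \<in> sets borel \<Longrightarrow> E \<subseteq> {0..L} \<Longrightarrow> c \<le> measure lborel E \<Longrightarrow>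
       \<tau> \<in> {0..L} \<Longrightarrow> (\<And>\<sigma>. \<sigma> \<in> E \<Longrightarrow> cmod (V (y(i := \<sigma>))) \<le> M) \<Longrightarrow> cmod (V (y(i := \<tau>))) \<le> \<Lambda> * M + \<epsilon>"
    and E: "E \<in> sets (PiM J (\<lambda>_. lborel))" "E \<subseteq> PiE J (\<lambda>_. {0..L})"
    and mE: "ennreal (real (card J) * c * L ^ card J) < ennreal L * emeasure (PiM J (\<lambda>_. lborel)) E"
    and M: "\<And>y. y \<in> E \<Longrightarrow> cmod (V y) \<le> M"
    and y: "y \<in> PiE J (\<lambda>_. {0..L})"
  shows "cmod (V y) \<le> \<Lambda> ^ card J * (M + real (card J) * \<epsilon>)"
  using assms(1,6-)
proof (induction J arbitrary: V E M y rule: finite_induct)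
  case empty
  then have "E \<noteq> {}" by auto
  with empty have "y \<in> E" by auto
  with empty show ?case by auto
next
  case (insert i J)
  note line = insert.prems(1)
  interpret product_sigma_finite "\<lambda>_::'i. lborel :: real measure" by standard
  note [measurable] = insert.prems(2)
  let ?P = "PiM J (\<lambda>_. lborel :: real measure)"
  define B where "B = PiE J (\<lambda>_. {0..L})"
  have B [measurable]: "B \<in> sets ?P" unfolding B_def using insert.hyps by (intro sets_PiM_I_finite) auto
  have eB: "emeasure ?P B = ennreal (L ^ card J)"
    unfolding B_def using L insert.hyps by (subst emeasure_PiM) (auto simp: prod_constant ennreal_power)
  define sl where "sl y = {\<sigma>. y(i := \<sigma>) \<in> E}" for y
  have slE: "indicator E (y(i := \<sigma>)) = (indicator (sl y) \<sigma> :: ennreal)" for y \<sigma> by (simp add: sl_def indicator_def)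
  have sl_sub: "sl y \<subseteq> {0..L}" for y
  proof
    fix \<sigma> assume "\<sigma> \<in> sl y"
    then have "y(i := \<sigma>) \<in> PiE (insert i J) (\<lambda>_. {0..L})" using insert.prems(3) by (auto simp: sl_def)
    then have "(y(i := \<sigma>)) i \<in> {0..L}" by (rule PiE_mem) simp
    then show "\<sigma> \<in> {0..L}" by simp
  qed
  have sl_m: "sl y \<in> sets borel" if "y \<in> space ?P" for y
  proof -
    have "(\<lambda>\<sigma>. y(i := \<sigma>)) \<in> lborel \<rightarrow>\<^sub>M PiM (insert i J) (\<lambda>_. lborel)"
      using measurable_component_update[OF that insert.hyps(2)] by simp
    from measurable_sets[OF this insert.prems(2)] show ?thesis by (simp add: sl_def vimage_def)
  qed
  have sl_fin: "emeasure lborel (sl y) = ennreal (measure lborel (sl y))" if "y \<in> space ?P" for y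
  proof (rule emeasure_eq_ennreal_measure)
    have "emeasure lborel (sl y) \<le> emeasure lborel {0..L}" by (rule emeasure_mono[OF sl_sub]) simp
    also have "\<dots> < top" using L by simp
    finally show "emeasure lborel (sl y) \<noteq> top" by simp
  qed
  define h where "h y = (\<integral>\<^sup>+\<sigma>. indicator E (y(i := \<sigma>)) \<partial>lborel)" for y
  have h_eq: "h y = emeasure lborel (sl y)" if "y \<in> space ?P" for y
    unfolding h_def slE using sl_m[OF that] by simp
  have hm [measurable]: "h \<in> borel_measurable ?P" unfolding h_def by measurable
  have hL: "h y \<le> ennreal L * indicator B y" if "y \<in> space ?P" for y
  proof (cases "y \<in> B")
    case True
    have "emeasure lborel (sl y) \<le> emeasure lborel {0..L}" by (rule emeasure_mono[OF sl_sub]) simp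
    then show ?thesis using True L by (simp add: h_eq[OF that])
  next
    case False
    have "sl y = {}"
    proof (rule ccontr)
      assume "sl y \<noteq> {}"
      then obtain \<sigma> where "y(i := \<sigma>) \<in> PiE (insert i J) (\<lambda>_. {0..L})" using insert.prems(3) by (auto simp: sl_def)
      then have "y j \<in> {0..L}" if "j \<in> J" for j
        using PiE_mem[of "y(i := \<sigma>)" "insert i J" "\<lambda>_. {0..L}" j] that insert.hyps(2) by (auto split: if_splits)
      moreover have "y \<in> extensional J" using that by (simp add: space_PiM PiE_def)
      ultimately have "y \<in> B" by (auto simp: B_def PiE_def)
      with False show False by simp
    qed
    then show ?thesis by (simp add: h_eq[OF that])
  qed
  define E' where "E' = {y \<in> space ?P. ennreal c \<le> h y}"
  have E'm: "E' \<in> sets ?P" unfolding E'_def by measurable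
  have E'B: "E' \<subseteq> B"
  proof
    fix y assume "y \<in> E'"
    then have y: "y \<in> space ?P" "ennreal c \<le> h y" by (auto simp: E'_def)
    show "y \<in> B"
    proof (rule ccontr)
      assume "y \<notin> B" then have "ennreal c \<le> 0" using hL[OF y(1)] y(2) by simp
      then show False using c by simp
    qed
  qed
  have "emeasure (PiM (insert i J) (\<lambda>_. lborel)) E = (\<integral>\<^sup>+y. h y \<partial>?P)"
    unfolding h_def using insert.hyps
    by (subst product_nn_integral_insert[symmetric]) (auto simp: nn_integral_indicator)
  also have "\<dots> \<le> (\<integral>\<^sup>+y. ennreal L * indicator E' y + ennreal c * indicator B y \<partial>?P)"
  proof (rule nn_integral_mono)
    fix y assume y: "y \<in> space ?P"
    show "h y \<le> ennreal L * indicator E' y + ennreal c * indicator B y"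
    proof (cases "y \<in> E'")
      case True
      then have "y \<in> B" using E'B by auto
      then have "h y \<le> ennreal L" using hL[OF y] by simp
      then show ?thesis using True by (simp add: add_increasing2)
    next
      case False
      then have "h y \<le> ennreal c" using y by (simp add: E'_def)
      then show ?thesis using hL[OF y] False by (cases "y \<in> B") auto
    qed
  qed
  also have "\<dots> = ennreal L * emeasure ?P E' + ennreal c * ennreal (L ^ card J)"
    using E'm by (subst nn_integral_add) (auto simp: nn_integral_cmult eB)
  finally have le: "emeasure (PiM (insert i J) (\<lambda>_. lborel)) E \<le> ennreal L * emeasure ?P E' + ennreal (c * L ^ card J)"
    using c L by (simp add: ennreal_mult)
  have mE': "ennreal (real (card J) * c * L ^ card J) < ennreal L * emeasure ?P E'"
  proof (rule ccontr)
    assume "\<not> ?thesis"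
    then have "ennreal L * emeasure ?P E' \<le> ennreal (real (card J) * c * L ^ card J)" by simp
    then have "emeasure (PiM (insert i J) (\<lambda>_. lborel)) E \<le> ennreal (real (card J) * c * L ^ card J) + ennreal (c * L ^ card J)"
      using le by (meson add_right_mono order_trans)
    also have "\<dots> = ennreal (real (card (insert i J)) * c * L ^ card J)"
      using c L insert.hyps by (subst ennreal_plus[symmetric]) (auto simp: algebra_simps)
    finally have "ennreal L * emeasure (PiM (insert i J) (\<lambda>_. lborel)) E \<le> ennreal L * ennreal (real (card (insert i J)) * c * L ^ card J)"
      by (rule mult_left_mono) simp
    also have "\<dots> = ennreal (real (card (insert i J)) * c * L ^ card (insert i J))"
      using c L insert.hyps by (subst ennreal_mult[symmetric]) (auto simp: algebra_simps)
    finally show False using insert.prems(4) by simp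
  qed
  have yi: "y i \<in> {0..L}" using insert.prems(6) by (rule PiE_mem) simp
  define V' where "V' z = V (z(i := y i))" for z
  have "cmod (V' (restrict y J)) \<le> \<Lambda> ^ card J * ((\<Lambda> * M + \<epsilon>) + real (card J) * \<epsilon>)"
  proof (rule insert.IH[OF _ E'm E'B[unfolded B_def] mE'])
    fix i' z A N \<tau>
    assume *: "i' \<in> J" "A \<in> sets borel" "A \<subseteq> {0..L}" "c \<le> measure lborel A" "\<tau> \<in> {0..L}"
      "\<And>\<sigma>. \<sigma> \<in> A \<Longrightarrow> cmod (V' (z(i' := \<sigma>))) \<le> N"
    have ne: "i' \<noteq> i" using *(1) insert.hyps(2) by auto
    have sw: "z(i' := \<sigma>, i := y i) = z(i := y i, i' := \<sigma>)" for \<sigma> using ne by (auto simp: fun_upd_twist)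
    have N: "cmod (V (z(i := y i, i' := \<sigma>))) \<le> N" if "\<sigma> \<in> A" for \<sigma>
      using *(6)[OF that] unfolding V'_def sw .
    show "cmod (V' (z(i' := \<tau>))) \<le> \<Lambda> * N + \<epsilon>"
      unfolding V'_def sw by (rule line[OF _ *(2-5) N]) (use *(1) in auto)
  next
    fix z assume "z \<in> E'"
    then have z: "z \<in> space ?P" "ennreal c \<le> h z" by (auto simp: E'_def)
    have "c \<le> measure lborel (sl z)" using z c by (simp add: h_eq sl_fin)
    moreover have "cmod (V (z(i := \<sigma>))) \<le> M" if "\<sigma> \<in> sl z" for \<sigma>
      using that by (intro insert.prems(5)) (simp only: sl_def mem_Collect_eq)
    ultimately show "cmod (V' z) \<le> \<Lambda> * M + \<epsilon>"
      unfolding V'_def by (rule line[OF insertI1 sl_m[OF z(1)] sl_sub _ yi])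
  next
    show "restrict y J \<in> PiE J (\<lambda>_. {0..L})"
      using insert.prems(6) by (auto simp: PiE_def)
  qed
  also have "V' (restrict y J) = V y"
  proof -
    have "(restrict y J)(i := y i) = y"
      using insert.prems(6) by (auto simp: fun_eq_iff restrict_def PiE_def extensional_def)
    then show ?thesis by (simp add: V'_def)
  qed
  also have "\<Lambda> ^ card J * ((\<Lambda> * M + \<epsilon>) + real (card J) * \<epsilon>) \<le> \<Lambda> ^ card (insert i J) * (M + real (card (insert i J)) * \<epsilon>)"
  proof -
    have "(\<Lambda> * M + \<epsilon>) + real (card J) * \<epsilon> = \<Lambda> * M + (1 + real (card J)) * \<epsilon>" by (simp add: algebra_simps)
    also have "\<dots> \<le> \<Lambda> * M + \<Lambda> * ((1 + real (card J)) * \<epsilon>)"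
      using \<Lambda> \<epsilon> mult_right_mono[of 1 \<Lambda> "(1 + real (card J)) * \<epsilon>"] by simp
    finally have "(\<Lambda> * M + \<epsilon>) + real (card J) * \<epsilon> \<le> \<Lambda> * (M + (1 + real (card J)) * \<epsilon>)" by (simp add: algebra_simps)
    from mult_left_mono[OF this, of "\<Lambda> ^ card J"] \<Lambda> insert.hyps show ?thesis by (simp add: mult_ac)
  qed
  finally show ?case .
qed

section \<open>Band-limited functions on cubes\<close>

text \<open>The inverse Fourier integral, without normalization; the name anticipates that \<open>a\<close> will vanish
  outside a ball.\<close>
definition band_limited :: "('a::euclidean_space \<Rightarrow> complex) \<Rightarrow> 'a \<Rightarrow> complex" where
  "band_limited a x = (LINT \<xi>|lborel. cis (x \<bullet> \<xi>) * a \<xi>)"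

text \<open>The interpolation error of a character is uniform over the frequencies of size at most \<open>S\<close>, hence
  it can be integrated against \<open>a\<close>.\<close>
lemma band_limited_line:
  fixes a :: "'a::euclidean_space \<Rightarrow> complex" and t :: "nat \<Rightarrow> real"
  assumes [measurable]: "a \<in> borel_measurable borel" and a: "integrable lborel a"
    and supp: "\<And>\<xi>. norm \<xi> > S \<Longrightarrow> a \<xi> = 0" and b: "b \<in> Basis"
    and t: "\<And>i. i < k \<Longrightarrow> t i + d \<le> t (Suc i)" and d: "0 < d" and tL: "\<And>i. i \<le> k \<Longrightarrow> t i \<in> {0..L}"
    and \<tau>: "\<tau> \<in> {0..L}" and M: "\<And>i. i \<le> k \<Longrightarrow> cmod (band_limited a (z + t i *\<^sub>R b)) \<le> M"
  shows "cmod (band_limited a (z + \<tau> *\<^sub>R b)) \<le> (1 + (2 * L / d) ^ k / fact k) * M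
     + (1 + (2 * L / d) ^ k / fact k) * (L * S) ^ Suc k / fact (Suc k) * (LINT \<xi>|lborel. cmod (a \<xi>))"
proof -
  let ?l = "\<lambda>j. lagrange_basis k t j \<tau>" and ?v = "band_limited a"
  let ?e = "(1 + (2 * L / d) ^ k / fact k) * (L * S) ^ Suc k / fact (Suc k)"
  have M0: "0 \<le> M" using M[of 0] norm_ge_zero order_trans by blast
  have L0: "0 \<le> L" using \<tau> by simp
  have i: "integrable lborel (\<lambda>\<xi>. cis (x \<bullet> \<xi>) * a \<xi>)" for x
    by (intro integrable_cis_mult a) measurable
  let ?g = "\<lambda>\<xi>. cis (\<tau> * (b \<bullet> \<xi>)) - (\<Sum>j\<le>k. complex_of_real (?l j) * cis (t j * (b \<bullet> \<xi>)))"
  have pt: "cis ((z + \<tau> *\<^sub>R b) \<bullet> \<xi>) * a \<xi> - (\<Sum>j\<le>k. complex_of_real (?l j) * (cis ((z + t j *\<^sub>R b) \<bullet> \<xi>) * a \<xi>)) = ?g \<xi> * (cis (z \<bullet> \<xi>) * a \<xi>)" for \<xi>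
    by (simp add: inner_add_left cis_mult[symmetric] left_diff_distrib right_diff_distrib sum_distrib_right sum_distrib_left mult_ac)
  have "?v (z + \<tau> *\<^sub>R b) - (\<Sum>j\<le>k. complex_of_real (?l j) * ?v (z + t j *\<^sub>R b))
    = (LINT \<xi>|lborel. cis ((z + \<tau> *\<^sub>R b) \<bullet> \<xi>) * a \<xi> - (\<Sum>j\<le>k. complex_of_real (?l j) * (cis ((z + t j *\<^sub>R b) \<bullet> \<xi>) * a \<xi>)))"
    unfolding band_limited_def
    by (subst Bochner_Integration.integral_diff) (auto intro!: i Bochner_Integration.integrable_sum integrable_mult_right simp: Bochner_Integration.integral_sum i)
  also have "\<dots> = (LINT \<xi>|lborel. ?g \<xi> * (cis (z \<bullet> \<xi>) * a \<xi>))" by (simp only: pt)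
  also have "cmod \<dots> \<le> (LINT \<xi>|lborel. cmod (?g \<xi> * (cis (z \<bullet> \<xi>) * a \<xi>)))" by (rule integral_norm_bound)
  also have "\<dots> \<le> (LINT \<xi>|lborel. ?e * cmod (a \<xi>))"
  proof (rule integral_mono)
    have "integrable lborel (\<lambda>\<xi>. cis ((z + \<tau> *\<^sub>R b) \<bullet> \<xi>) * a \<xi> - (\<Sum>j\<le>k. complex_of_real (?l j) * (cis ((z + t j *\<^sub>R b) \<bullet> \<xi>) * a \<xi>)))"
      by (intro Bochner_Integration.integrable_diff i Bochner_Integration.integrable_sum integrable_mult_right)
    then show "integrable lborel (\<lambda>\<xi>. cmod (?g \<xi> * (cis (z \<bullet> \<xi>) * a \<xi>)))"
      unfolding pt by (rule integrable_norm)
    show "integrable lborel (\<lambda>\<xi>. ?e * cmod (a \<xi>))" using a by simp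
    fix \<xi> :: 'a
    show "cmod (?g \<xi> * (cis (z \<bullet> \<xi>) * a \<xi>)) \<le> ?e * cmod (a \<xi>)"
    proof (cases "norm \<xi> > S")
      case True then show ?thesis by (simp add: supp)
    next
      case False
      then have "\<bar>b \<bullet> \<xi>\<bar> \<le> S" using Basis_le_norm[OF b, of \<xi>] by (simp add: inner_commute)
      from cis_interpolation_error[where t=t and k=k and d=d, OF t d tL \<tau> this]
      have "cmod (?g \<xi>) \<le> ?e" .
      then show ?thesis by (simp only: norm_mult norm_cis mult_1_left) (rule mult_right_mono, auto)
    qed
  qed
  finally have 1: "cmod (?v (z + \<tau> *\<^sub>R b) - (\<Sum>j\<le>k. complex_of_real (?l j) * ?v (z + t j *\<^sub>R b))) \<le> ?e * (LINT \<xi>|lborel. cmod (a \<xi>))"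
    by simp
  have "cmod (\<Sum>j\<le>k. complex_of_real (?l j) * ?v (z + t j *\<^sub>R b)) \<le> (\<Sum>j\<le>k. \<bar>?l j\<bar> * M)"
    by (rule order_trans[OF norm_sum sum_mono]) (auto simp: norm_mult intro!: mult_left_mono M)
  also have "\<dots> = (\<Sum>j\<le>k. \<bar>?l j\<bar>) * M" by (simp only: sum_distrib_right)
  also have "\<dots> \<le> (1 + (2 * L / d) ^ k / fact k) * M"
    using lagrange_basis_sum_bound[where t=t and k=k and d=d, OF t d tL \<tau>] by (intro mult_right_mono M0) auto
  finally have 2: "cmod (\<Sum>j\<le>k. complex_of_real (?l j) * ?v (z + t j *\<^sub>R b)) \<le> (1 + (2 * L / d) ^ k / fact k) * M" .
  have "cmod (?v (z + \<tau> *\<^sub>R b)) \<le> cmod (\<Sum>j\<le>k. complex_of_real (?l j) * ?v (z + t j *\<^sub>R b)) + cmod (?v (z + \<tau> *\<^sub>R b) - (\<Sum>j\<le>k. complex_of_real (?l j) * ?v (z + t j *\<^sub>R b)))"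
    by (rule norm_triangle_sub)
  with 1 2 show ?thesis by linarith
qed

lemma band_limited_cube_bound:
  fixes a :: "'a::euclidean_space \<Rightarrow> complex" and q :: 'a
  assumes [measurable]: "a \<in> borel_measurable borel" and a: "integrable lborel a"
    and supp: "\<And>\<xi>. norm \<xi> > S \<Longrightarrow> a \<xi> = 0" and S: "0 \<le> S" and L: "0 < L" and c: "0 < c"
    and E [measurable]: "E \<in> sets borel" and EQ: "E \<subseteq> cbox q (q + L *\<^sub>R One)"
    and mE: "real DIM('a) * c * L ^ DIM('a) < L * measure lborel E"
    and M: "\<And>x. x \<in> E \<Longrightarrow> cmod (band_limited a x) \<le> M"
    and x: "x \<in> cbox q (q + L *\<^sub>R One)"
    and d: "d = c / (2 * real (Suc k))" and \<Lambda>: "\<Lambda> = 1 + (2 * L / d) ^ k / fact k"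
    and \<epsilon>: "\<epsilon> = \<Lambda> * (L * S) ^ Suc k / fact (Suc k) * (LINT \<xi>|lborel. cmod (a \<xi>))"
  shows "cmod (band_limited a x) \<le> \<Lambda> ^ DIM('a) * (M + real DIM('a) * \<epsilon>)"
proof -
  define \<phi> :: "('a \<Rightarrow> real) \<Rightarrow> 'a" where "\<phi> y = q + (\<Sum>b\<in>Basis. y b *\<^sub>R b)" for y
  let ?P = "PiM (Basis :: 'a set) (\<lambda>_. lborel :: real measure)"
  have \<phi>m [measurable]: "\<phi> \<in> ?P \<rightarrow>\<^sub>M borel" unfolding \<phi>_def by measurable
  have \<phi>b: "(\<phi> y - q) \<bullet> b = y b" if "b \<in> Basis" for y b
    using that by (simp add: \<phi>_def inner_sum_left inner_Basis if_distrib cong: if_cong)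
  have \<phi>upd: "\<phi> (y(b := s)) = \<phi> (y(b := 0)) + s *\<^sub>R b" if "b \<in> Basis" for y b s
  proof -
    have "(\<Sum>i\<in>Basis. (y(b := s)) i *\<^sub>R i) = (\<Sum>i\<in>Basis. (y(b := 0)) i *\<^sub>R i + (if i = b then s *\<^sub>R b else 0))"
      by (intro sum.cong refl) auto
    then show ?thesis using that by (simp add: \<phi>_def sum.distrib)
  qed
  have box: "\<phi> y \<in> cbox q (q + L *\<^sub>R One) \<longleftrightarrow> (\<forall>b\<in>Basis. y b \<in> {0..L})" for y
  proof -
    have "\<phi> y \<bullet> b = q \<bullet> b + y b" if "b \<in> Basis" for b using \<phi>b[OF that, of y] by (simp add: inner_diff_left)
    then show ?thesis by (auto simp: mem_box inner_add_left)
  qed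
  define E' where "E' = \<phi> -` E \<inter> space ?P"
  have E'm: "E' \<in> sets ?P" unfolding E'_def by (rule measurable_sets[OF \<phi>m E])
  have E'sub: "E' \<subseteq> PiE Basis (\<lambda>_. {0..L})"
  proof
    fix y assume "y \<in> E'"
    then have "\<phi> y \<in> cbox q (q + L *\<^sub>R One)" "y \<in> extensional Basis" using EQ by (auto simp: E'_def space_PiM PiE_def)
    then show "y \<in> PiE Basis (\<lambda>_. {0..L})" unfolding box by (auto simp: PiE_def)
  qed
  have "distr ?P borel \<phi> = lborel"
  proof -
    have "distr ?P borel \<phi> = distr (distr ?P borel (\<lambda>y. \<Sum>b\<in>Basis. y b *\<^sub>R b)) borel ((+) q)"
      by (subst distr_distr) (auto simp: \<phi>_def[abs_def] o_def)
    then show ?thesis by (simp add: lborel_eq[symmetric] lborel_distr_plus)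
  qed
  then have "emeasure lborel E = emeasure (distr ?P borel \<phi>) E" by simp
  also have "\<dots> = emeasure ?P E'" unfolding E'_def by (rule emeasure_distr) measurable
  finally have eE: "emeasure ?P E' = emeasure lborel E" by simp
  have "emeasure lborel E \<le> emeasure lborel (cbox q (q + L *\<^sub>R One))" by (rule emeasure_mono[OF EQ]) simp
  also have "\<dots> < top" using emeasure_lborel_cbox_finite[of q "q + L *\<^sub>R One"] by simp
  finally have eE2: "emeasure lborel E = ennreal (measure lborel E)" by (intro emeasure_eq_ennreal_measure) auto
  have \<Lambda>1: "1 \<le> \<Lambda>" unfolding \<Lambda> d using L c by auto
  have \<epsilon>0: "0 \<le> \<epsilon>" unfolding \<epsilon> using L S \<Lambda>1 by auto
  have d0: "0 < d" using c by (simp add: d)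
  define y where "y b = (if b \<in> Basis then (x - q) \<bullet> b else undefined)" for b
  have "\<phi> y = q + (\<Sum>b\<in>Basis. ((x - q) \<bullet> b) *\<^sub>R b)" unfolding \<phi>_def y_def by simp
  then have \<phi>y: "\<phi> y = x" by (simp only: euclidean_representation) simp
  have "cmod (band_limited a (\<phi> y)) \<le> \<Lambda> ^ card (Basis :: 'a set) * (M + real (card (Basis :: 'a set)) * \<epsilon>)"
  proof (rule cube_induction[OF finite_Basis L c \<Lambda>1 \<epsilon>0 _ E'm E'sub])
    have "0 \<le> real DIM('a) * c * L ^ DIM('a)" using L c by simp
    then have "0 < L * measure lborel E" using mE by linarith
    then have "0 < measure lborel E" using L by (simp add: zero_less_mult_iff)
    then show "ennreal (real (card (Basis :: 'a set)) * c * L ^ card (Basis :: 'a set)) < ennreal L * emeasure ?P E'"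
      unfolding eE eE2 using mE L c by (subst ennreal_mult[symmetric]) (auto intro!: ennreal_lessI mult_pos_pos elim: le_less_trans[rotated])
    show "y \<in> PiE Basis (\<lambda>_. {0..L})"
      using x box[of y] unfolding \<phi>y by (auto simp: PiE_def extensional_def y_def)
    show "cmod (band_limited a (\<phi> z)) \<le> M" if "z \<in> E'" for z using that M by (auto simp: E'_def)
    fix i :: 'a and z :: "'a \<Rightarrow> real" and A N \<tau>
    assume *: "i \<in> Basis" "A \<in> sets borel" "A \<subseteq> {0..L}" "c \<le> measure lborel A" "\<tau> \<in> {0..L}"
      "\<And>\<sigma>. \<sigma> \<in> A \<Longrightarrow> cmod (band_limited a (\<phi> (z(i := \<sigma>)))) \<le> N"
    have "2 * d * real k < c" using c by (simp add: d field_simps)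
    then have "2 * d * real k < measure lborel A" using *(4) by linarith
    from separated_points[OF *(2,3) d0 this] obtain t where
      t: "\<And>i. i \<le> k \<Longrightarrow> t i \<in> A" "\<And>i. i < k \<Longrightarrow> t i + d \<le> t (Suc i)" by auto
    have tL: "t i \<in> {0..L}" if "i \<le> k" for i using t(1)[OF that] *(3) by auto
    have N: "cmod (band_limited a (\<phi> (z(i := 0)) + t j *\<^sub>R i)) \<le> N" if "j \<le> k" for j
      using *(6)[OF t(1)[OF that]] by (simp only: \<phi>upd[OF *(1), of z "t j"])
    show "cmod (band_limited a (\<phi> (z(i := \<tau>)))) \<le> \<Lambda> * N + \<epsilon>"
      unfolding \<phi>upd[OF *(1), of z \<tau>] \<epsilon> \<Lambda>
      by (rule band_limited_line[where t=t and k=k and d=d, OF assms(1) a supp *(1) t(2) d0 tL *(5) N])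
  qed
  then show ?thesis by (simp add: \<phi>y)
qed

text \<open>From \<open>(k + 1)\<^sup>k \<le> k! exp (k + 1)\<close> the amplification of \<open>k + 1\<close> nodes at distance of order
  \<open>1 / k\<close> grows at most exponentially, and so do its powers; the Taylor remainder decays
  like \<open>1 / k!\<close>.\<close>
lemma interpolation_constants_vanish:
  fixes c L S :: real
  assumes c: "0 < c" and L: "0 < L" and S: "0 \<le> S"
  shows "(\<lambda>k. (1 + (2 * L / (c / (2 * real (Suc k)))) ^ k / fact k) ^ m * ((L * S) ^ Suc k / fact (Suc k))) \<longlonglongrightarrow> 0"
proof -
  define D where "D = 1 + 4 * L / c"
  have D1: "1 \<le> D" using c L by (simp add: D_def)
  define e1 where "e1 = exp (1::real)"
  have e1: "1 \<le> e1" by (simp add: e1_def)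
  have bound: "1 + (2 * L / (c / (2 * real (Suc k)))) ^ k / fact k \<le> (2 * e1 * D) ^ Suc k" for k
  proof -
    have "real (Suc k) ^ k / fact k \<le> exp (real (Suc k))"
    proof -
      have "(\<Sum>n\<in>{k}. inverse (fact n) * real (Suc k) ^ n) \<le> (\<Sum>n. inverse (fact n) * real (Suc k) ^ n)"
        by (rule sum_le_suminf[OF summable_exp]) auto
      then show ?thesis by (simp add: exp_def divide_inverse mult.commute)
    qed
    also have "exp (real (Suc k)) = e1 ^ Suc k" unfolding e1_def using exp_of_nat_mult[of "Suc k" "1::real"] by simp
    finally have f: "real (Suc k) ^ k / fact k \<le> e1 ^ Suc k" .
    have "(2 * L / (c / (2 * real (Suc k)))) ^ k / fact k = (4 * L / c) ^ k * (real (Suc k) ^ k / fact k)"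
    proof -
      have "2 * L / (c / (2 * real (Suc k))) = (4 * L / c) * real (Suc k)" by simp
      then show ?thesis by (simp only: power_mult_distrib times_divide_eq_right)
    qed
    also have "\<dots> \<le> D ^ Suc k * e1 ^ Suc k"
    proof (rule mult_mono[OF _ f])
      have "4 * L / c \<le> D" by (simp add: D_def)
      then have "(4 * L / c) ^ k \<le> D ^ k" using c L by (intro power_mono) auto
      also have "\<dots> \<le> D ^ Suc k" using D1 by (intro power_increasing) auto
      finally show "(4 * L / c) ^ k \<le> D ^ Suc k" .
    qed (use D1 in auto)
    finally have "1 + (2 * L / (c / (2 * real (Suc k)))) ^ k / fact k \<le> 1 + (e1 * D) ^ Suc k"
      by (simp only: power_mult_distrib mult.commute)
    also have "\<dots> \<le> 2 * (e1 * D) ^ Suc k"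
    proof -
      have "1 * 1 \<le> e1 * D" using e1 D1 by (intro mult_mono) auto
      then have "1 \<le> (e1 * D) ^ Suc k" by (intro one_le_power) simp
      then show ?thesis by (simp only: mult_2 add_le_cancel_right)
    qed
    also have "\<dots> \<le> 2 ^ Suc k * (e1 * D) ^ Suc k"
      using e1 D1 by (intro mult_right_mono) (auto simp: self_le_power)
    also have "\<dots> = (2 * e1 * D) ^ Suc k" by (simp only: power_mult_distrib mult.assoc)
    finally show ?thesis .
  qed
  define X where "X = (2 * e1 * D) ^ m * (L * S)"
  show ?thesis
  proof (rule tendsto_sandwich[OF _ _ tendsto_const])
    show "\<forall>\<^sub>F k in sequentially. 0 \<le> (1 + (2 * L / (c / (2 * real (Suc k)))) ^ k / fact k) ^ m * ((L * S) ^ Suc k / fact (Suc k))"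
      using c L S by (intro always_eventually allI mult_nonneg_nonneg zero_le_power divide_nonneg_nonneg add_nonneg_nonneg) auto
    show "\<forall>\<^sub>F k in sequentially. (1 + (2 * L / (c / (2 * real (Suc k)))) ^ k / fact k) ^ m * ((L * S) ^ Suc k / fact (Suc k)) \<le> X ^ Suc k / fact (Suc k)"
    proof (intro always_eventually allI)
      fix k
      have "(1 + (2 * L / (c / (2 * real (Suc k)))) ^ k / fact k) ^ m \<le> ((2 * e1 * D) ^ Suc k) ^ m"
        using c L by (intro power_mono bound add_nonneg_nonneg divide_nonneg_nonneg zero_le_power) auto
      then have "(1 + (2 * L / (c / (2 * real (Suc k)))) ^ k / fact k) ^ m * ((L * S) ^ Suc k / fact (Suc k)) \<le> ((2 * e1 * D) ^ Suc k) ^ m * ((L * S) ^ Suc k / fact (Suc k))"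
        using L S by (intro mult_right_mono divide_nonneg_nonneg zero_le_power) auto
      also have "((2 * e1 * D) ^ Suc k) ^ m = ((2 * e1 * D) ^ m) ^ Suc k" by (simp only: power_mult[symmetric] mult.commute)
      also have "((2 * e1 * D) ^ m) ^ Suc k * ((L * S) ^ Suc k / fact (Suc k)) = X ^ Suc k / fact (Suc k)"
        by (simp only: X_def power_mult_distrib times_divide_eq_right)
      finally show "(1 + (2 * L / (c / (2 * real (Suc k)))) ^ k / fact k) ^ m * ((L * S) ^ Suc k / fact (Suc k)) \<le> X ^ Suc k / fact (Suc k)" .
    qed
    have "(\<lambda>n. X ^ n / fact n) \<longlonglongrightarrow> 0"
      using summable_LIMSEQ_zero[OF summable_exp[of X]] by (simp add: divide_inverse mult.commute)
    then show "(\<lambda>k. X ^ Suc k / fact (Suc k)) \<longlonglongrightarrow> 0" by (rule LIMSEQ_Suc)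
  qed
qed

text \<open>A Remez inequality with a remainder: the bound on \<open>E\<close> extends to the cube with a constant that
  depends on the density \<open>\<gamma>\<close>, up to an arbitrarily small multiple of the trivial bound.\<close>
lemma band_limited_remez:
  assumes \<gamma>: "0 < \<gamma>" and L: "0 < L" and S: "0 \<le> S" and \<eta>: "0 < \<eta>"
  obtains C where "0 \<le> C" "\<And>(a :: 'a::euclidean_space \<Rightarrow> complex) q E M x.
    \<lbrakk>a \<in> borel_measurable borel; integrable lborel a; \<And>\<xi>. norm \<xi> > S \<Longrightarrow> a \<xi> = 0; E \<in> sets borel;
     E \<subseteq> cbox q (q + L *\<^sub>R One); \<gamma> * L ^ DIM('a) \<le> measure lborel E; \<And>x. x \<in> E \<Longrightarrow> cmod (band_limited a x) \<le> M;
     x \<in> cbox q (q + L *\<^sub>R One)\<rbrakk> \<Longrightarrow> cmod (band_limited a x) \<le> C * M + \<eta> * (LINT \<xi>|lborel. cmod (a \<xi>))"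
proof -
  let ?n = "DIM('a)"
  \<comment> \<open>With this slice measure, at most half the required measure of \<open>E\<close> is lost in \<open>cube_induction\<close>.\<close>
  define c where "c = \<gamma> * L / (2 * real ?n)"
  have c: "0 < c" using \<gamma> L by (simp add: c_def)
  define \<Lambda> where "\<Lambda> k = 1 + (2 * L / (c / (2 * real (Suc k)))) ^ k / fact k" for k
  have "(\<lambda>k. \<Lambda> k ^ Suc ?n * ((L * S) ^ Suc k / fact (Suc k)) * real ?n) \<longlonglongrightarrow> 0 * real ?n"
    unfolding \<Lambda>_def by (intro tendsto_mult tendsto_const interpolation_constants_vanish c L S)
  then have "\<forall>\<^sub>F k in sequentially. \<Lambda> k ^ Suc ?n * ((L * S) ^ Suc k / fact (Suc k)) * real ?n < \<eta>"
    using \<eta> by (intro order_tendstoD(2)) auto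
  then obtain k where k: "\<Lambda> k ^ Suc ?n * ((L * S) ^ Suc k / fact (Suc k)) * real ?n < \<eta>"
    by (auto simp: eventually_sequentially)
  have \<Lambda>1: "1 \<le> \<Lambda> k" unfolding \<Lambda>_def using L c by auto
  show ?thesis
  proof (rule that[of "\<Lambda> k ^ ?n"])
    show "0 \<le> \<Lambda> k ^ ?n" using \<Lambda>1 by simp
    fix a :: "'a \<Rightarrow> complex" and q E M x
    assume *: "a \<in> borel_measurable borel" "integrable lborel a" "\<And>\<xi>. norm \<xi> > S \<Longrightarrow> a \<xi> = 0" "E \<in> sets borel"
     "E \<subseteq> cbox q (q + L *\<^sub>R One)" "\<gamma> * L ^ DIM('a) \<le> measure lborel E" "\<And>x. x \<in> E \<Longrightarrow> cmod (band_limited a x) \<le> M"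
     "x \<in> cbox q (q + L *\<^sub>R One)"
    let ?A = "LINT \<xi>|lborel. cmod (a \<xi>)"
    have "real ?n * c * L ^ ?n = L * (\<gamma> * L ^ ?n) / 2" by (simp add: c_def)
    also have "\<dots> < L * (\<gamma> * L ^ ?n)" using \<gamma> L by simp
    also have "\<dots> \<le> L * measure lborel E" using L *(6) by (intro mult_left_mono) auto
    finally have mE: "real ?n * c * L ^ ?n < L * measure lborel E" .
    have "cmod (band_limited a x) \<le> \<Lambda> k ^ ?n * (M + real ?n * (\<Lambda> k * (L * S) ^ Suc k / fact (Suc k) * ?A))"
      by (rule band_limited_cube_bound[where k=k and S=S and L=L and c=c and E=E and q=q, OF *(1,2,3) S L c *(4,5) mE *(7,8) refl _ refl])
         (auto simp: \<Lambda>_def)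
    also have "\<dots> = \<Lambda> k ^ ?n * M + (\<Lambda> k ^ Suc ?n * ((L * S) ^ Suc k / fact (Suc k)) * real ?n) * ?A"
      by (simp add: algebra_simps)
    also have "\<dots> \<le> \<Lambda> k ^ ?n * M + \<eta> * ?A"
      using k by (intro add_left_mono mult_right_mono) auto
    finally show "cmod (band_limited a x) \<le> \<Lambda> k ^ ?n * M + \<eta> * ?A" .
  qed
qed

section \<open>Local mean-square estimates\<close>
lemma cnj_abs_L2:
  assumes "sq_integrable h"
  shows "cnj_L2 (abs_L2 h) = abs_L2 (\<lambda>x. cnj (h x))"
  by (rule L2_eqI, use rep_cnj_L2[of "abs_L2 h"] rep_abs_L2[OF assms] rep_abs_L2[OF sq_integrable_cnj[OF assms]] in eventually_elim) simp

lemma band_limited_eq_fourier_integral: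
  assumes [measurable]: "f \<in> borel_measurable borel"
  shows "band_limited f x = cnj (fourier_integral (\<lambda>\<xi>. cnj (f \<xi>)) x)"
proof -
  have "cnj (cnj (band_limited f x)) = cnj (LINT \<xi>|lborel. cnj (cis (x \<bullet> \<xi>) * f \<xi>))"
    unfolding band_limited_def by (simp only: Bochner_Integration.integral_cnj)
  also have "(LINT \<xi>|lborel. cnj (cis (x \<bullet> \<xi>) * f \<xi>)) = fourier_integral (\<lambda>\<xi>. cnj (f \<xi>)) x"
    by (simp add: fourier_integral_lborel cis_cnj inner_commute)
  finally show ?thesis by simp
qed

lemma band_limited_measurable [measurable]:
  assumes [measurable]: "f \<in> borel_measurable borel"
  shows "band_limited f \<in> borel_measurable borel"
proof -
  have "band_limited f = (\<lambda>x. cnj (fourier_integral (\<lambda>\<xi>. cnj (f \<xi>)) x))"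
    by (rule ext) (rule band_limited_eq_fourier_integral[OF assms])
  then show ?thesis by simp
qed

lemma inverse_fourier_L2_integrable:
  fixes f :: "'a::euclidean_space \<Rightarrow> complex"
  assumes f [measurable]: "f \<in> borel_measurable borel" and i: "integrable lborel f" and s: "sq_integrable f"
  shows "AE x in lebesgue. rep_L2 (inverse_fourier_L2 (abs_L2 f)) x = complex_of_real (1 / (2 * pi) ^ DIM('a)) * band_limited f x"
proof -
  have ci: "integrable lborel (\<lambda>x. cnj (f x))" using i by simp
  have cm: "(\<lambda>x. cnj (f x)) \<in> borel_measurable borel" by measurable
  have eq: "inverse_fourier_L2 (abs_L2 f) = (1 / (2 * pi) ^ DIM('a)) *\<^sub>R cnj_L2 (fourier_L2 (abs_L2 (\<lambda>x. cnj (f x))))"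
    by (simp add: inverse_fourier_L2_def cnj_abs_L2[OF s])
  show ?thesis unfolding eq band_limited_eq_fourier_integral[OF f]
    using rep_L2_scaleR[of "1 / (2 * pi) ^ DIM('a)" "cnj_L2 (fourier_L2 (abs_L2 (\<lambda>x. cnj (f x))))"]
      rep_cnj_L2[of "fourier_L2 (abs_L2 (\<lambda>x. cnj (f x)))"] fourier_L2_integrable[OF cm ci sq_integrable_cnj[OF s]]
    by eventually_elim simp
qed

lemma sq_integrable_indicator_borel:
  fixes S :: "'a::euclidean_space set"
  assumes [measurable]: "S \<in> sets borel" and "emeasure lborel S < \<infinity>"
  shows "bounded_integrable (indicator S :: 'a \<Rightarrow> complex)"
  unfolding bounded_integrable_def
proof (intro conjI exI[of _ 1] allI)
  show "integrable lborel (indicator S :: 'a \<Rightarrow> complex)"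
  proof (rule Bochner_Integration.integrable_bound)
    show "integrable lborel (indicator S :: 'a \<Rightarrow> real)" using assms by (simp add: integrable_indicator_iff)
  qed (auto simp: indicator_def)
qed (auto simp: indicator_def)

lemma integral_cmod_bound:
  fixes f :: "'a::euclidean_space \<Rightarrow> complex"
  assumes [measurable]: "f \<in> borel_measurable borel" "S \<in> sets borel" and s: "sq_integrable f"
    and z: "\<And>x. x \<notin> S \<Longrightarrow> f x = 0" and S: "emeasure lborel S < \<infinity>"
  shows "(LINT x|lborel. cmod (f x)) \<le> norm (abs_L2 (indicator S :: 'a \<Rightarrow> complex)) * norm (abs_L2 f)"
proof -
  let ?g = "\<lambda>x. complex_of_real (cmod (f x))" and ?h = "indicator S :: 'a \<Rightarrow> complex"
  have sg: "sq_integrable ?g" using s by (auto simp: sq_integrable_def)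
  have sh: "sq_integrable ?h" by (rule sq_integrable_bounded_integrable[OF sq_integrable_indicator_borel[OF assms(2) S]])
  have e: "?g x * cnj (?h x) = complex_of_real (cmod (f x))" for x
    using z[of x] by (auto simp: indicator_def)
  have "(LINT x|lborel. cmod (f x)) = Re (LINT x|lborel. ?g x * cnj (?h x))"
    by (simp only: e) simp
  also have "\<dots> = abs_L2 ?g \<bullet> abs_L2 ?h"
    by (rule inner_abs_L2(1)[symmetric]) (auto simp: sg sh)
  also have "\<dots> \<le> norm (abs_L2 ?g) * norm (abs_L2 ?h)" by (rule norm_cauchy_schwarz)
  also have "norm (abs_L2 ?g) = norm (abs_L2 f)"
    by (rule norm_L2_cong, use rep_abs_L2[OF sg] rep_abs_L2[OF s] in eventually_elim) simp
  finally show ?thesis by (simp add: mult.commute)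
qed

text \<open>A transform supported in a ball is integrable, with \<open>L\<^sup>1\<close> norm bounded by the \<open>L\<^sup>2\<close> norm, so \<open>w\<close>
  is given by an absolutely convergent inversion integral.\<close>
lemma band_limited_representation:
  fixes S :: real
  obtains K where "0 \<le> K" "\<And>w :: 'a::euclidean_space L2. (AE \<xi> in lebesgue. norm \<xi> > S \<longrightarrow> fhat w \<xi> = 0) \<Longrightarrow>
    \<exists>a. a \<in> borel_measurable borel \<and> integrable lborel a \<and> (\<forall>\<xi>. norm \<xi> > S \<longrightarrow> a \<xi> = 0) \<and>
      (AE x in lebesgue. rep_L2 w x = band_limited a x) \<and> (LINT \<xi>|lborel. cmod (a \<xi>)) \<le> K * norm w"
proof (rule that)
  let ?c = "1 / (2 * pi) ^ DIM('a)"
  let ?B = "cball 0 S :: 'a set"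
  let ?K = "norm (abs_L2 (indicator ?B :: 'a \<Rightarrow> complex)) * (?c * sqrt ((2 * pi) ^ DIM('a)))"
  show "0 \<le> ?K" by simp
  fix w :: "'a L2" assume w: "AE \<xi> in lebesgue. norm \<xi> > S \<longrightarrow> fhat w \<xi> = 0"
  define a0 where "a0 \<xi> = indicator ?B \<xi> * borel_rep (fourier_L2 w) \<xi>" for \<xi>
  define a where "a \<xi> = complex_of_real ?c * a0 \<xi>" for \<xi>
  have Bm [measurable]: "?B \<in> sets borel" by simp
  have a0m [measurable]: "a0 \<in> borel_measurable borel" unfolding a0_def by measurable
  have a0s: "sq_integrable a0" unfolding a0_def by (rule sq_integrable_indicator[OF sq_integrable_borel_rep]) auto
  have Bf: "emeasure lborel ?B < \<infinity>" by (rule emeasure_lborel_cball_finite)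
  have a0z: "\<xi> \<notin> ?B \<Longrightarrow> a0 \<xi> = 0" for \<xi> by (simp add: a0_def)
  have a0i: "integrable lborel a0" by (rule integrable_bounded_support[OF a0m Bm a0s a0z Bf])
  have a0eq: "abs_L2 a0 = fourier_L2 w"
    by (rule L2_eqI, use rep_abs_L2[OF a0s] borel_rep_AE[of "fourier_L2 w"] w in eventually_elim) (auto simp: a0_def indicator_def)
  have "AE x in lebesgue. rep_L2 (inverse_fourier_L2 (abs_L2 a0)) x = complex_of_real ?c * band_limited a0 x"
    by (rule inverse_fourier_L2_integrable[OF a0m a0i a0s])
  moreover have "complex_of_real ?c * band_limited a0 x = band_limited a x" for x
    unfolding band_limited_def a_def integral_mult_right_zero[symmetric] by (simp add: mult_ac)
  ultimately have rep: "AE x in lebesgue. rep_L2 w x = band_limited a x"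
    unfolding a0eq by simp
  have "(LINT \<xi>|lborel. cmod (a \<xi>)) = ?c * (LINT \<xi>|lborel. cmod (a0 \<xi>))"
    by (simp add: a_def norm_mult norm_divide norm_power)
  also have "\<dots> \<le> ?c * (norm (abs_L2 (indicator ?B :: 'a \<Rightarrow> complex)) * norm (abs_L2 a0))"
    by (intro mult_left_mono integral_cmod_bound[OF a0m Bm a0s a0z Bf]) auto
  also have "\<dots> = ?K * norm w" by (simp add: a0eq norm_fourier_L2)
  finally have 1: "(LINT \<xi>|lborel. cmod (a \<xi>)) \<le> ?K * norm w" .
  show "\<exists>a. a \<in> borel_measurable borel \<and> integrable lborel a \<and> (\<forall>\<xi>. norm \<xi> > S \<longrightarrow> a \<xi> = 0) \<and>
      (AE x in lebesgue. rep_L2 w x = band_limited a x) \<and> (LINT \<xi>|lborel. cmod (a \<xi>)) \<le> ?K * norm w"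
  proof (intro exI[of _ a] conjI allI impI 1 rep)
    show "a \<in> borel_measurable borel" unfolding a_def by measurable
    show "integrable lborel a" unfolding a_def using a0i by simp
    show "a \<xi> = 0" if "norm \<xi> > S" for \<xi> using that by (simp add: a_def a0_def)
  qed
qed

lemma mean_square_markov:
  fixes v :: "'a::euclidean_space \<Rightarrow> complex"
  assumes [measurable]: "v \<in> borel_measurable borel" "W \<in> sets borel" and W: "emeasure lborel W < \<infinity>"
    and I: "(\<integral>\<^sup>+x. indicator W x * ennreal ((cmod (v x))\<^sup>2) \<partial>lborel) \<le> ennreal J"
    and M: "0 < M" and J: "0 \<le> J" "J \<le> M\<^sup>2 * m"
  shows "measure lborel W - m \<le> measure lborel {x \<in> W. cmod (v x) \<le> M}"
proof -
  let ?E = "{x \<in> W. cmod (v x) \<le> M}"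
  let ?A = "{x \<in> W. 1 \<le> ennreal (1 / M\<^sup>2) * ennreal ((cmod (v x))\<^sup>2)}"
  have [measurable]: "?E \<in> sets borel" "?A \<in> sets borel" by measurable
  have "emeasure lborel ?A \<le> ennreal (1 / M\<^sup>2) * (\<integral>\<^sup>+x. ennreal ((cmod (v x))\<^sup>2) * indicator W x \<partial>lborel)"
    by (rule nn_integral_Markov_inequality) measurable
  also have "\<dots> \<le> ennreal (1 / M\<^sup>2) * ennreal J" using I by (intro mult_left_mono) (auto simp: mult.commute)
  also have "\<dots> = ennreal (J / M\<^sup>2)" using J M by (simp add: ennreal_mult[symmetric])
  also have "\<dots> \<le> ennreal m" using J M by (intro ennreal_leI) (simp add: divide_le_eq mult.commute)
  finally have eA: "emeasure lborel ?A \<le> ennreal m" .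
  have "0 \<le> M\<^sup>2 * m" using J by linarith
  then have m0: "0 \<le> m" using M by (simp add: zero_le_mult_iff)
  have mA: "measure lborel ?A \<le> m" using eA m0 by (simp add: measure_def enn2real_leI)
  have "W \<subseteq> ?E \<union> ?A"
  proof
    fix x assume "x \<in> W"
    show "x \<in> ?E \<union> ?A"
    proof (cases "cmod (v x) \<le> M")
      case False
      then have "M\<^sup>2 \<le> (cmod (v x))\<^sup>2" using M by (intro power_mono) auto
      then have "1 \<le> 1 / M\<^sup>2 * (cmod (v x))\<^sup>2" using M by (simp add: le_divide_eq)
      then have "1 \<le> ennreal (1 / M\<^sup>2 * (cmod (v x))\<^sup>2)" by simp
      then have "1 \<le> ennreal (1 / M\<^sup>2) * ennreal ((cmod (v x))\<^sup>2)" by (subst ennreal_mult[symmetric]) auto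
      then show ?thesis using \<open>x \<in> W\<close> by simp
    qed (use \<open>x \<in> W\<close> in simp)
  qed
  then have "W = ?E \<union> ?A" by auto
  then have "measure lborel W \<le> measure lborel ?E + measure lborel ?A"
    using measure_Un_le[of ?E lborel ?A] by simp
  then show ?thesis using mA by linarith
qed

lemma half_fraction: "0 < l \<Longrightarrow> 0 < d \<Longrightarrow> 2 * l * (e / (4 * l * d)) * k = e / 2 * (k / d)" for l d e k :: real
  by (simp add: field_simps)

text \<open>By Markov's inequality, \<open>w\<close> is bounded by its quadratic mean over \<open>W \<inter> Q\<close>, up to a constant, on
  a subset that has at least half of the guaranteed measure. The Remez bound carries this over to
  the cube \<open>Q\<close>, with an error that is small compared to the global norm.\<close>
lemma local_mean_square_estimate:
  assumes \<gamma>: "0 < \<gamma>" and L: "0 < L" and S: "0 \<le> S" and \<eta>: "0 < \<eta>"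
  obtains C where "0 \<le> C" "\<And>(w :: 'a::euclidean_space L2) q W.
    \<lbrakk>AE \<xi> in lebesgue. norm \<xi> > S \<longrightarrow> fhat w \<xi> = 0; W \<in> sets borel;
     \<gamma> * L ^ DIM('a) \<le> measure lborel (W \<inter> cbox q (q + L *\<^sub>R One))\<rbrakk> \<Longrightarrow>
     (\<integral>\<^sup>+x. indicator (cbox q (q + L *\<^sub>R One)) x * ennreal ((cmod (rep_L2 w x))\<^sup>2) \<partial>lebesgue) \<le>
     ennreal C * (\<integral>\<^sup>+x. indicator (W \<inter> cbox q (q + L *\<^sub>R One)) x * ennreal ((cmod (rep_L2 w x))\<^sup>2) \<partial>lebesgue) + ennreal (\<eta> * (norm w)\<^sup>2)"
proof -
  let ?n = "DIM('a)"
  have Ln: "0 < L ^ ?n" using L by simp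
  obtain K where K: "0 \<le> K" "\<And>w :: 'a L2. (AE \<xi> in lebesgue. norm \<xi> > S \<longrightarrow> fhat w \<xi> = 0) \<Longrightarrow>
    \<exists>a. a \<in> borel_measurable borel \<and> integrable lborel a \<and> (\<forall>\<xi>. norm \<xi> > S \<longrightarrow> a \<xi> = 0) \<and>
      (AE x in lebesgue. rep_L2 w x = band_limited a x) \<and> (LINT \<xi>|lborel. cmod (a \<xi>)) \<le> K * norm w"
    using band_limited_representation[of S] by blast
  \<comment> \<open>\<open>\<eta>1\<close> and \<open>\<eta>2\<close> are chosen so that the remainder of the Remez bound and the correction in \<open>M\<close> each contribute at most \<open>\<eta> / 2\<close>.\<close>
  define \<eta>1 where "\<eta>1 = sqrt (\<eta> / (4 * L ^ ?n * (K\<^sup>2 + 1)))"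
  have den: "0 < 4 * L ^ ?n * (K\<^sup>2 + 1)" using Ln by (simp add: add_nonneg_pos)
  have \<eta>1: "0 < \<eta>1" using \<eta> den by (simp add: \<eta>1_def)
  have \<eta>1b: "2 * L ^ ?n * \<eta>1\<^sup>2 * K\<^sup>2 \<le> \<eta> / 2"
  proof -
    have "\<eta>1\<^sup>2 = \<eta> / (4 * L ^ ?n * (K\<^sup>2 + 1))" using \<eta> den by (simp add: \<eta>1_def)
    moreover have "0 < K\<^sup>2 + 1" by (simp add: add_nonneg_pos)
    ultimately have "2 * L ^ ?n * \<eta>1\<^sup>2 * K\<^sup>2 = \<eta> / 2 * (K\<^sup>2 / (K\<^sup>2 + 1))"
      by (simp only: half_fraction[OF Ln])
    also have "\<dots> \<le> \<eta> / 2 * 1" using \<eta> by (intro mult_left_mono) (auto simp: divide_le_eq_1 add_nonneg_pos)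
    finally show ?thesis by simp
  qed
  have \<gamma>2: "0 < \<gamma> / 2" using \<gamma> by simp
  show ?thesis
  proof (rule band_limited_remez[OF \<gamma>2 L S \<eta>1, where 'a='a])
    fix C0 :: real assume C0: "0 \<le> C0"
      "\<And>(a :: 'a \<Rightarrow> complex) q E M x.
      \<lbrakk>a \<in> borel_measurable borel; integrable lborel a; \<And>\<xi>. norm \<xi> > S \<Longrightarrow> a \<xi> = 0; E \<in> sets borel;
       E \<subseteq> cbox q (q + L *\<^sub>R One); \<gamma> / 2 * L ^ DIM('a) \<le> measure lborel E; \<And>x. x \<in> E \<Longrightarrow> cmod (band_limited a x) \<le> M;
       x \<in> cbox q (q + L *\<^sub>R One)\<rbrakk> \<Longrightarrow> cmod (band_limited a x) \<le> C0 * M + \<eta>1 * (LINT \<xi>|lborel. cmod (a \<xi>))"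
    define \<eta>2 where "\<eta>2 = \<eta> / (4 * L ^ ?n * (C0\<^sup>2 + 1))"
    have den2: "0 < 4 * L ^ ?n * (C0\<^sup>2 + 1)" using Ln by (simp add: add_nonneg_pos)
    have \<eta>2: "0 < \<eta>2" using \<eta> den2 by (simp add: \<eta>2_def)
    have \<eta>2b: "2 * L ^ ?n * C0\<^sup>2 * \<eta>2 \<le> \<eta> / 2"
    proof -
      have d: "0 < C0\<^sup>2 + 1" by (simp add: add_nonneg_pos)
      have "2 * L ^ ?n * C0\<^sup>2 * \<eta>2 = 2 * L ^ ?n * \<eta>2 * C0\<^sup>2" by (simp only: mult_ac)
      also have "\<dots> = \<eta> / 2 * (C0\<^sup>2 / (C0\<^sup>2 + 1))" by (simp only: \<eta>2_def half_fraction[OF Ln d])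
      also have "\<dots> \<le> \<eta> / 2 * 1" using \<eta> by (intro mult_left_mono) (auto simp: divide_le_eq_1 add_nonneg_pos)
      finally show ?thesis by simp
    qed
    define C where "C = 2 * L ^ ?n * C0\<^sup>2 * (2 / (\<gamma> * L ^ ?n))"
    have C: "0 \<le> C" using \<gamma> Ln by (simp add: C_def)
    show thesis
    proof (rule that[OF C])
      fix w :: "'a L2" and q :: 'a and W :: "'a set"
      assume supp: "AE \<xi> in lebesgue. norm \<xi> > S \<longrightarrow> fhat w \<xi> = 0" and W [measurable]: "W \<in> sets borel"
        and mW: "\<gamma> * L ^ DIM('a) \<le> measure lborel (W \<inter> cbox q (q + L *\<^sub>R One))"
      let ?Q = "cbox q (q + L *\<^sub>R One)"
      let ?sq = "\<lambda>x. ennreal ((cmod (rep_L2 w x))\<^sup>2)"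
      have Qm [measurable]: "?Q \<in> sets borel" by simp
      show "(\<integral>\<^sup>+x. indicator ?Q x * ?sq x \<partial>lebesgue) \<le> ennreal C * (\<integral>\<^sup>+x. indicator (W \<inter> ?Q) x * ?sq x \<partial>lebesgue) + ennreal (\<eta> * (norm w)\<^sup>2)"
      proof (cases "w = 0")
        case True
        have "(\<integral>\<^sup>+x. indicator ?Q x * ?sq x \<partial>lebesgue) = (\<integral>\<^sup>+x. 0 \<partial>(lebesgue :: 'a measure))"
          by (rule nn_integral_cong_AE, use rep_L2_zero in eventually_elim) (simp add: True)
        then show ?thesis by simp
      next
        case False
        obtain a where a: "a \<in> borel_measurable borel" "integrable lborel a" "\<And>\<xi>. norm \<xi> > S \<Longrightarrow> a \<xi> = 0"
          and rep: "AE x in lebesgue. rep_L2 w x = band_limited a x" and aK: "(LINT \<xi>|lborel. cmod (a \<xi>)) \<le> K * norm w"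
          using K(2)[OF supp] by blast
        note [measurable] = a(1)
        let ?v = "band_limited a" and ?A = "LINT \<xi>|lborel. cmod (a \<xi>)"
        have vw: "(\<integral>\<^sup>+x. indicator B x * ?sq x \<partial>lebesgue) = (\<integral>\<^sup>+x. indicator B x * ennreal ((cmod (?v x))\<^sup>2) \<partial>lborel)" for B
          unfolding nn_integral_lebesgue_eq[symmetric]
          by (rule nn_integral_cong_AE, use rep in eventually_elim) simp
        let ?I = "\<integral>\<^sup>+x. indicator (W \<inter> ?Q) x * ?sq x \<partial>lebesgue"
        have "?I \<le> (\<integral>\<^sup>+x. ?sq x \<partial>lebesgue)" by (rule nn_integral_mono) (simp add: indicator_def)
        also have "\<dots> < top" unfolding norm_L2_nn[symmetric] by simp
        finally obtain J where J: "0 \<le> J" "?I = ennreal J" by (cases ?I) auto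
        \<comment> \<open>The second summand keeps the threshold positive when \<open>w\<close> vanishes on \<open>W \<inter> Q\<close>.\<close>
        define M where "M = sqrt (2 / (\<gamma> * L ^ ?n) * J + \<eta>2 * (norm w)\<^sup>2)"
        have arg: "0 < 2 / (\<gamma> * L ^ ?n) * J + \<eta>2 * (norm w)\<^sup>2"
          using \<gamma> Ln J(1) \<eta>2 False by (intro add_nonneg_pos) auto
        have M: "0 < M" "M\<^sup>2 = 2 / (\<gamma> * L ^ ?n) * J + \<eta>2 * (norm w)\<^sup>2" using arg by (simp_all add: M_def)
        define E where "E = {x \<in> W \<inter> ?Q. cmod (?v x) \<le> M}"
        have Em: "E \<in> sets borel" unfolding E_def by measurable
        have WQf: "emeasure lborel (W \<inter> ?Q) < \<infinity>"
        proof -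
          have "emeasure lborel (W \<inter> ?Q) \<le> emeasure lborel ?Q" by (rule emeasure_mono) auto
          then show ?thesis using emeasure_lborel_cbox_finite[of q "q + L *\<^sub>R One"] by (rule le_less_trans)
        qed
        have "J = \<gamma> * L ^ ?n / 2 * (2 / (\<gamma> * L ^ ?n) * J)" using \<gamma> L by simp
        also have "\<dots> \<le> \<gamma> * L ^ ?n / 2 * M\<^sup>2" unfolding M(2) using \<gamma> Ln \<eta>2 by (intro mult_left_mono) auto
        finally have JM: "J \<le> M\<^sup>2 * (\<gamma> * L ^ ?n / 2)" by (simp add: mult.commute)
        have "measure lborel (W \<inter> ?Q) - \<gamma> * L ^ ?n / 2 \<le> measure lborel E"
          unfolding E_def
          by (rule mean_square_markov[OF _ _ WQf _ M(1) J(1) JM]) (simp_all add: J(2)[symmetric] vw)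
        then have mE: "\<gamma> / 2 * L ^ ?n \<le> measure lborel E" using mW by simp
        have vE: "cmod (?v x) \<le> M" if "x \<in> E" for x using that by (simp add: E_def)
        have EQ: "E \<subseteq> ?Q" by (auto simp: E_def)
        have A0: "0 \<le> ?A" by simp
        have vb: "(cmod (?v x))\<^sup>2 \<le> 2 * C0\<^sup>2 * M\<^sup>2 + 2 * \<eta>1\<^sup>2 * (K * norm w)\<^sup>2" if "x \<in> ?Q" for x
        proof -
          have "cmod (?v x) \<le> C0 * M + \<eta>1 * ?A" by (rule C0(2)[OF a Em EQ mE vE that])
          also have "\<dots> \<le> C0 * M + \<eta>1 * (K * norm w)" using aK \<eta>1 by (intro add_left_mono mult_left_mono) auto
          finally have "(cmod (?v x))\<^sup>2 \<le> (C0 * M + \<eta>1 * (K * norm w))\<^sup>2" by (intro power_mono) auto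
          also have "\<dots> \<le> 2 * (C0 * M)\<^sup>2 + 2 * (\<eta>1 * (K * norm w))\<^sup>2"
          proof -
            have "0 \<le> (C0 * M - \<eta>1 * (K * norm w))\<^sup>2" by simp
            then show ?thesis unfolding power2_sum power2_diff by linarith
          qed
          finally show ?thesis by (simp add: power_mult_distrib)
        qed
        have "(\<integral>\<^sup>+x. indicator ?Q x * ?sq x \<partial>lebesgue) \<le> (\<integral>\<^sup>+x. ennreal (2 * C0\<^sup>2 * M\<^sup>2 + 2 * \<eta>1\<^sup>2 * (K * norm w)\<^sup>2) * indicator ?Q x \<partial>lborel)"
          unfolding vw
        proof (rule nn_integral_mono)
          fix x
          show "indicator ?Q x * ennreal ((cmod (?v x))\<^sup>2) \<le> ennreal (2 * C0\<^sup>2 * M\<^sup>2 + 2 * \<eta>1\<^sup>2 * (K * norm w)\<^sup>2) * indicator ?Q x"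
            using ennreal_leI[OF vb[of x]] by (cases "x \<in> ?Q") (simp_all del: ennreal_plus)
        qed
        also have "\<dots> = ennreal (2 * C0\<^sup>2 * M\<^sup>2 + 2 * \<eta>1\<^sup>2 * (K * norm w)\<^sup>2) * ennreal (L ^ ?n)"
        proof -
          have "emeasure lborel ?Q = ennreal (L ^ ?n)"
            using L by (simp add: emeasure_lborel_cbox_eq inner_add_left)
          then show ?thesis by (simp add: nn_integral_cmult_indicator)
        qed
        also have "\<dots> = ennreal ((2 * C0\<^sup>2 * M\<^sup>2 + 2 * \<eta>1\<^sup>2 * (K * norm w)\<^sup>2) * L ^ ?n)"
          using Ln by (intro ennreal_mult[symmetric]) auto
        also have "\<dots> \<le> ennreal (C * J + \<eta> * (norm w)\<^sup>2)"
        proof (rule ennreal_leI)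
          have "(2 * C0\<^sup>2 * M\<^sup>2 + 2 * \<eta>1\<^sup>2 * (K * norm w)\<^sup>2) * L ^ ?n = C * J + (2 * L ^ ?n * C0\<^sup>2 * \<eta>2) * (norm w)\<^sup>2 + (2 * L ^ ?n * \<eta>1\<^sup>2 * K\<^sup>2) * (norm w)\<^sup>2"
            unfolding M(2) C_def by (simp add: algebra_simps power_mult_distrib)
          also have "\<dots> \<le> C * J + \<eta> / 2 * (norm w)\<^sup>2 + \<eta> / 2 * (norm w)\<^sup>2"
            by (rule add_mono[OF add_mono[OF order_refl mult_right_mono[OF \<eta>2b]] mult_right_mono[OF \<eta>1b]]) auto
          finally show "(2 * C0\<^sup>2 * M\<^sup>2 + 2 * \<eta>1\<^sup>2 * (K * norm w)\<^sup>2) * L ^ ?n \<le> C * J + \<eta> * (norm w)\<^sup>2" by (simp add: field_simps)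
        qed
        also have "\<dots> = ennreal C * ?I + ennreal (\<eta> * (norm w)\<^sup>2)"
          unfolding J(2) ennreal_mult[OF C J(1), symmetric]
          by (rule ennreal_plus) (use C J(1) \<eta> in auto)
        finally show ?thesis .
      qed
    qed
  qed
qed

section \<open>Localization by a band-limited window\<close>

text \<open>This function has compactly supported transform, is square integrable and bounded, and is
  bounded away from 0 near the origin, because the characters \<open>cis (- (\<xi> \<bullet> x))\<close> with
  \<open>|\<xi>| < \<epsilon>\<close> have real part at least \<open>1 / 2\<close> there.\<close>
definition window :: "real \<Rightarrow> 'a::euclidean_space \<Rightarrow> complex" where
  "window \<epsilon> = fourier_integral (indicator (ball 0 \<epsilon>))"

lemma ball_bounded_integrable: "bounded_integrable (indicator (ball c \<epsilon>) :: 'a::euclidean_space \<Rightarrow> complex)"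
  by (rule sq_integrable_indicator_borel[OF _ emeasure_lborel_ball_finite]) simp

lemma window_measurable [measurable]: "window \<epsilon> \<in> borel_measurable borel"
  unfolding window_def by (intro fourier_integral_measurable borel_measurable_indicator) simp

lemma sq_integrable_window: "sq_integrable (window \<epsilon>)"
  unfolding window_def by (rule plancherel_bounded_integrable(1)[OF ball_bounded_integrable])

lemma window_bound:
  fixes x :: "'a::euclidean_space"
  shows "cmod (window \<epsilon> x) \<le> measure lborel (ball (0::'a) \<epsilon>)"
proof -
  have "cmod (window \<epsilon> x) \<le> (LINT \<xi>|lborel. cmod (indicator (ball (0::'a) \<epsilon>) \<xi>))"
    unfolding window_def by (intro fourier_integral_bound borel_measurable_indicator) simp
  also have "(\<lambda>\<xi>. cmod (indicator (ball (0::'a) \<epsilon>) \<xi>)) = indicator (ball 0 \<epsilon>)" by (auto simp: indicator_def)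
  finally show ?thesis by simp
qed

lemma window_lower_bound:
  fixes x :: "'a::euclidean_space"
  assumes "norm x * \<epsilon> \<le> 1"
  shows "measure lborel (ball (0::'a) \<epsilon>) / 2 \<le> cmod (window \<epsilon> x)"
proof -
  let ?B = "ball (0::'a) \<epsilon>"
  have Bm [measurable]: "?B \<in> sets borel" by simp
  have i: "integrable lborel (\<lambda>\<xi>. cis (- (\<xi> \<bullet> x)) * indicator ?B \<xi>)"
    using ball_bounded_integrable[of "0::'a" \<epsilon>] by (intro integrable_cis_mult) (auto simp: bounded_integrable_def)
  have Re_i: "integrable lborel (\<lambda>\<xi>. Re (cis (- (\<xi> \<bullet> x)) * indicator ?B \<xi>))"
    by (rule integrable_Re[OF i])
  have ii: "integrable lborel (indicator ?B :: 'a \<Rightarrow> real)"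
    using emeasure_lborel_ball_finite[of "0::'a" \<epsilon>] by (simp add: integrable_indicator_iff)
  have "measure lborel ?B / 2 = (LINT \<xi>|lborel. 1 / 2 * indicator ?B \<xi>)" by simp
  also have "\<dots> \<le> (LINT \<xi>|lborel. Re (cis (- (\<xi> \<bullet> x)) * indicator ?B \<xi>))"
  proof (rule integral_mono[OF _ Re_i])
    show "integrable lborel (\<lambda>\<xi>. 1 / 2 * indicator ?B \<xi> :: real)" using ii by (intro integrable_mult_right)
    fix \<xi> :: 'a
    show "1 / 2 * indicator ?B \<xi> \<le> Re (cis (- (\<xi> \<bullet> x)) * indicator ?B \<xi>)"
    proof (cases "\<xi> \<in> ?B")
      case True
      have "\<bar>\<xi> \<bullet> x\<bar> \<le> norm \<xi> * norm x" by (rule Cauchy_Schwarz_ineq2)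
      also have "\<dots> \<le> \<epsilon> * norm x" using True by (intro mult_right_mono) auto
      also have "\<dots> \<le> 1" using assms by (simp add: mult.commute)
      finally have s: "\<bar>\<xi> \<bullet> x\<bar> \<le> 1" .
      have "cos (pi / 3) \<le> cos \<bar>\<xi> \<bullet> x\<bar>"
        using s pi_gt3 by (intro cos_monotone_0_pi_le) auto
      then have "1 / 2 \<le> cos (\<xi> \<bullet> x)" by (simp only: cos_60 cos_abs_real)
      then show ?thesis using True by simp
    qed simp
  qed
  also have "\<dots> = Re (window \<epsilon> x)"
    unfolding window_def fourier_integral_lborel[OF borel_measurable_indicator[OF Bm]]
    using integral_bounded_linear[OF bounded_linear_Re i] by simp
  also have "\<dots> \<le> cmod (window \<epsilon> x)" by (rule complex_Re_le_cmod)
  finally show ?thesis .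
qed

text \<open>The multiplication formula for a square-integrable \<open>f\<close>. The real inner product only sees the
  real part of the integral; multiplying \<open>f\<close> by \<open>1\<close> and \<open>\<i>\<close> recovers the whole.\<close>
lemma fourier_pairing_zero:
  fixes f \<psi> :: "'a::euclidean_space \<Rightarrow> complex"
  assumes f [measurable]: "f \<in> borel_measurable borel" and fs: "sq_integrable f" and \<psi>: "bounded_integrable \<psi>"
    and z: "AE \<xi> in lebesgue. fhat (abs_L2 f) \<xi> * \<psi> \<xi> = 0"
  shows "(LINT x|lborel. f x * fourier_integral \<psi> x) = 0"
proof -
  have [measurable]: "\<psi> \<in> borel_measurable borel" using \<psi> by (simp add: bounded_integrable_def)
  note s\<psi> = sq_integrable_bounded_integrable[OF \<psi>] plancherel_bounded_integrable(1)[OF \<psi>]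
  have F\<psi>: "fourier_L2 (abs_L2 \<psi>) = abs_L2 (fourier_integral \<psi>)"
    by (rule L2_eqI, use fourier_L2_integrable[of \<psi>] s\<psi> \<psi> rep_abs_L2[OF s\<psi>(2)] in \<open>auto simp: bounded_integrable_def elim: AE_mp\<close>)
  have "Re (c * (LINT x|lborel. f x * fourier_integral \<psi> x)) = 0" for c
  proof -
    have cf: "sq_integrable (\<lambda>x. c * f x)" by (rule sq_integrable_cmult[OF fs])
    have "Re (c * (LINT x|lborel. f x * fourier_integral \<psi> x)) = Re (LINT x|lborel. (c * f x) * cnj (cnj (fourier_integral \<psi> x)))"
      by (simp only: integral_mult_right_zero[symmetric] mult.assoc complex_cnj_cnj)
    also have "\<dots> = abs_L2 (\<lambda>x. c * f x) \<bullet> abs_L2 (\<lambda>x. cnj (fourier_integral \<psi> x))"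
      by (rule inner_abs_L2(1)[symmetric]) (auto intro: cf sq_integrable_cnj s\<psi>)
    also have "abs_L2 (\<lambda>x. cnj (fourier_integral \<psi> x)) = cnj_L2 (fourier_L2 (abs_L2 \<psi>))"
      by (simp add: F\<psi> cnj_abs_L2[OF s\<psi>(2)])
    also have "abs_L2 (\<lambda>x. c * f x) \<bullet> cnj_L2 (fourier_L2 (abs_L2 \<psi>)) = scaleC_L2 c (fourier_L2 (abs_L2 f)) \<bullet> cnj_L2 (abs_L2 \<psi>)"
      by (simp add: fourier_L2_adjoint[symmetric] abs_L2_cmult[OF fs] fourier_L2_scaleC)
    also have "\<dots> = (LINT x|(lebesgue :: 'a measure). (0::real))"
      unfolding inner_L2_eq
    proof (rule integral_cong_AE)
      show "AE x in lebesgue. rep_L2 (scaleC_L2 c (fourier_L2 (abs_L2 f))) x \<bullet> rep_L2 (cnj_L2 (abs_L2 \<psi>)) x = 0"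
        using z rep_L2_scaleC[of c "fourier_L2 (abs_L2 f)"] rep_cnj_L2[of "abs_L2 \<psi>"] rep_abs_L2[OF s\<psi>(1)]
        by eventually_elim auto
    qed measurable
    finally show ?thesis by simp
  qed
  from this[of 1] this[of "\<i>"] show ?thesis by (simp add: complex_eq_iff)
qed

text \<open>Multiplication by the window convolves the transform with the indicator of a ball of
  radius \<open>\<epsilon>\<close>. Concretely, the transform of the product at \<open>\<xi>\<close> is the integral of \<open>f\<close> against the
  transform of a function \<open>\<psi>\<close> supported in the ball of radius \<open>\<epsilon>\<close> around \<open>\<xi>\<close>.\<close>
lemma windowed_band_limited:
  fixes f :: "'a::euclidean_space \<Rightarrow> complex"
  assumes f [measurable]: "f \<in> borel_measurable borel" and fs: "sq_integrable f"
    and supp: "AE \<xi> in lebesgue. norm \<xi> > R \<longrightarrow> fhat (abs_L2 f) \<xi> = 0"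
  shows "sq_integrable (\<lambda>x. window \<epsilon> (x - y) * f x)"
    and "AE \<xi> in lebesgue. norm \<xi> > R + \<epsilon> \<longrightarrow> fhat (abs_L2 (\<lambda>x. window \<epsilon> (x - y) * f x)) \<xi> = 0"
proof -
  let ?v = "\<lambda>x. window \<epsilon> (x - y) * f x"
  let ?B = "ball (0::'a) \<epsilon>"
  have Bm [measurable]: "?B \<in> sets borel" by simp
  have vm [measurable]: "?v \<in> borel_measurable borel" by measurable
  show vs: "sq_integrable ?v"
  proof (rule sq_integrable_bound[OF fs, where c="measure lborel ?B"])
    show "?v \<in> borel_measurable lebesgue" by (rule borel_imp_lebesgue_measurable) measurable
    show "AE x in lebesgue. cmod (?v x) \<le> measure lborel ?B * cmod (f x)"
      using window_bound[of \<epsilon>] by (intro AE_I2) (auto simp: norm_mult intro!: mult_right_mono)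
  qed
  have ws: "sq_integrable (\<lambda>x. window \<epsilon> (x - y) :: complex)"
  proof -
    have "integrable lborel (\<lambda>x::'a. (cmod (window \<epsilon> x))\<^sup>2)" using sq_integrable_window[of \<epsilon>, where 'a='a] by (simp add: sq_integrable_borel)
    from integrable_lborel_translate[OF _ this, of y] show ?thesis by (simp add: sq_integrable_borel)
  qed
  have vi: "integrable lborel ?v"
  proof -
    have "integrable lborel (\<lambda>x. window \<epsilon> (x - y) * cnj (cnj (f x)))"
      by (rule inner_abs_L2(2)) (auto intro: ws sq_integrable_cnj fs)
    then show ?thesis by simp
  qed
  have z: "fourier_integral ?v \<xi> = 0" if \<xi>: "norm \<xi> > R + \<epsilon>" for \<xi>
  proof -
    define \<psi> where "\<psi> \<zeta> = indicator ?B (\<zeta> - \<xi>) * cis (y \<bullet> (\<zeta> - \<xi>))" for \<zeta>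
    have \<psi>m [measurable]: "\<psi> \<in> borel_measurable borel" unfolding \<psi>_def by measurable
    have \<psi>: "bounded_integrable \<psi>"
      unfolding bounded_integrable_def
    proof (intro conjI exI[of _ 1] allI \<psi>m)
      have "integrable lborel (\<lambda>\<zeta>. indicator ?B (\<zeta> - \<xi>) :: complex)"
        using ball_bounded_integrable[of "0::'a" \<epsilon>] by (intro integrable_lborel_translate) (auto simp: bounded_integrable_def)
      from integrable_cis_mult[OF _ _ this, of "\<lambda>\<zeta>. y \<bullet> (\<zeta> - \<xi>)"]
      show "integrable lborel \<psi>" by (simp add: \<psi>_def[abs_def] mult.commute)
      show "cmod (\<psi> x) \<le> 1" for x by (simp add: \<psi>_def norm_mult indicator_def)
    qed
    have F\<psi>: "fourier_integral \<psi> x = cis (- (x \<bullet> \<xi>)) * window \<epsilon> (x - y)" for x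
    proof -
      have "fourier_integral \<psi> x = (LINT \<zeta>|lborel. cis (- (\<zeta> \<bullet> x)) * \<psi> \<zeta>)" by (simp add: fourier_integral_lborel)
      also have "\<dots> = (LINT \<zeta>|lborel. (\<lambda>\<zeta>. cis (- (x \<bullet> \<xi>)) * (cis (- (\<zeta> \<bullet> (x - y))) * indicator ?B \<zeta>)) (\<zeta> - \<xi>))"
      proof (rule Bochner_Integration.integral_cong[OF refl])
        fix \<zeta> :: 'a
        have "cis (- (\<zeta> \<bullet> x)) * cis (y \<bullet> (\<zeta> - \<xi>)) = cis (- (x \<bullet> \<xi>)) * cis (- ((\<zeta> - \<xi>) \<bullet> (x - y)))"
          unfolding cis_mult by (rule arg_cong[of _ _ cis]) (simp add: inner_diff_left inner_diff_right inner_commute)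
        then show "cis (- (\<zeta> \<bullet> x)) * \<psi> \<zeta> = (\<lambda>\<zeta>. cis (- (x \<bullet> \<xi>)) * (cis (- (\<zeta> \<bullet> (x - y))) * indicator ?B \<zeta>)) (\<zeta> - \<xi>)"
          by (simp add: \<psi>_def mult_ac)
      qed
      also have "\<dots> = (LINT \<zeta>|lborel. cis (- (x \<bullet> \<xi>)) * (cis (- (\<zeta> \<bullet> (x - y))) * indicator ?B \<zeta>))"
        by (rule integral_lborel_translate) measurable
      also have "\<dots> = cis (- (x \<bullet> \<xi>)) * window \<epsilon> (x - y)"
        by (simp add: window_def fourier_integral_lborel)
      finally show ?thesis .
    qed
    have "(LINT x|lborel. f x * fourier_integral \<psi> x) = 0"
    proof (rule fourier_pairing_zero[OF f fs \<psi>])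
      show "AE \<zeta> in lebesgue. fhat (abs_L2 f) \<zeta> * \<psi> \<zeta> = 0"
        using supp
      proof eventually_elim
        case (elim \<zeta>)
        show ?case
        proof (cases "norm \<zeta> > R")
          case False
          then have "norm (\<zeta> - \<xi>) > \<epsilon>" using \<xi> norm_triangle_ineq2[of \<xi> \<zeta>] by (simp add: norm_minus_commute)
          then have "\<psi> \<zeta> = 0" by (simp add: \<psi>_def)
          then show ?thesis by simp
        qed (use elim in simp)
      qed
    qed
    then show ?thesis by (simp add: fourier_integral_lborel F\<psi> mult_ac)
  qed
  show "AE \<xi> in lebesgue. norm \<xi> > R + \<epsilon> \<longrightarrow> fhat (abs_L2 ?v) \<xi> = 0"
    using fourier_L2_integrable[OF vm vi vs] by eventually_elim (simp add: z)
qed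

section \<open>The Logvinenko--Sereda inequality\<close>

text \<open>Apply the local estimate to \<open>x \<mapsto> window \<epsilon> (x - y) * u x\<close> on the cube with corner \<open>y\<close>, and
  integrate over all \<open>y\<close>. On the cube the window is bounded below and above, so its two mean
  squares become those of \<open>u\<close>, and Tonelli's theorem turns them into \<open>L ^ DIM('a)\<close> times
  the squared norms of \<open>u\<close> and \<open>1\<^sub>W u\<close>. The remainder becomes \<open>\<eta>\<close> times the squared norm of the
  window times that of \<open>u\<close>, which is absorbed. Averaging over continuous positions instead of a
  lattice of cubes makes a square-integrable window sufficient.\<close>
theorem logvinenko_sereda:
  fixes W :: "'a::euclidean_space set"
  assumes W [measurable]: "W \<in> sets borel" and \<gamma>: "0 < \<gamma>" and L: "0 < L" and R: "0 \<le> R"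
    and thick: "\<And>q. \<gamma> * L ^ DIM('a) \<le> measure lborel (W \<inter> cbox q (q + L *\<^sub>R One))"
  obtains c where "0 < c" "\<And>u :: 'a L2. (AE \<xi> in lebesgue. norm \<xi> > R \<longrightarrow> fhat u \<xi> = 0) \<Longrightarrow>
    c * (norm u)\<^sup>2 \<le> (norm (mult_indicator W u))\<^sup>2"
proof -
  let ?n = "DIM('a)"
  have Ln: "0 < L ^ ?n" using L by simp
  \<comment> \<open>The diagonal of the cube has length \<open>1 / \<epsilon>\<close>, so \<open>window_lower_bound\<close> applies on the cube.\<close>
  define \<epsilon> where "\<epsilon> = 1 / (L * norm (One :: 'a))"
  have nOne: "0 < norm (One :: 'a)" by simp
  have \<epsilon>: "0 < \<epsilon>" using L nOne by (simp add: \<epsilon>_def)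
  define vol where "vol = measure lborel (ball (0::'a) \<epsilon>)"
  have vol: "0 < vol" unfolding vol_def using \<epsilon> by (rule content_ball_pos)
  define X where "X = (norm (abs_L2 (window \<epsilon> :: 'a \<Rightarrow> complex)))\<^sup>2"
  define \<eta> where "\<eta> = (vol / 2)\<^sup>2 * L ^ ?n / (2 * (X + 1))"
  have X0: "0 \<le> X" by (simp add: X_def)
  have \<eta>: "0 < \<eta>" using vol Ln X0 by (simp add: \<eta>_def add_nonneg_pos)
  have RS: "0 \<le> R + \<epsilon>" using R \<epsilon> by simp
  show ?thesis
  proof (rule local_mean_square_estimate[OF \<gamma> L RS \<eta>, where 'a='a])
    fix C :: real assume C: "0 \<le> C" "\<And>(w :: 'a L2) q W.
      \<lbrakk>AE \<xi> in lebesgue. norm \<xi> > R + \<epsilon> \<longrightarrow> fhat w \<xi> = 0; W \<in> sets borel;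
       \<gamma> * L ^ DIM('a) \<le> measure lborel (W \<inter> cbox q (q + L *\<^sub>R One))\<rbrakk> \<Longrightarrow>
       (\<integral>\<^sup>+x. indicator (cbox q (q + L *\<^sub>R One)) x * ennreal ((cmod (rep_L2 w x))\<^sup>2) \<partial>lebesgue) \<le>
       ennreal C * (\<integral>\<^sup>+x. indicator (W \<inter> cbox q (q + L *\<^sub>R One)) x * ennreal ((cmod (rep_L2 w x))\<^sup>2) \<partial>lebesgue) + ennreal (\<eta> * (norm w)\<^sup>2)"
    define c where "c = (vol / 2)\<^sup>2 / (2 * (C * vol\<^sup>2 + 1))"
    have den: "0 < C * vol\<^sup>2 + 1" using C(1) by (simp add: add_nonneg_pos)
    have c: "0 < c" using vol den by (simp add: c_def)
    show thesis
    proof (rule that[OF c])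
      fix u :: "'a L2" assume u: "AE \<xi> in lebesgue. norm \<xi> > R \<longrightarrow> fhat u \<xi> = 0"
      define f where "f = borel_rep u"
      have f [measurable]: "f \<in> borel_measurable borel" by (simp add: f_def)
      have fs: "sq_integrable f" and uf: "abs_L2 f = u" by (simp_all add: f_def sq_integrable_borel_rep abs_borel_rep)
      define g where "g x = ennreal ((cmod (f x))\<^sup>2)" for x
      have g [measurable]: "g \<in> borel_measurable borel" unfolding g_def by measurable
      define K where "K = cbox (0::'a) (L *\<^sub>R One)"
      have K [measurable]: "K \<in> sets borel" by (simp add: K_def)
      have Kq: "indicator (cbox q (q + L *\<^sub>R One)) x = (indicator K (x - q) :: ennreal)" for x q :: 'a
        by (auto simp: indicator_def K_def mem_box inner_diff_left inner_add_left algebra_simps)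
      have Kx: "cmod (window \<epsilon> x) \<ge> vol / 2" if "x \<in> K" for x :: 'a
        unfolding vol_def
      proof (rule window_lower_bound)
        have "norm x \<le> norm (L *\<^sub>R One :: 'a)"
          using that L by (intro norm_le_componentwise) (auto simp: K_def mem_box)
        then have "norm x \<le> L * norm (One :: 'a)" using L by simp
        then have "norm x * \<epsilon> \<le> (L * norm (One :: 'a)) * \<epsilon>" using \<epsilon> by (intro mult_right_mono) auto
        then show "norm x * \<epsilon> \<le> 1" using L nOne by (simp add: \<epsilon>_def)
      qed
      have pw: "(\<integral>\<^sup>+x. ennreal ((vol / 2)\<^sup>2) * (indicator K (x - y) * g x) \<partial>lborel) \<le>
         ennreal (C * vol\<^sup>2) * (\<integral>\<^sup>+x. indicator K (x - y) * (indicator W x * g x) \<partial>lborel)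
         + ennreal \<eta> * (\<integral>\<^sup>+x. ennreal ((cmod (window \<epsilon> (x - y)))\<^sup>2) * g x \<partial>lborel)" for y :: 'a
      proof -
        let ?v = "\<lambda>x. window \<epsilon> (x - y) * f x"
        note wb = windowed_band_limited[OF f fs, of R \<epsilon> y, unfolded uf, OF u]
        let ?w = "abs_L2 ?v"
        have sq: "AE x in lebesgue. ennreal ((cmod (rep_L2 ?w x))\<^sup>2) = ennreal ((cmod (window \<epsilon> (x - y)))\<^sup>2) * g x"
          using rep_abs_L2[OF wb(1)] by eventually_elim (simp add: g_def norm_mult power_mult_distrib ennreal_mult)
        have ind: "(\<integral>\<^sup>+x. h x * ennreal ((cmod (rep_L2 ?w x))\<^sup>2) \<partial>lebesgue) = (\<integral>\<^sup>+x. h x * (ennreal ((cmod (window \<epsilon> (x - y)))\<^sup>2) * g x) \<partial>lborel)" for h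
          unfolding nn_integral_lebesgue_eq[symmetric] by (rule nn_integral_cong_AE, use sq in eventually_elim) simp
        have nw: "ennreal (\<eta> * (norm ?w)\<^sup>2) = ennreal \<eta> * (\<integral>\<^sup>+x. ennreal ((cmod (window \<epsilon> (x - y)))\<^sup>2) * g x \<partial>lborel)"
          using \<eta> ind[of "\<lambda>_. 1"] by (simp add: ennreal_mult norm_L2_nn)
        have "(\<integral>\<^sup>+x. ennreal ((vol / 2)\<^sup>2) * (indicator K (x - y) * g x) \<partial>lborel) \<le> (\<integral>\<^sup>+x. indicator K (x - y) * (ennreal ((cmod (window \<epsilon> (x - y)))\<^sup>2) * g x) \<partial>lborel)"
        proof (rule nn_integral_mono)
          fix x :: 'a
          show "ennreal ((vol / 2)\<^sup>2) * (indicator K (x - y) * g x) \<le> indicator K (x - y) * (ennreal ((cmod (window \<epsilon> (x - y)))\<^sup>2) * g x)"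
          proof (cases "x - y \<in> K")
            case True
            then have "(vol / 2)\<^sup>2 \<le> (cmod (window \<epsilon> (x - y)))\<^sup>2" using vol by (intro power_mono Kx) auto
            then have "ennreal ((vol / 2)\<^sup>2) * g x \<le> ennreal ((cmod (window \<epsilon> (x - y)))\<^sup>2) * g x" by (intro mult_right_mono ennreal_leI) auto
            then show ?thesis using True by simp
          qed simp
        qed
        also have "\<dots> = (\<integral>\<^sup>+x. indicator (cbox y (y + L *\<^sub>R One)) x * ennreal ((cmod (rep_L2 ?w x))\<^sup>2) \<partial>lebesgue)"
          unfolding ind Kq ..
        also have "\<dots> \<le> ennreal C * (\<integral>\<^sup>+x. indicator (W \<inter> cbox y (y + L *\<^sub>R One)) x * ennreal ((cmod (rep_L2 ?w x))\<^sup>2) \<partial>lebesgue) + ennreal (\<eta> * (norm ?w)\<^sup>2)"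
          by (rule C(2)[OF wb(2) W thick])
        also have "(\<integral>\<^sup>+x. indicator (W \<inter> cbox y (y + L *\<^sub>R One)) x * ennreal ((cmod (rep_L2 ?w x))\<^sup>2) \<partial>lebesgue) \<le> ennreal (vol\<^sup>2) * (\<integral>\<^sup>+x. indicator K (x - y) * (indicator W x * g x) \<partial>lborel)"
        proof -
          have "(\<integral>\<^sup>+x. indicator (W \<inter> cbox y (y + L *\<^sub>R One)) x * ennreal ((cmod (rep_L2 ?w x))\<^sup>2) \<partial>lebesgue) \<le> (\<integral>\<^sup>+x. ennreal (vol\<^sup>2) * (indicator K (x - y) * (indicator W x * g x)) \<partial>lborel)"
            unfolding ind
          proof (rule nn_integral_mono)
            fix x :: 'a
            have "ennreal ((cmod (window \<epsilon> (x - y)))\<^sup>2) * g x \<le> ennreal (vol\<^sup>2) * g x"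
              using window_bound[of \<epsilon> "x - y"] by (intro mult_right_mono ennreal_leI power_mono) (auto simp: vol_def)
            then show "indicator (W \<inter> cbox y (y + L *\<^sub>R One)) x * (ennreal ((cmod (window \<epsilon> (x - y)))\<^sup>2) * g x) \<le> ennreal (vol\<^sup>2) * (indicator K (x - y) * (indicator W x * g x))"
              unfolding indicator_inter_arith Kq by (auto simp: indicator_def)
          qed
          then show ?thesis by (simp add: nn_integral_cmult)
        qed
        finally show ?thesis unfolding nw using C(1)
          by (simp add: ennreal_mult mult.assoc add_right_mono mult_left_mono)
      qed
      have swap: "(\<integral>\<^sup>+y. \<integral>\<^sup>+x. k (x - y) * h x \<partial>lborel \<partial>lborel) = (\<integral>\<^sup>+z. k z \<partial>lborel) * (\<integral>\<^sup>+x. h x \<partial>lborel)"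
        if [measurable]: "h \<in> borel_measurable borel" "k \<in> borel_measurable borel" for h k :: "'a \<Rightarrow> ennreal"
      proof -
        have "(\<integral>\<^sup>+y. \<integral>\<^sup>+x. k (x - y) * h x \<partial>lborel \<partial>lborel) = (\<integral>\<^sup>+x. \<integral>\<^sup>+y. k (x - y) * h x \<partial>lborel \<partial>lborel)"
          by (rule lborel_pair.Fubini') measurable
        also have "\<dots> = (\<integral>\<^sup>+x. (\<integral>\<^sup>+z. k z \<partial>lborel) * h x \<partial>lborel)"
        proof (rule nn_integral_cong)
          fix x :: 'a
          have "(\<integral>\<^sup>+y. k (x - y) \<partial>lborel) = (\<integral>\<^sup>+z. k z \<partial>lborel)"
            by (subst (2) lborel_affine'[of "-1" x]) (auto simp: nn_integral_density nn_integral_distr)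
          then show "(\<integral>\<^sup>+y. k (x - y) * h x \<partial>lborel) = (\<integral>\<^sup>+z. k z \<partial>lborel) * h x"
            by (simp add: nn_integral_multc)
        qed
        also have "\<dots> = (\<integral>\<^sup>+z. k z \<partial>lborel) * (\<integral>\<^sup>+x. h x \<partial>lborel)" by (simp add: nn_integral_cmult)
        finally show ?thesis .
      qed
      have Kvol: "(\<integral>\<^sup>+z. indicator K z \<partial>lborel) = ennreal (L ^ ?n)"
        using L by (simp add: K_def emeasure_lborel_cbox_eq)
      have Xw: "(\<integral>\<^sup>+z. ennreal ((cmod (window \<epsilon> (z::'a)))\<^sup>2) \<partial>lborel) = ennreal X"
        unfolding X_def norm_L2_nn nn_integral_lebesgue_eq[symmetric]
        by (rule nn_integral_cong_AE, use rep_abs_L2[OF sq_integrable_window[of \<epsilon>, where 'a='a]] in eventually_elim) simp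
      have nu: "(\<integral>\<^sup>+x. g x \<partial>lborel) = ennreal ((norm u)\<^sup>2)"
        unfolding norm_L2_nn nn_integral_lebesgue_eq[symmetric] g_def f_def
        by (rule nn_integral_cong_AE, use borel_rep_AE[of u] in eventually_elim) simp
      have nWu: "(\<integral>\<^sup>+x. indicator W x * g x \<partial>lborel) = ennreal ((norm (mult_indicator W u))\<^sup>2)"
      proof -
        have "W \<in> sets lebesgue" using W by simp
        show ?thesis
          unfolding norm_L2_nn nn_integral_lebesgue_eq[symmetric] g_def f_def
          by (intro nn_integral_cong_AE, use borel_rep_AE[of u] rep_mult_indicator[of W u, OF \<open>W \<in> sets lebesgue\<close>] in eventually_elim) (auto simp: indicator_def)
      qed
      have "ennreal ((vol / 2)\<^sup>2) * (ennreal (L ^ ?n) * ennreal ((norm u)\<^sup>2)) = (\<integral>\<^sup>+y. \<integral>\<^sup>+x. ennreal ((vol / 2)\<^sup>2) * (indicator K (x - y) * g x) \<partial>lborel \<partial>lborel)"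
        unfolding Kvol[symmetric] nu[symmetric] by (subst swap[symmetric]) (auto simp: nn_integral_cmult)
      also have "\<dots> \<le> (\<integral>\<^sup>+y. ennreal (C * vol\<^sup>2) * (\<integral>\<^sup>+x. indicator K (x - y) * (indicator W x * g x) \<partial>lborel)
         + ennreal \<eta> * (\<integral>\<^sup>+x. ennreal ((cmod (window \<epsilon> (x - y)))\<^sup>2) * g x \<partial>lborel) \<partial>lborel)"
        by (rule nn_integral_mono) (rule pw)
      also have "\<dots> = ennreal (C * vol\<^sup>2) * (\<integral>\<^sup>+y. \<integral>\<^sup>+x. indicator K (x - y) * (indicator W x * g x) \<partial>lborel \<partial>lborel)
         + ennreal \<eta> * (\<integral>\<^sup>+y. \<integral>\<^sup>+x. ennreal ((cmod (window \<epsilon> (x - y)))\<^sup>2) * g x \<partial>lborel \<partial>lborel)"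
        by (subst nn_integral_add) (auto simp: nn_integral_cmult)
      also have "\<dots> = ennreal (C * vol\<^sup>2) * (ennreal (L ^ ?n) * ennreal ((norm (mult_indicator W u))\<^sup>2)) + ennreal \<eta> * (ennreal X * ennreal ((norm u)\<^sup>2))"
        by (subst swap, measurable, subst swap[of g "\<lambda>z. ennreal ((cmod (window \<epsilon> z))\<^sup>2)"], measurable) (simp add: Kvol Xw nu nWu)
      finally have "ennreal ((vol / 2)\<^sup>2 * (L ^ ?n * (norm u)\<^sup>2)) \<le> ennreal ((C * vol\<^sup>2) * (L ^ ?n * (norm (mult_indicator W u))\<^sup>2) + \<eta> * (X * (norm u)\<^sup>2))"
        using C(1) Ln \<eta> X0 by (simp add: ennreal_mult ennreal_plus)
      then have 1: "(vol / 2)\<^sup>2 * (L ^ ?n * (norm u)\<^sup>2) \<le> (C * vol\<^sup>2) * (L ^ ?n * (norm (mult_indicator W u))\<^sup>2) + \<eta> * (X * (norm u)\<^sup>2)"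
        using C(1) Ln \<eta> X0 by (subst (asm) ennreal_le_iff) auto
      have "\<eta> * (X * (norm u)\<^sup>2) = (vol / 2)\<^sup>2 * L ^ ?n * (norm u)\<^sup>2 / 2 * (X / (X + 1))"
        unfolding \<eta>_def by (simp add: field_simps)
      also have "\<dots> \<le> (vol / 2)\<^sup>2 * L ^ ?n * (norm u)\<^sup>2 / 2 * 1"
        using X0 Ln by (intro mult_left_mono) (auto simp: divide_le_eq_1)
      finally have "(vol / 2)\<^sup>2 * L ^ ?n * (norm u)\<^sup>2 / 2 \<le> (C * vol\<^sup>2) * (L ^ ?n * (norm (mult_indicator W u))\<^sup>2)"
        using 1 by (simp add: mult.assoc)
      then have "L ^ ?n * ((vol / 2)\<^sup>2 * (norm u)\<^sup>2 / 2) \<le> L ^ ?n * (C * vol\<^sup>2 * (norm (mult_indicator W u))\<^sup>2)"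
        by (simp add: mult_ac)
      then have "(vol / 2)\<^sup>2 * (norm u)\<^sup>2 / 2 \<le> C * vol\<^sup>2 * (norm (mult_indicator W u))\<^sup>2"
        using Ln by (simp only: mult_le_cancel_left_pos)
      also have "\<dots> \<le> (C * vol\<^sup>2 + 1) * (norm (mult_indicator W u))\<^sup>2" by (intro mult_right_mono) auto
      finally show "c * (norm u)\<^sup>2 \<le> (norm (mult_indicator W u))\<^sup>2"
        using den unfolding c_def by (simp add: divide_le_eq algebra_simps)
    qed
  qed
qed

section \<open>Bounded operators commuting with complex scalars\<close>
lemma L2_operatorsI:
  assumes "\<And>u v. B (u + v) = B u + B v" "\<And>c u. B (scaleC_L2 c u) = scaleC_L2 c (B u)" "\<And>u. norm (B u) \<le> K * norm u"
  shows "B \<in> L2_operators"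
  unfolding L2_operators_def
proof (intro CollectI conjI allI)
  show "bounded_linear B"
    by (rule bounded_linear_intro[where K=K])
       (use assms(1) assms(2)[of "complex_of_real _"] assms(3) in \<open>auto simp: scaleC_L2_of_real mult.commute\<close>)
qed (rule assms(2))

lemma L2_operatorsD:
  assumes "B \<in> L2_operators"
  shows "bounded_linear B" "B (scaleC_L2 c u) = scaleC_L2 c (B u)" "B (u + v) = B u + B v" "B (u - v) = B u - B v"
    "B (r *\<^sub>R u) = r *\<^sub>R B u" "B (- u) = - B u" "B 0 = 0"
  using assms by (auto simp: L2_operators_def linear_simps)

lemma L2_operators_bound:
  assumes "B \<in> L2_operators" obtains K where "0 \<le> K" "\<And>u. norm (B u) \<le> K * norm u"
  using bounded_linear.nonneg_bounded[OF L2_operatorsD(1)[OF assms]] by (metis mult.commute)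

lemma L2_operators_comp: "A \<in> L2_operators \<Longrightarrow> B \<in> L2_operators \<Longrightarrow> A \<circ> B \<in> L2_operators"
  unfolding L2_operators_def by (auto simp: o_def intro: bounded_linear_compose)

lemma L2_operators_add: "A \<in> L2_operators \<Longrightarrow> B \<in> L2_operators \<Longrightarrow> (\<lambda>u. A u + B u) \<in> L2_operators"
  unfolding L2_operators_def by (auto simp: scaleC_L2_add intro: bounded_linear_add)

lemma L2_operators_diff: "A \<in> L2_operators \<Longrightarrow> B \<in> L2_operators \<Longrightarrow> (\<lambda>u. A u - B u) \<in> L2_operators"
  unfolding L2_operators_def by (auto simp: scaleC_L2_diff intro: bounded_linear_sub)

lemma L2_operators_id: "(\<lambda>u. u) \<in> L2_operators"
  unfolding L2_operators_def by simp

lemma L2_operators_mult_indicator: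
  assumes "\<omega> \<in> sets lebesgue" shows "mult_indicator \<omega> \<in> L2_operators"
proof (rule L2_operatorsI[where K=1])
  note r = rep_mult_indicator[OF assms]
  show "mult_indicator \<omega> (u + v) = mult_indicator \<omega> u + mult_indicator \<omega> v" for u v
    by (rule L2_eqI, use r[of "u + v"] r[of u] r[of v] rep_L2_add[of u v] rep_L2_add[of "mult_indicator \<omega> u" "mult_indicator \<omega> v"] in eventually_elim)
       (simp add: distrib_left)
  show "mult_indicator \<omega> (scaleC_L2 c u) = scaleC_L2 c (mult_indicator \<omega> u)" for c u
    by (rule L2_eqI, use r[of "scaleC_L2 c u"] r[of u] rep_L2_scaleC[of c u] rep_L2_scaleC[of c "mult_indicator \<omega> u"] in eventually_elim) simp
  show "norm (mult_indicator \<omega> u) \<le> 1 * norm u" for u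
    by (rule norm_L2_le, use r[of u] in eventually_elim) (auto simp: indicator_def)
qed

text \<open>The solution of \<open>x = u + D x\<close> is obtained from the contraction principle; linearity of the
  solution operator follows from uniqueness.\<close>

lemma L2_operators_inverse_perturbation:
  fixes D :: "'a::euclidean_space L2 \<Rightarrow> 'a L2"
  assumes D: "D \<in> L2_operators" and \<rho>: "0 \<le> \<rho>" "\<rho> < 1" and b: "\<And>u. norm (D u) \<le> \<rho> * norm u"
  obtains S where "S \<in> L2_operators" "\<And>u. S u - D (S u) = u"
proof -
  have ex: "\<exists>!x. y + D x = x" for y
  proof -
    have "dist (y + D x) (y + D z) \<le> \<rho> * dist x z" for x z
      using b[of "x - z"] by (simp add: dist_norm L2_operatorsD(4)[OF D])
    then show ?thesis by (intro banach_fix_type[OF \<rho>]) simp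
  qed
  define S where "S y = (THE x. y + D x = x)" for y
  have S: "y + D (S y) = S y" for y unfolding S_def by (rule theI'[OF ex])
  have uniq: "S y = x" if "y + D x = x" for x y using ex[of y] S[of y] that by blast
  have "S \<in> L2_operators"
  proof (rule L2_operatorsI[where K = "1 / (1 - \<rho>)"])
    show "S (u + v) = S u + S v" for u v
    proof (rule uniq)
      show "u + v + D (S u + S v) = S u + S v"
        using S[of u] S[of v] by (simp add: L2_operatorsD(3)[OF D] algebra_simps)
    qed
    show "S (scaleC_L2 c u) = scaleC_L2 c (S u)" for c u
    proof (rule uniq)
      show "scaleC_L2 c u + D (scaleC_L2 c (S u)) = scaleC_L2 c (S u)"
        by (simp add: L2_operatorsD(2)[OF D] S flip: scaleC_L2_add)
    qed
    show "norm (S u) \<le> 1 / (1 - \<rho>) * norm u" for u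
    proof -
      have "norm (S u) \<le> norm u + norm (D (S u))" using norm_triangle_ineq[of u "D (S u)"] by (simp add: S)
      also have "\<dots> \<le> norm u + \<rho> * norm (S u)" using b by simp
      finally have "(1 - \<rho>) * norm (S u) \<le> norm u" by (simp add: algebra_simps)
      then show ?thesis using \<rho> by (simp add: pos_le_divide_eq mult.commute)
    qed
  qed
  moreover have "S u - D (S u) = u" for u using S[of u] by (simp add: algebra_simps)
  ultimately show ?thesis using that by blast
qed

section \<open>Bounded Fourier multipliers\<close>

definition bounded_symbol :: "('a::euclidean_space \<Rightarrow> real) \<Rightarrow> bool" where
  "bounded_symbol m \<longleftrightarrow> m \<in> borel_measurable borel \<and> (\<exists>C. \<forall>\<xi>. \<bar>m \<xi>\<bar> \<le> C)"

definition multiplier_op :: "('a::euclidean_space \<Rightarrow> real) \<Rightarrow> 'a L2 \<Rightarrow> 'a L2" where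
  "multiplier_op m u = inverse_fourier_L2 (abs_L2 (\<lambda>\<xi>. complex_of_real (m \<xi>) * fhat u \<xi>))"

lemma rep_multiplier_op:
  assumes m: "bounded_symbol m"
  shows "AE \<xi> in lebesgue. fhat (multiplier_op m u) \<xi> = complex_of_real (m \<xi>) * fhat u \<xi>"
proof -
  obtain C where C: "\<And>\<xi>. \<bar>m \<xi>\<bar> \<le> C" using m by (auto simp: bounded_symbol_def)
  have [measurable]: "m \<in> borel_measurable lebesgue"
    using m by (intro borel_imp_lebesgue_measurable) (simp add: bounded_symbol_def)
  have "sq_integrable (\<lambda>\<xi>. complex_of_real (m \<xi>) * fhat u \<xi>)"
    by (rule sq_integrable_bound[OF rep_L2_sq_integrable, where c=C])
       (auto simp: norm_mult C intro!: AE_I2 mult_right_mono)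
  from rep_abs_L2[OF this] show ?thesis by (simp add: multiplier_op_def)
qed

lemma fourier_L2_eqI:
  assumes "AE \<xi> in lebesgue. fhat u \<xi> = fhat v \<xi>"
  shows "u = v"
  using L2_eqI[OF assms] by (simp add: fourier_L2_eq_iff)

lemma norm_le_fourier:
  assumes "AE \<xi> in lebesgue. cmod (fhat u \<xi>) \<le> c * cmod (fhat v \<xi>)" "0 \<le> c"
  shows "norm u \<le> c * norm v"
  using norm_L2_le[OF assms] by (simp add: norm_fourier_L2)

lemma norm_multiplier_op_le:
  assumes m: "bounded_symbol m" and C: "\<And>\<xi>. \<bar>m \<xi>\<bar> \<le> C"
  shows "norm (multiplier_op m u) \<le> C * norm u"
proof (rule norm_le_fourier)
  show "0 \<le> C" using C[of 0] by (meson abs_ge_zero order_trans)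
  show "AE \<xi> in lebesgue. cmod (fhat (multiplier_op m u) \<xi>) \<le> C * cmod (fhat u \<xi>)"
    using rep_multiplier_op[OF m, of u] by eventually_elim (auto simp: norm_mult C intro!: mult_right_mono)
qed

lemma L2_operators_multiplier_op:
  assumes m: "bounded_symbol m" shows "multiplier_op m \<in> L2_operators"
proof -
  obtain C where C: "\<And>\<xi>. \<bar>m \<xi>\<bar> \<le> C" using m by (auto simp: bounded_symbol_def)
  note r = rep_multiplier_op[OF m]
  show ?thesis
  proof (rule L2_operatorsI[where K=C])
    show "multiplier_op m (u + v) = multiplier_op m u + multiplier_op m v" for u v
      by (rule fourier_L2_eqI, unfold fourier_L2_add, use r[of "u + v", unfolded fourier_L2_add] r[of u] r[of v] rep_L2_add[of "fourier_L2 u" "fourier_L2 v"]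
          rep_L2_add[of "fourier_L2 (multiplier_op m u)" "fourier_L2 (multiplier_op m v)"] in eventually_elim)
         (simp add: distrib_left)
    show "multiplier_op m (scaleC_L2 c u) = scaleC_L2 c (multiplier_op m u)" for c u
      by (rule fourier_L2_eqI, unfold fourier_L2_scaleC, use r[of "scaleC_L2 c u", unfolded fourier_L2_scaleC] r[of u] rep_L2_scaleC[of c "fourier_L2 u"]
          rep_L2_scaleC[of c "fourier_L2 (multiplier_op m u)"] in eventually_elim) simp
    show "norm (multiplier_op m u) \<le> C * norm u" for u by (rule norm_multiplier_op_le[OF m C])
  qed
qed

lemma fourier_L2_diff: "fourier_L2 (u - v) = fourier_L2 u - fourier_L2 v"
  using bounded_linear_fourier_L2 by (rule linear_simps)

lemma rep_fourier_add: "AE \<xi> in lebesgue. fhat (u + v) \<xi> = fhat u \<xi> + fhat v \<xi>"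
  unfolding fourier_L2_add by (rule rep_L2_add)

lemma rep_fourier_diff: "AE \<xi> in lebesgue. fhat (u - v) \<xi> = fhat u \<xi> - fhat v \<xi>"
  unfolding fourier_L2_diff by (rule rep_L2_diff)

lemma rep_fourier_scaleR: "AE \<xi> in lebesgue. fhat (c *\<^sub>R u) \<xi> = complex_of_real c * fhat u \<xi>"
  unfolding fourier_L2_scaleR by (rule rep_L2_scaleR)

lemma tendsto_fourier_L2_iff: "((\<lambda>i. fourier_L2 (X i)) \<longlongrightarrow> fourier_L2 u) F \<longleftrightarrow> (X \<longlongrightarrow> (u :: 'a::euclidean_space L2)) F"
proof
  assume "(X \<longlongrightarrow> u) F"
  then show "((\<lambda>i. fourier_L2 (X i)) \<longlongrightarrow> fourier_L2 u) F"
    by (rule bounded_linear.tendsto[OF bounded_linear_fourier_L2])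
next
  assume "((\<lambda>i. fourier_L2 (X i)) \<longlongrightarrow> fourier_L2 u) F"
  then have "((\<lambda>i. norm (fourier_L2 (X i) - fourier_L2 u)) \<longlongrightarrow> 0) F"
    by (simp add: LIM_zero_iff tendsto_norm_zero_iff)
  then have "((\<lambda>i. norm (X i - u)) \<longlongrightarrow> 0) F"
    unfolding fourier_L2_diff[symmetric] norm_fourier_L2 by (simp add: tendsto_mult_left_iff[where c = "sqrt ((2 * pi) ^ DIM('a))", of "\<lambda>i. norm (X i - u)" 0, simplified])
  then show "(X \<longlongrightarrow> u) F" by (simp add: LIM_zero_iff tendsto_norm_zero_iff)
qed

section \<open>Multiplier semigroups\<close>

lemma bounded_symbol_exp:
  assumes s: "s \<in> borel_measurable borel" "\<And>\<xi>. 0 \<le> s \<xi>" and t: "0 \<le> t"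
  shows "bounded_symbol (\<lambda>\<xi>. exp (- (t * s \<xi>)))"
  unfolding bounded_symbol_def
proof (intro conjI exI[of _ 1] allI)
  show "(\<lambda>\<xi>. exp (- (t * s \<xi>))) \<in> borel_measurable borel" using s(1) by measurable
  show "\<bar>exp (- (t * s \<xi>))\<bar> \<le> 1" for \<xi> using s(2) t by simp
qed

lemma exp_difference_quotient_bound:
  assumes "0 \<le> a" "0 < (t::real)"
  shows "\<bar>(exp (- (t * a)) - 1) / t\<bar> \<le> a"
proof -
  have "1 - t * a \<le> exp (- (t * a))" using exp_ge_add_one_self[of "- (t * a)"] by simp
  moreover have "exp (- (t * a)) \<le> 1" using assms by simp
  ultimately have "\<bar>exp (- (t * a)) - 1\<bar> \<le> t * a" by simp
  then show ?thesis using assms by (simp add: abs_divide pos_divide_le_eq mult.commute)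
qed

lemma exp_difference_quotient_tendsto:
  fixes X :: "nat \<Rightarrow> real"
  assumes "X \<longlonglongrightarrow> 0" "\<And>i. X i \<noteq> 0"
  shows "(\<lambda>i. (exp (- (X i * a)) - 1) / X i) \<longlonglongrightarrow> - a"
proof -
  have "((\<lambda>t. exp (- (t * a))) has_real_derivative - a) (at 0)"
    by (auto intro!: derivative_eq_intros)
  then have "((\<lambda>t. (exp (- (t * a)) - 1) / t) \<longlongrightarrow> - a) (at 0)"
    by (simp add: has_field_derivative_iff)
  then show ?thesis
    using assms by (auto simp: tendsto_at_iff_sequentially o_def)
qed

context
  fixes s :: "'a::euclidean_space \<Rightarrow> real"
  assumes s [measurable]: "s \<in> borel_measurable borel" and s0: "\<And>\<xi>. 0 \<le> s \<xi>"
begin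

definition multiplier_semigroup :: "real \<Rightarrow> 'a L2 \<Rightarrow> 'a L2" where
  "multiplier_semigroup t = multiplier_op (\<lambda>\<xi>. exp (- (t * s \<xi>)))"

lemma rep_multiplier_semigroup:
  assumes "0 \<le> t"
  shows "AE \<xi> in lebesgue. fhat (multiplier_semigroup t u) \<xi> = complex_of_real (exp (- (t * s \<xi>))) * fhat u \<xi>"
  unfolding multiplier_semigroup_def by (rule rep_multiplier_op[OF bounded_symbol_exp[OF s s0 assms]])

lemma multiplier_semigroup_operator: "0 \<le> t \<Longrightarrow> multiplier_semigroup t \<in> L2_operators"
  unfolding multiplier_semigroup_def by (rule L2_operators_multiplier_op[OF bounded_symbol_exp[OF s s0]])

lemma multiplier_semigroup_zero: "multiplier_semigroup 0 u = u"
  by (rule fourier_L2_eqI, use rep_multiplier_semigroup[OF order_refl, of u] in eventually_elim) simp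

lemma multiplier_semigroup_add:
  assumes "0 \<le> r" "0 \<le> t" shows "multiplier_semigroup (r + t) u = multiplier_semigroup r (multiplier_semigroup t u)"
  by (rule fourier_L2_eqI, use rep_multiplier_semigroup[OF add_nonneg_nonneg[OF assms], of u] rep_multiplier_semigroup[OF assms(2), of u]
      rep_multiplier_semigroup[OF assms(1), of "multiplier_semigroup t u"] in eventually_elim)
     (simp add: distrib_right exp_add[symmetric] flip: of_real_mult mult.assoc)

lemma multiplier_semigroup_tendsto: "((\<lambda>t. multiplier_semigroup t u) \<longlongrightarrow> u) (at_right 0)"
  unfolding tendsto_fourier_L2_iff[symmetric, of _ u] tendsto_at_iff_sequentially o_def
proof (intro allI impI)
  fix X :: "nat \<Rightarrow> real" assume "\<forall>i. X i \<in> {0<..} - {0}" and X0: "X \<longlonglongrightarrow> 0"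
  then have X: "0 \<le> X i" for i by (simp add: less_imp_le)
  show "(\<lambda>i. fourier_L2 (multiplier_semigroup (X i) u)) \<longlonglongrightarrow> fourier_L2 u"
  proof (rule L2_dominated_convergence[where c=1 and w="fourier_L2 u"])
    have a: "AE \<xi> in lebesgue. \<forall>i. fhat (multiplier_semigroup (X i) u) \<xi> = complex_of_real (exp (- (X i * s \<xi>))) * fhat u \<xi>"
      unfolding AE_all_countable using rep_multiplier_semigroup[OF X] by blast
    then show "AE \<xi> in lebesgue. (\<lambda>i. fhat (multiplier_semigroup (X i) u) \<xi>) \<longlonglongrightarrow> fhat u \<xi>"
    proof eventually_elim
      case (elim \<xi>)
      have "(\<lambda>i. complex_of_real (exp (- (X i * s \<xi>))) * fhat u \<xi>) \<longlonglongrightarrow> complex_of_real (exp (- (0 * s \<xi>))) * fhat u \<xi>"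
        by (intro tendsto_intros X0)
      then show ?case using elim by simp
    qed
    show "AE \<xi> in lebesgue. cmod (fhat (multiplier_semigroup (X i) u) \<xi> - fhat u \<xi>) \<le> 1 * cmod (fhat u \<xi>)" for i
      using a
    proof eventually_elim
      case (elim \<xi>)
      have "fhat (multiplier_semigroup (X i) u) \<xi> - fhat u \<xi> = complex_of_real (exp (- (X i * s \<xi>)) - 1) * fhat u \<xi>"
        using elim by (simp add: algebra_simps)
      moreover have "\<bar>exp (- (X i * s \<xi>)) - 1\<bar> \<le> 1" using X[of i] s0[of \<xi>] by (simp add: abs_le_iff)
      ultimately show ?case by (simp only: norm_mult norm_of_real) (rule mult_right_mono, auto)
    qed
  qed
qed

lemma rep_difference_quotient:
  assumes "0 < t"
  shows "AE \<xi> in lebesgue. fhat ((multiplier_semigroup t u - u) /\<^sub>R t) \<xi> = complex_of_real ((exp (- (t * s \<xi>)) - 1) / t) * fhat u \<xi>"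
  using rep_fourier_scaleR[of "inverse t" "multiplier_semigroup t u - u"] rep_fourier_diff[of "multiplier_semigroup t u" u]
    rep_multiplier_semigroup[OF less_imp_le[OF assms], of u]
  by eventually_elim (simp add: field_simps)

text \<open>The difference quotients of \<open>t \<mapsto> exp (- (t * s))\<close> are bounded by \<open>s\<close>. So if \<open>s\<close> times the
  transform of \<open>u\<close> is square integrable, they converge in mean by dominated convergence.
  Conversely, a limit in mean is almost everywhere the pointwise limit of a subsequence.\<close>
lemma multiplier_semigroup_generator:
  "((\<lambda>t. (multiplier_semigroup t u - u) /\<^sub>R t) \<longlongrightarrow> v) (at_right 0) \<longleftrightarrow>
   (AE \<xi> in lebesgue. fhat v \<xi> = - complex_of_real (s \<xi>) * fhat u \<xi>)"
proof
  assume v: "AE \<xi> in lebesgue. fhat v \<xi> = - complex_of_real (s \<xi>) * fhat u \<xi>"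
  show "((\<lambda>t. (multiplier_semigroup t u - u) /\<^sub>R t) \<longlongrightarrow> v) (at_right 0)"
    unfolding tendsto_fourier_L2_iff[symmetric, of _ v] tendsto_at_iff_sequentially o_def
  proof (intro allI impI)
    fix X :: "nat \<Rightarrow> real" assume *: "\<forall>i. X i \<in> {0<..} - {0}" and X0: "X \<longlonglongrightarrow> 0"
    then have X: "0 < X i" for i by simp
    have Xne: "X i \<noteq> 0" for i using X[of i] by simp
    show "(\<lambda>i. fourier_L2 ((multiplier_semigroup (X i) u - u) /\<^sub>R X i)) \<longlonglongrightarrow> fourier_L2 v"
    proof (rule L2_dominated_convergence[where c=2 and w="fourier_L2 v"])
      have a: "AE \<xi> in lebesgue. \<forall>i. fhat ((multiplier_semigroup (X i) u - u) /\<^sub>R X i) \<xi> = complex_of_real ((exp (- (X i * s \<xi>)) - 1) / X i) * fhat u \<xi>"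
        unfolding AE_all_countable using rep_difference_quotient[OF X] by blast
      then show "AE \<xi> in lebesgue. (\<lambda>i. fhat ((multiplier_semigroup (X i) u - u) /\<^sub>R X i) \<xi>) \<longlonglongrightarrow> fhat v \<xi>"
        using v
      proof eventually_elim
        case (elim \<xi>)
        have "(\<lambda>i. complex_of_real ((exp (- (X i * s \<xi>)) - 1) / X i) * fhat u \<xi>) \<longlonglongrightarrow> complex_of_real (- s \<xi>) * fhat u \<xi>"
          by (intro tendsto_mult tendsto_of_real tendsto_const exp_difference_quotient_tendsto X0 Xne)
        then show ?case using elim by simp
      qed
      show "AE \<xi> in lebesgue. cmod (fhat ((multiplier_semigroup (X i) u - u) /\<^sub>R X i) \<xi> - fhat v \<xi>) \<le> 2 * cmod (fhat v \<xi>)" for i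
        using a v
      proof eventually_elim
        case (elim \<xi>)
        have "cmod (fhat ((multiplier_semigroup (X i) u - u) /\<^sub>R X i) \<xi>) \<le> s \<xi> * cmod (fhat u \<xi>)"
          unfolding elim(1)[rule_format] norm_mult norm_of_real by (intro mult_right_mono exp_difference_quotient_bound s0 X) auto
        also have "\<dots> = cmod (fhat v \<xi>)" unfolding elim(2) using s0[of \<xi>] by (simp add: norm_mult)
        finally show ?case using norm_triangle_ineq4[of "fhat ((multiplier_semigroup (X i) u - u) /\<^sub>R X i) \<xi>" "fhat v \<xi>"] by linarith
      qed
    qed
  qed
next
  assume lim: "((\<lambda>t. (multiplier_semigroup t u - u) /\<^sub>R t) \<longlongrightarrow> v) (at_right 0)"
  define X where "X i = inverse (real (Suc i))" for i
  have X: "0 < X i" for i by (simp add: X_def)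
  have X0: "X \<longlonglongrightarrow> 0" unfolding X_def by (rule LIMSEQ_inverse_real_of_nat)
  have "(\<lambda>i. fourier_L2 ((multiplier_semigroup (X i) u - u) /\<^sub>R X i)) \<longlonglongrightarrow> fourier_L2 v"
    using lim X X0 unfolding tendsto_fourier_L2_iff tendsto_at_iff_sequentially o_def by (auto simp: less_le)
  from L2_tendsto_AE_subseq[OF this] obtain r where r: "strict_mono r"
    "AE \<xi> in lebesgue. (\<lambda>i. fhat ((multiplier_semigroup (X (r i)) u - u) /\<^sub>R X (r i)) \<xi>) \<longlonglongrightarrow> fhat v \<xi>" .
  have a: "AE \<xi> in lebesgue. \<forall>i. fhat ((multiplier_semigroup (X (r i)) u - u) /\<^sub>R X (r i)) \<xi> = complex_of_real ((exp (- (X (r i) * s \<xi>)) - 1) / X (r i)) * fhat u \<xi>"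
    unfolding AE_all_countable using rep_difference_quotient[OF X] by blast
  show "AE \<xi> in lebesgue. fhat v \<xi> = - complex_of_real (s \<xi>) * fhat u \<xi>"
    using r(2) a
  proof eventually_elim
    case (elim \<xi>)
    have Xr: "(\<lambda>i. X (r i)) \<longlonglongrightarrow> 0" using LIMSEQ_subseq_LIMSEQ[OF X0 r(1)] by (simp add: o_def)
    have "(\<lambda>i. complex_of_real ((exp (- (X (r i) * s \<xi>)) - 1) / X (r i)) * fhat u \<xi>) \<longlonglongrightarrow> complex_of_real (- s \<xi>) * fhat u \<xi>"
      by (intro tendsto_mult tendsto_of_real tendsto_const exp_difference_quotient_tendsto Xr) (simp add: X_def)
    moreover have "(\<lambda>i. complex_of_real ((exp (- (X (r i) * s \<xi>)) - 1) / X (r i)) * fhat u \<xi>) \<longlonglongrightarrow> fhat v \<xi>"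
      using elim by simp
    ultimately show ?case using LIMSEQ_unique by fastforce
  qed
qed

end

section \<open>A feedback for thick control supports\<close>

text \<open>The operators are \<open>P\<close> (projection onto \<open>|\<xi>| \<le> R\<close>), \<open>I = 1\<^sub>\<omega>\<close>, \<open>K = S (\<mu> - A) P\<close> with \<open>S\<close> the
  inverse of \<open>1 - D\<close>, \<open>D = P (1 - 1\<^sub>\<omega>) P\<close>, and \<open>Z = 1\<^sub>\<omega> K\<close>. The hypothesis makes \<open>D\<close> a
  strict contraction, and on the range of \<open>P\<close> the operators \<open>1 - D\<close> and \<open>P 1\<^sub>\<omega>\<close> coincide.
  The semigroup is \<open>Yi E Y\<close> where \<open>E\<close> is the multiplier semigroup with symbol \<open>s\<close>, equal to
  \<open>\<mu>\<close> on low and to \<open>F\<close> on high frequencies, \<open>Y = 1 + G\<close> and \<open>Yi = 1 - G\<close>.\<close>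
theorem stabilizable_if_low_frequencies_observable:
  fixes \<omega> :: "'a::euclidean_space set" and F :: "real \<Rightarrow> real"
  assumes F: "continuous_on {0..} F" and \<omega>: "\<omega> \<in> sets lebesgue" and \<mu>: "0 < \<mu>" and R: "0 \<le> R"
    and high: "\<And>r. r > R \<Longrightarrow> 2 * \<mu> \<le> F r" and c: "0 < c"
    and obs: "\<And>u :: 'a L2. (AE \<xi> in lebesgue. norm \<xi> > R \<longrightarrow> fhat u \<xi> = 0) \<Longrightarrow> c * (norm u)\<^sup>2 \<le> (norm (mult_indicator \<omega> u))\<^sup>2"
  shows "exp_stabilizable_at_rate F \<omega> \<mu>"
proof -
  have Fm [measurable]: "(\<lambda>\<xi>::'a. F (norm \<xi>)) \<in> borel_measurable borel"
    by (intro borel_measurable_continuous_onI continuous_on_compose2[OF F]) (auto intro: continuous_intros)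
  obtain CF where CF: "\<And>r. 0 \<le> r \<Longrightarrow> r \<le> R \<Longrightarrow> \<bar>F r\<bar> \<le> CF"
  proof -
    have "compact (F ` {0..R})" by (intro compact_continuous_image continuous_on_subset[OF F]) auto
    then have "bounded (F ` {0..R})" by (rule compact_imp_bounded)
    then obtain a where "\<forall>x\<in>{0..R}. \<bar>F x\<bar> \<le> a" unfolding bounded_iff by auto
    then show thesis by (intro that[of a]) auto
  qed
  define low :: "'a \<Rightarrow> real" where "low \<xi> = (if norm \<xi> \<le> R then 1 else 0)" for \<xi>
  have low: "bounded_symbol low" unfolding bounded_symbol_def low_def by (auto intro!: exI[of _ 1])
  have [measurable]: "low \<in> borel_measurable borel" using low by (simp add: bounded_symbol_def)
  define P where "P = multiplier_op low"
  note rP = rep_multiplier_op[OF low, folded P_def]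
  have P: "P \<in> L2_operators" unfolding P_def by (rule L2_operators_multiplier_op[OF low])
  have nP: "norm (P u) \<le> norm u" for u
    using norm_multiplier_op_le[OF low, of 1 u] by (simp add: P_def low_def)
  define I where "I = mult_indicator \<omega>"
  have I: "I \<in> L2_operators" unfolding I_def by (rule L2_operators_mult_indicator[OF \<omega>])
  define D where "D u = P (P u - I (P u))" for u
  have Dop: "D \<in> L2_operators"
    using L2_operators_comp[OF P L2_operators_diff[OF P L2_operators_comp[OF I P]]] by (simp add: D_def[abs_def] o_def)
  define c' where "c' = min c 1"
  have c': "0 < c'" "c' \<le> 1" "c' \<le> c" using c by (auto simp: c'_def)
  have pyth: "(norm (v - I v))\<^sup>2 = (norm v)\<^sup>2 - (norm (I v))\<^sup>2" for v
  proof -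
    have "I v \<bullet> v = I v \<bullet> I v"
      unfolding inner_L2_eq I_def
      by (rule integral_cong_AE, measurable, use rep_mult_indicator[OF \<omega>, of v] in eventually_elim) (auto simp: indicator_def)
    then show ?thesis by (simp add: power2_norm_eq_inner inner_diff_left inner_diff_right inner_commute)
  qed
  have nD: "norm (D u) \<le> sqrt (1 - c') * norm u" for u
  proof -
    have Psupp: "AE \<xi> in lebesgue. norm \<xi> > R \<longrightarrow> fhat (P u) \<xi> = 0"
      using rP[of u] by eventually_elim (simp add: low_def)
    have "c' * (norm (P u))\<^sup>2 \<le> c * (norm (P u))\<^sup>2" by (rule mult_right_mono[OF c'(3)]) simp
    also have "\<dots> \<le> (norm (I (P u)))\<^sup>2" unfolding I_def by (rule obs[OF Psupp])
    finally have "(norm (P u - I (P u)))\<^sup>2 \<le> (1 - c') * (norm (P u))\<^sup>2"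
      unfolding pyth by (simp add: algebra_simps)
    also have "\<dots> \<le> (1 - c') * (norm u)\<^sup>2" using c' nP[of u] by (intro mult_left_mono power_mono) auto
    finally have "sqrt ((norm (P u - I (P u)))\<^sup>2) \<le> sqrt ((1 - c') * (norm u)\<^sup>2)" by (rule real_sqrt_le_mono)
    then have "norm (P u - I (P u)) \<le> sqrt (1 - c') * norm u" by (simp add: real_sqrt_mult)
    then show ?thesis unfolding D_def using nP[of "P u - I (P u)"] by linarith
  qed
  obtain S where S: "S \<in> L2_operators" "\<And>u. S u - D (S u) = u"
    using L2_operators_inverse_perturbation[OF Dop _ _ nD] c' by auto
  define kq where "kq \<xi> = low \<xi> * (\<mu> - F (norm \<xi>))" for \<xi>
  have kq: "bounded_symbol kq"
    unfolding bounded_symbol_def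
  proof (intro conjI exI[of _ "\<mu> + CF"] allI)
    show "kq \<in> borel_measurable borel" unfolding kq_def by measurable
    have "0 \<le> CF" using CF[of 0] R by (meson abs_ge_zero order_refl order_trans)
    then show "\<bar>kq \<xi>\<bar> \<le> \<mu> + CF" for \<xi>
      using CF[of "norm \<xi>"] \<mu> by (auto simp: kq_def low_def)
  qed
  note rkq = rep_multiplier_op[OF kq]
  define K where "K = S \<circ> multiplier_op kq"
  have K: "K \<in> L2_operators" unfolding K_def by (rule L2_operators_comp[OF S(1) L2_operators_multiplier_op[OF kq]])
  define Z where "Z = I \<circ> K"
  have Z: "Z \<in> L2_operators" unfolding Z_def by (rule L2_operators_comp[OF I K])
  have PZ: "P (Z u) = multiplier_op kq u" for u
  proof -
    define y where "y = multiplier_op kq u"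
    define x where "x = K u"
    have PP: "P (P v) = P v" for v
      by (rule fourier_L2_eqI, use rP[of v] rP[of "P v"] in eventually_elim) (simp add: low_def)
    have Py: "P y = y"
      unfolding y_def by (rule fourier_L2_eqI, use rkq[of u] rP[of "multiplier_op kq u"] in eventually_elim) (simp add: low_def kq_def)
    have xD: "x - D x = y" using S(2)[of y] by (simp add: x_def y_def K_def)
    then have "x = y + D x" by (simp add: algebra_simps)
    moreover have "P (y + D x) = y + D x" by (simp add: L2_operatorsD(3)[OF P] Py D_def PP)
    ultimately have Px: "P x = x" by metis
    have "D x = x - P (I x)" by (simp add: D_def Px L2_operatorsD(4)[OF P])
    with xD show ?thesis by (simp add: Z_def x_def y_def)
  qed
  have Zlow: "AE \<xi> in lebesgue. norm \<xi> \<le> R \<longrightarrow> fhat (Z u) \<xi> = complex_of_real (\<mu> - F (norm \<xi>)) * fhat u \<xi>" for u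
    using rP[of "Z u", unfolded PZ] rkq[of u] by eventually_elim (auto simp: low_def kq_def)
  \<comment> \<open>The symbol of \<open>(A - \<mu>)\<^sup>-\<^sup>1\<close> on the high frequencies, where \<open>F - \<mu> \<ge> \<mu>\<close>.\<close>
  define gs where "gs \<xi> = (1 - low \<xi>) / (F (norm \<xi>) - \<mu>)" for \<xi>
  have gs: "bounded_symbol gs"
    unfolding bounded_symbol_def
  proof (intro conjI exI[of _ "1 / \<mu>"] allI)
    show "gs \<in> borel_measurable borel" unfolding gs_def by measurable
    show "\<bar>gs \<xi>\<bar> \<le> 1 / \<mu>" for \<xi>
      using high[of "norm \<xi>"] \<mu> by (auto simp: gs_def low_def field_simps)
  qed
  define G where "G = multiplier_op gs \<circ> Z"
  have G: "G \<in> L2_operators" unfolding G_def by (rule L2_operators_comp[OF L2_operators_multiplier_op[OF gs] Z])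
  have rG: "AE \<xi> in lebesgue. fhat (G u) \<xi> = complex_of_real (gs \<xi>) * fhat (Z u) \<xi>" for u
    unfolding G_def o_def by (rule rep_multiplier_op[OF gs])
  \<comment> \<open>\<open>Z\<close> depends on the low frequencies of its argument only.\<close>
  have Zrel: "Z v = a *\<^sub>R Z u" if "AE \<xi> in lebesgue. norm \<xi> \<le> R \<longrightarrow> fhat v \<xi> = complex_of_real a * fhat u \<xi>" for u v a
  proof -
    have "multiplier_op kq v = a *\<^sub>R multiplier_op kq u"
      by (rule fourier_L2_eqI, use rkq[of v] rkq[of u] rep_fourier_scaleR[of a "multiplier_op kq u"] that in eventually_elim)
         (auto simp: kq_def low_def)
    then show ?thesis by (simp add: Z_def K_def L2_operatorsD(5)[OF S(1)] L2_operatorsD(5)[OF I])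
  qed
  have GG: "G (G u) = 0" for u
  proof -
    have "Z (G u) = 0 *\<^sub>R Z u"
      by (rule Zrel, use rG[of u] in eventually_elim) (simp add: gs_def low_def)
    then show ?thesis by (simp add: G_def L2_operatorsD(7)[OF L2_operators_multiplier_op[OF gs]])
  qed
  define s where "s \<xi> = (if norm \<xi> \<le> R then \<mu> else F (norm \<xi>))" for \<xi> :: 'a
  have sm [measurable]: "s \<in> borel_measurable borel" unfolding s_def by measurable
  have s\<mu>: "\<mu> \<le> s \<xi>" for \<xi> using high[of "norm \<xi>"] \<mu> by (auto simp: s_def)
  have s0: "0 \<le> s \<xi>" for \<xi> using s\<mu>[of \<xi>] \<mu> by linarith
  define E where "E = multiplier_semigroup s"
  note E_op = multiplier_semigroup_operator[of s, OF sm s0, folded E_def]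
  define Y where "Y u = u + G u" for u
  define Yi where "Yi u = u - G u" for u
  have Yop: "Y \<in> L2_operators" unfolding Y_def by (rule L2_operators_add[OF L2_operators_id G])
  have Yiop: "Yi \<in> L2_operators" unfolding Yi_def by (rule L2_operators_diff[OF L2_operators_id G])
  have YYi: "Y (Yi u) = u" for u by (simp add: Y_def Yi_def L2_operatorsD(4)[OF G] GG)
  have YiY: "Yi (Y u) = u" for u by (simp add: Y_def Yi_def L2_operatorsD(3)[OF G] GG)
  define T where "T t u = Yi (E t (Y u))" for t u
  have T_op: "T t \<in> L2_operators" if "0 \<le> t" for t
    using L2_operators_comp[OF Yiop L2_operators_comp[OF E_op[OF that] Yop]] by (simp add: T_def[abs_def] o_def)
  have sg: "c0_semigroup T"
    unfolding c0_semigroup_def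
  proof (intro conjI allI impI)
    show "T t \<in> L2_operators" if "0 \<le> t" for t by (rule T_op[OF that])
    show "T 0 = id" by (rule ext) (simp add: T_def E_def multiplier_semigroup_zero[of s, OF sm s0] YiY)
    show "T (r + t) = T r \<circ> T t" if "0 \<le> r" "0 \<le> t" for r t
      using that by (intro ext) (simp add: T_def E_def multiplier_semigroup_add[of s, OF sm s0] YYi)
    show "((\<lambda>t. T t u) \<longlongrightarrow> u) (at_right 0)" for u
    proof -
      have "((\<lambda>t. Yi (E t (Y u))) \<longlongrightarrow> Yi (Y u)) (at_right 0)"
        unfolding E_def
        by (rule bounded_linear.tendsto[OF L2_operatorsD(1)[OF Yiop] multiplier_semigroup_tendsto[of s, OF sm s0]])
      then show ?thesis by (simp add: T_def YiY)
    qed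
  qed
  have gen1: "((\<lambda>t. (T t u - u) /\<^sub>R t) \<longlongrightarrow> v) (at_right 0) \<longleftrightarrow> ((\<lambda>t. (E t (Y u) - Y u) /\<^sub>R t) \<longlongrightarrow> Y v) (at_right 0)" for u v
  proof -
    have 1: "(T t u - u) /\<^sub>R t = Yi ((E t (Y u) - Y u) /\<^sub>R t)" for t
      by (simp add: T_def L2_operatorsD(4,5)[OF Yiop] YiY)
    then have 2: "(E t (Y u) - Y u) /\<^sub>R t = Y ((T t u - u) /\<^sub>R t)" for t by (simp add: YYi)
    show ?thesis
    proof
      assume "((\<lambda>t. (T t u - u) /\<^sub>R t) \<longlongrightarrow> v) (at_right 0)"
      then show "((\<lambda>t. (E t (Y u) - Y u) /\<^sub>R t) \<longlongrightarrow> Y v) (at_right 0)"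
        unfolding 2 by (rule bounded_linear.tendsto[OF L2_operatorsD(1)[OF Yop]])
    next
      assume "((\<lambda>t. (E t (Y u) - Y u) /\<^sub>R t) \<longlongrightarrow> Y v) (at_right 0)"
      then have "((\<lambda>t. Yi ((E t (Y u) - Y u) /\<^sub>R t)) \<longlongrightarrow> Yi (Y v)) (at_right 0)"
        by (rule bounded_linear.tendsto[OF L2_operatorsD(1)[OF Yiop]])
      then show "((\<lambda>t. (T t u - u) /\<^sub>R t) \<longlongrightarrow> v) (at_right 0)" by (simp only: 1 YiY)
    qed
  qed
  have rY: "AE \<xi> in lebesgue. fhat (Y u) \<xi> = fhat u \<xi> + complex_of_real (gs \<xi>) * fhat (Z u) \<xi>" for u
    unfolding Y_def using rep_fourier_add[of u "G u"] rG[of u] by eventually_elim simp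
  have gs_high: "gs \<xi> * (F (norm \<xi>) - \<mu>) = 1" if "\<not> norm \<xi> \<le> R" for \<xi>
    using high[of "norm \<xi>"] that \<mu> by (simp add: gs_def low_def)
  have gs_low: "gs \<xi> = 0" if "norm \<xi> \<le> R" for \<xi> using that by (simp add: gs_def low_def)
  \<comment> \<open>On low frequencies both conditions say that the transforms of \<open>v\<close> and \<open>- \<mu> u\<close> agree; then \<open>Z v = - \<mu> Z u\<close>, and with this the conditions on high frequencies are equivalent.\<close>
  have key: "((\<lambda>t. (T t u - u) /\<^sub>R t) \<longlongrightarrow> v) (at_right 0) \<longleftrightarrow>
     (AE \<xi> in lebesgue. fhat v \<xi> = - complex_of_real (F (norm \<xi>)) * fhat u \<xi> - fhat (Z u) \<xi>)" (is "?L \<longleftrightarrow> ?A") for u v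
  proof -
    have L: "?L \<longleftrightarrow> (AE \<xi> in lebesgue. fhat (Y v) \<xi> = - complex_of_real (s \<xi>) * fhat (Y u) \<xi>)"
      unfolding gen1 E_def by (rule multiplier_semigroup_generator[of s, OF sm s0])
    have split: "(y = - complex_of_real (F (norm \<xi>)) * x - z) \<longleftrightarrow>
        (y + complex_of_real (gs \<xi>) * (- complex_of_real \<mu> * z) = - complex_of_real (F (norm \<xi>)) * (x + complex_of_real (gs \<xi>) * z))"
      if "\<not> norm \<xi> \<le> R" for x y z \<xi>
    proof -
      have g: "complex_of_real (gs \<xi>) * (complex_of_real (F (norm \<xi>)) - complex_of_real \<mu>) = 1"
        using gs_high[OF that] by (metis of_real_1 of_real_diff of_real_mult)
      have "(y + complex_of_real (gs \<xi>) * (- complex_of_real \<mu> * z)) - (- complex_of_real (F (norm \<xi>)) * (x + complex_of_real (gs \<xi>) * z))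
        = y + complex_of_real (F (norm \<xi>)) * x + (complex_of_real (gs \<xi>) * (complex_of_real (F (norm \<xi>)) - complex_of_real \<mu>)) * z"
        by (simp add: algebra_simps)
      also have "\<dots> = y - (- complex_of_real (F (norm \<xi>)) * x - z)" by (simp add: g)
      finally show ?thesis by (metis eq_iff_diff_eq_0)
    qed
    show ?thesis
    proof
      assume ?L
      then have a: "AE \<xi> in lebesgue. fhat (Y v) \<xi> = - complex_of_real (s \<xi>) * fhat (Y u) \<xi>" by (simp only: L)
      have "Z v = (- \<mu>) *\<^sub>R Z u"
        by (rule Zrel, use a rY[of v] rY[of u] in eventually_elim) (auto simp: gs_low s_def)
      then have "AE \<xi> in lebesgue. fhat (Z v) \<xi> = complex_of_real (- \<mu>) * fhat (Z u) \<xi>"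
        using rep_fourier_scaleR[of "- \<mu>" "Z u"] by simp
      then show ?A using a rY[of v] rY[of u] Zlow[of u]
      proof eventually_elim
        case (elim \<xi>)
        show ?case
        proof (cases "norm \<xi> \<le> R")
          case True
          then have "fhat v \<xi> = - complex_of_real \<mu> * fhat u \<xi>" using elim by (simp add: gs_low s_def)
          then show ?thesis using elim(5) True by (simp add: algebra_simps)
        next
          case False
          show ?thesis unfolding split[OF False] using elim False by (simp add: s_def)
        qed
      qed
    next
      assume a: ?A
      have low_v: "AE \<xi> in lebesgue. norm \<xi> \<le> R \<longrightarrow> fhat v \<xi> = complex_of_real (- \<mu>) * fhat u \<xi>"
        using a Zlow[of u]
      proof eventually_elim
        case (elim \<xi>)
        show ?case
        proof
          assume "norm \<xi> \<le> R"
          with elim show "fhat v \<xi> = complex_of_real (- \<mu>) * fhat u \<xi>"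
            by (simp only: simp_thms) (simp add: left_diff_distrib)
        qed
      qed
      have "Z v = (- \<mu>) *\<^sub>R Z u" by (rule Zrel[OF low_v])
      then have "AE \<xi> in lebesgue. fhat (Z v) \<xi> = complex_of_real (- \<mu>) * fhat (Z u) \<xi>"
        using rep_fourier_scaleR[of "- \<mu>" "Z u"] by simp
      then have "AE \<xi> in lebesgue. fhat (Y v) \<xi> = - complex_of_real (s \<xi>) * fhat (Y u) \<xi>"
        using a low_v rY[of v] rY[of u]
      proof eventually_elim
        case (elim \<xi>)
        show ?case
        proof (cases "norm \<xi> \<le> R")
          case True
          then show ?thesis using elim by (simp add: gs_low s_def)
        next
          case False
          have "fhat v \<xi> + complex_of_real (gs \<xi>) * (- complex_of_real \<mu> * fhat (Z u) \<xi>) =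
            - complex_of_real (F (norm \<xi>)) * (fhat u \<xi> + complex_of_real (gs \<xi>) * fhat (Z u) \<xi>)"
            using split[OF False] elim(2) by blast
          then show ?thesis using elim(1,4,5) False by (simp add: s_def)
        qed
      qed
      then show ?L by (simp only: L)
    qed
  qed
  have rneg: "AE \<xi> in lebesgue. fhat (- w) \<xi> = - fhat w \<xi>" for w :: "'a L2"
    using rep_fourier_scaleR[of "-1" w] by simp
  have gen: "generates_perturbed (fourier_multiplier (\<lambda>\<xi>. F (norm \<xi>))) (mult_indicator \<omega> \<circ> K) T"
    unfolding generates_perturbed_def semigroup_generator_def key
  proof (intro conjI sg set_eqI iffI)
    fix p assume "p \<in> {(u, v). AE \<xi> in lebesgue. fhat v \<xi> = - complex_of_real (F (norm \<xi>)) * fhat u \<xi> - fhat (Z u) \<xi>}"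
    then obtain u v where p: "p = (u, v)" and
      a: "AE \<xi> in lebesgue. fhat v \<xi> = - complex_of_real (F (norm \<xi>)) * fhat u \<xi> - fhat (Z u) \<xi>" by auto
    have "(u, - v - Z u) \<in> fourier_multiplier (\<lambda>\<xi>. F (norm \<xi>))"
      unfolding fourier_multiplier_iff
      using a rneg[of v] rep_fourier_diff[of "- v" "Z u"] by eventually_elim simp
    moreover have "p = (u, - ((- v - Z u) + (mult_indicator \<omega> \<circ> K) u))" by (simp add: p Z_def I_def)
    ultimately show "p \<in> {(u, - (v + (mult_indicator \<omega> \<circ> K) u)) |u v. (u, v) \<in> fourier_multiplier (\<lambda>\<xi>. F (norm \<xi>))}" by blast
  next
    fix p assume "p \<in> {(u, - (v + (mult_indicator \<omega> \<circ> K) u)) |u v. (u, v) \<in> fourier_multiplier (\<lambda>\<xi>. F (norm \<xi>))}"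
    then obtain u v where p: "p = (u, - (v + Z u))" and a: "(u, v) \<in> fourier_multiplier (\<lambda>\<xi>. F (norm \<xi>))"
      by (auto simp: Z_def I_def)
    have "AE \<xi> in lebesgue. fhat (- (v + Z u)) \<xi> = - complex_of_real (F (norm \<xi>)) * fhat u \<xi> - fhat (Z u) \<xi>"
      using a[unfolded fourier_multiplier_iff] rneg[of "v + Z u"] rep_fourier_add[of v "Z u"] by eventually_elim simp
    then show "p \<in> {(u, v). AE \<xi> in lebesgue. fhat v \<xi> = - complex_of_real (F (norm \<xi>)) * fhat u \<xi> - fhat (Z u) \<xi>}"
      by (simp add: p)
  qed
  obtain kY where kY: "0 \<le> kY" "\<And>u. norm (Y u) \<le> kY * norm u" using L2_operators_bound[OF Yop] by blast
  obtain kYi where kYi: "0 \<le> kYi" "\<And>u. norm (Yi u) \<le> kYi * norm u" using L2_operators_bound[OF Yiop] by blast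
  define M where "M = max 1 (kYi * kY)"
  have decay: "onorm (T t) \<le> M * exp (- \<mu> * t)" if "0 \<le> t" for t
  proof (rule onorm_bound)
    show "0 \<le> M * exp (- \<mu> * t)" by (simp add: M_def)
    fix u
    have sb: "bounded_symbol (\<lambda>\<xi>. exp (- (t * s \<xi>)))" by (rule bounded_symbol_exp[OF sm s0 that])
    have "\<bar>exp (- (t * s \<xi>))\<bar> \<le> exp (- \<mu> * t)" for \<xi>
      using mult_left_mono[OF s\<mu>[of \<xi>] that] by (simp add: mult.commute)
    from norm_multiplier_op_le[OF sb this, of "Y u"]
    have e: "norm (E t (Y u)) \<le> exp (- \<mu> * t) * norm (Y u)" by (simp add: E_def multiplier_semigroup_def[OF sm s0])
    have "norm (T t u) \<le> kYi * norm (E t (Y u))" unfolding T_def by (rule kYi(2))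
    also have "\<dots> \<le> kYi * (exp (- \<mu> * t) * norm (Y u))" by (rule mult_left_mono[OF e kYi(1)])
    also have "\<dots> \<le> kYi * (exp (- \<mu> * t) * (kY * norm u))" by (intro mult_left_mono kY(2) kYi(1)) auto
    also have "\<dots> = (kYi * kY) * (exp (- \<mu> * t) * norm u)" by (simp only: mult_ac)
    also have "\<dots> \<le> M * (exp (- \<mu> * t) * norm u)" by (intro mult_right_mono) (auto simp: M_def)
    finally show "norm (T t u) \<le> M * exp (- \<mu> * t) * norm u" by (simp only: mult.assoc)
  qed
  show ?thesis
    unfolding exp_stabilizable_at_rate_def
    by (intro exI[of _ M] conjI bexI[of _ K] exI[of _ T] gen allI impI decay K) (simp_all add: M_def)
qed

section \<open>Stabilizability implies an observability estimate\<close>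
lemma mult_indicator_symmetric:
  assumes "\<omega> \<in> sets lebesgue"
  shows "mult_indicator \<omega> u \<bullet> v = u \<bullet> mult_indicator \<omega> v"
  unfolding inner_L2_eq
  by (rule integral_cong_AE, measurable, use rep_mult_indicator[OF assms, of u] rep_mult_indicator[OF assms, of v] in eventually_elim)
     (auto simp: indicator_def)

lemma fourier_multiplier_symmetric:
  fixes u :: "'a::euclidean_space L2"
  assumes "(u, u') \<in> fourier_multiplier m" "(v, v') \<in> fourier_multiplier m"
  shows "u' \<bullet> v = u \<bullet> v'"
proof -
  have "fourier_L2 u' \<bullet> fourier_L2 v = fourier_L2 u \<bullet> fourier_L2 v'"
    unfolding inner_L2_eq
    by (rule integral_cong_AE, measurable, use assms[unfolded fourier_multiplier_iff] in eventually_elim)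
       (simp add: inner_complex_def algebra_simps)
  then show ?thesis unfolding fourier_L2_inner by simp
qed

text \<open>From the left, the quotient is \<open>T (t - k)\<close> applied to a quotient at 0; as the operators are
  uniformly bounded, it may be compared with \<open>T (t - k) l\<close>, and \<open>T t l = T (t - k) (T k l)\<close>.\<close>
lemma semigroup_has_derivative:
  fixes T :: "real \<Rightarrow> 'a::euclidean_space L2 \<Rightarrow> 'a L2"
  assumes sg: "c0_semigroup T" and b: "\<And>t u. 0 \<le> t \<Longrightarrow> norm (T t u) \<le> M * norm u"
    and g: "((\<lambda>t. (T t g - g) /\<^sub>R t) \<longlongrightarrow> l) (at_right 0)" and t: "0 < t"
  shows "((\<lambda>h. (T (t + h) g - T t g) /\<^sub>R h) \<longlongrightarrow> T t l) (at 0)"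
proof -
  have T_op: "T r \<in> L2_operators" if "0 \<le> r" for r using sg that by (auto simp: c0_semigroup_def)
  have T_add: "T (r + q) u = T r (T q u)" if "0 \<le> r" "0 \<le> q" for r q u
    using sg that by (auto simp: c0_semigroup_def)
  have T0: "((\<lambda>t. T t u) \<longlongrightarrow> u) (at_right 0)" for u using sg by (auto simp: c0_semigroup_def)
  have right: "((\<lambda>h. (T (t + h) g - T t g) /\<^sub>R h) \<longlongrightarrow> T t l) (at_right 0)"
  proof (rule Lim_transform_eventually)
    show "((\<lambda>h. T t ((T h g - g) /\<^sub>R h)) \<longlongrightarrow> T t l) (at_right 0)"
      using t by (intro bounded_linear.tendsto[OF L2_operatorsD(1)[OF T_op]] g) auto
    show "\<forall>\<^sub>F h in at_right 0. T t ((T h g - g) /\<^sub>R h) = (T (t + h) g - T t g) /\<^sub>R h"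
      using eventually_at_right_less[of "0::real"]
    proof eventually_elim
      case (elim h)
      have o: "T t \<in> L2_operators" using T_op t by simp
      show ?case using elim t by (simp add: T_add L2_operatorsD(4,5)[OF o])
    qed
  qed
  have left: "((\<lambda>h. (T (t + h) g - T t g) /\<^sub>R h) \<longlongrightarrow> T t l) (at_left 0)"
    unfolding filterlim_at_left_to_right minus_zero
  proof (rule Lim_transform_eventually)
    show "((\<lambda>k. T (t - k) ((T k g - g) /\<^sub>R k)) \<longlongrightarrow> T t l) (at_right 0)"
    proof (rule LIM_zero_cancel, rule Lim_null_comparison)
      have "((\<lambda>k. M * norm ((T k g - g) /\<^sub>R k - l) + M * norm (l - T k l)) \<longlongrightarrow> M * norm (l - l) + M * norm (l - l)) (at_right 0)"
        by (intro tendsto_intros g T0)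
      then show "((\<lambda>k. M * norm ((T k g - g) /\<^sub>R k - l) + M * norm (l - T k l)) \<longlongrightarrow> 0) (at_right 0)" by simp
      have "\<forall>\<^sub>F k in at_right 0. k < t" using t eventually_at_right[of 0 t "\<lambda>k. k < t"] by auto
      with eventually_at_right_less[of "0::real"]
      show "\<forall>\<^sub>F k in at_right 0. norm (T (t - k) ((T k g - g) /\<^sub>R k) - T t l) \<le> M * norm ((T k g - g) /\<^sub>R k - l) + M * norm (l - T k l)"
      proof eventually_elim
        case (elim k)
        then have o: "T (t - k) \<in> L2_operators" using T_op by simp
        have "T t l = T (t - k) (T k l)" using T_add[of "t - k" k l] elim by simp
        then have "T (t - k) ((T k g - g) /\<^sub>R k) - T t l = T (t - k) ((T k g - g) /\<^sub>R k - l) + T (t - k) (l - T k l)"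
          by (simp only: L2_operatorsD(4)[OF o]) simp
        also have "norm \<dots> \<le> norm (T (t - k) ((T k g - g) /\<^sub>R k - l)) + norm (T (t - k) (l - T k l))" by (rule norm_triangle_ineq)
        also have "\<dots> \<le> M * norm ((T k g - g) /\<^sub>R k - l) + M * norm (l - T k l)"
          using elim by (intro add_mono b) auto
        finally show ?case .
      qed
    qed
    have "\<forall>\<^sub>F k in at_right 0. k < t" using t eventually_at_right[of 0 t "\<lambda>k. k < t"] by auto
    with eventually_at_right_less[of "0::real"]
    show "\<forall>\<^sub>F k in at_right 0. T (t - k) ((T k g - g) /\<^sub>R k) = (T (t + - k) g - T t g) /\<^sub>R - k"
    proof eventually_elim
      case (elim k)
      then have o: "T (t - k) \<in> L2_operators" using T_op by simp
      have "T t g = T (t - k) (T k g)" using T_add[of "t - k" k g] elim by simp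
      then show ?case by (simp add: L2_operatorsD(4,5)[OF o] scaleR_right_diff_distrib)
    qed
  qed
  show ?thesis using left right by (simp add: filterlim_split_at)
qed

text \<open>Consider \<open>\<phi> t = exp (m * t) * (T t g \<bullet> g)\<close>. Since \<open>A\<close> and \<open>1\<^sub>\<omega>\<close> are symmetric, its derivative is
  \<open>- exp (m * t) * (T t g \<bullet> (A - m) g + K (T t g) \<bullet> 1\<^sub>\<omega> g)\<close>, which is bounded by a multiple of
  \<open>|g| (|(A - m) g| + |1\<^sub>\<omega> g|)\<close>. At the time \<open>\<tau>\<close> the function \<open>|\<phi>|\<close> is at most half of
  \<open>\<phi> 0 = |g|\<^sup>2\<close>, and the mean value theorem compares the two.\<close>
lemma stabilizable_imp_observable:
  fixes \<omega> :: "'a::euclidean_space set"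
  assumes st: "exp_stabilizable_at_rate F \<omega> \<alpha>" and \<alpha>: "0 < \<alpha>" and \<omega>: "\<omega> \<in> sets lebesgue" and m: "m \<le> 0"
  obtains C where "0 < C"
    "\<And>g v :: 'a L2. (g, v) \<in> fourier_multiplier (\<lambda>\<xi>. F (norm \<xi>)) \<Longrightarrow> norm g \<le> C * (norm (v - m *\<^sub>R g) + norm (mult_indicator \<omega> g))"
proof -
  let ?A = "fourier_multiplier (\<lambda>\<xi>::'a. F (norm \<xi>))" and ?I = "mult_indicator \<omega>"
  obtain M K T where M: "1 \<le> M" and K: "K \<in> L2_operators" and gen: "generates_perturbed ?A (?I \<circ> K) T"
    and decay: "\<And>t. 0 \<le> t \<Longrightarrow> onorm (T t) \<le> M * exp (- \<alpha> * t)"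
    using st unfolding exp_stabilizable_at_rate_def by blast
  have sg: "c0_semigroup T" using gen by (simp add: generates_perturbed_def)
  have generator: "((\<lambda>t. (T t u - u) /\<^sub>R t) \<longlongrightarrow> w) (at_right 0) \<longleftrightarrow> (\<exists>v. (u, v) \<in> ?A \<and> w = - (v + ?I (K u)))" for u w
  proof -
    have "(u, w) \<in> semigroup_generator T \<longleftrightarrow> (u, w) \<in> {(u, - (v + (?I \<circ> K) u)) |u v. (u, v) \<in> ?A}"
      using gen by (simp add: generates_perturbed_def)
    then show ?thesis by (auto simp: semigroup_generator_def)
  qed
  have T_op: "T r \<in> L2_operators" if "0 \<le> r" for r using sg that by (auto simp: c0_semigroup_def)
  have T_add: "T (r + q) u = T r (T q u)" if "0 \<le> r" "0 \<le> q" for r q u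
    using sg that by (auto simp: c0_semigroup_def)
  have Tb: "norm (T t u) \<le> M * exp (- \<alpha> * t) * norm u" if "0 \<le> t" for t u
    using onorm[OF L2_operatorsD(1)[OF T_op[OF that]], of u] mult_right_mono[OF decay[OF that], of "norm u"] by simp
  have TM: "norm (T t u) \<le> M * norm u" if "0 \<le> t" for t u
  proof -
    have "exp (- \<alpha> * t) \<le> 1" using \<alpha> that by simp
    then have "M * exp (- \<alpha> * t) * norm u \<le> M * 1 * norm u" using M by (intro mult_right_mono mult_left_mono) auto
    then show ?thesis using Tb[OF that, of u] by simp
  qed
  obtain k where k: "0 \<le> k" "\<And>u. norm (K u) \<le> k * norm u" using L2_operators_bound[OF K] by blast
  define \<tau> where "\<tau> = (ln (2 * M) + 1) / \<alpha>"
  have \<tau>: "0 < \<tau>" using M \<alpha> by (simp add: \<tau>_def add_nonneg_pos)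
  have half: "M * exp (- \<alpha> * \<tau>) \<le> 1 / 2"
  proof -
    have "exp (- \<alpha> * \<tau>) \<le> exp (- ln (2 * M))" using \<alpha> by (simp add: \<tau>_def)
    also have "\<dots> = 1 / (2 * M)"
    proof -
      have "exp (ln (2 * M)) = 2 * M" using M by (intro exp_ln) simp
      then show ?thesis by (simp only: exp_minus inverse_eq_divide)
    qed
    finally have "M * exp (- \<alpha> * \<tau>) \<le> M * (1 / (2 * M))" using M by (intro mult_left_mono) auto
    then show ?thesis using M by simp
  qed
  define C where "C = 2 * \<tau> * M * (1 + k)"
  have C: "0 < C" using \<tau> M k by (simp add: C_def)
  show ?thesis
  proof (rule that[OF C])
    fix g v assume gv: "(g, v) \<in> ?A"
    define l where "l = - (v + ?I (K g))"
    have gl: "((\<lambda>t. (T t g - g) /\<^sub>R t) \<longlongrightarrow> l) (at_right 0)" using generator gv by (auto simp: l_def)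
    define \<delta> where "\<delta> = norm (v - m *\<^sub>R g) + k * norm (?I g)"
    have \<delta>0: "0 \<le> \<delta>" using k by (simp add: \<delta>_def)
    have orbit: "T t l \<bullet> g = - (T t g \<bullet> v) - (K (T t g) \<bullet> ?I g)" if t: "0 \<le> t" for t
    proof -
      have o: "T t \<in> L2_operators" using T_op t .
      have "((\<lambda>h. T t ((T h g - g) /\<^sub>R h)) \<longlongrightarrow> T t l) (at_right 0)"
        by (rule bounded_linear.tendsto[OF L2_operatorsD(1)[OF o] gl])
      then have "((\<lambda>h. (T h (T t g) - T t g) /\<^sub>R h) \<longlongrightarrow> T t l) (at_right 0)"
      proof (rule Lim_transform_eventually)
        show "\<forall>\<^sub>F h in at_right 0. T t ((T h g - g) /\<^sub>R h) = (T h (T t g) - T t g) /\<^sub>R h"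
          using eventually_at_right_less[of "0::real"]
        proof eventually_elim
          case (elim h)
          have "T h (T t g) = T t (T h g)" using T_add[of h t g] T_add[of t h g] elim t by (simp add: add.commute)
          then show ?case by (simp add: L2_operatorsD(4,5)[OF o])
        qed
      qed
      then obtain w where w: "(T t g, w) \<in> ?A" "T t l = - (w + ?I (K (T t g)))" using generator by blast
      then show ?thesis
        by (simp add: inner_add_left inner_diff_left fourier_multiplier_symmetric[OF w(1) gv] mult_indicator_symmetric[OF \<omega>])
    qed
    define \<phi> where "\<phi> t = exp (m * t) * (T t g \<bullet> g)" for t
    have der: "(\<phi> has_real_derivative (- exp (m * t) * (T t g \<bullet> (v - m *\<^sub>R g) + K (T t g) \<bullet> ?I g))) (at t)" if t: "0 < t" for t
    proof -
      have "((\<lambda>h. ((T (t + h) g - T t g) /\<^sub>R h) \<bullet> g) \<longlongrightarrow> T t l \<bullet> g) (at 0)"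
        by (intro tendsto_inner semigroup_has_derivative[OF sg TM gl t] tendsto_const)
      then have "((\<lambda>t. T t g \<bullet> g) has_real_derivative T t l \<bullet> g) (at t)"
        unfolding DERIV_def by (simp add: inner_diff_left divide_inverse mult.commute)
      then have "(\<phi> has_real_derivative (exp (m * t) * m * (T t g \<bullet> g) + exp (m * t) * (T t l \<bullet> g))) (at t)"
        unfolding \<phi>_def by (auto intro!: derivative_eq_intros)
      moreover have "exp (m * t) * m * (T t g \<bullet> g) + exp (m * t) * (T t l \<bullet> g) = - exp (m * t) * (T t g \<bullet> (v - m *\<^sub>R g) + K (T t g) \<bullet> ?I g)"
        unfolding orbit[OF less_imp_le[OF t]] by (simp add: inner_diff_right algebra_simps)
      ultimately show ?thesis by simp
    qed
    have derb: "\<bar>- exp (m * t) * (T t g \<bullet> (v - m *\<^sub>R g) + K (T t g) \<bullet> ?I g)\<bar> \<le> M * norm g * \<delta>" if t: "0 < t" for t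
    proof -
      have e: "exp (m * t) \<le> 1" using m t by (simp add: mult_nonpos_nonneg)
      have n: "norm (T t g) \<le> M * norm g" using TM t by simp
      have "\<bar>T t g \<bullet> (v - m *\<^sub>R g)\<bar> \<le> norm (T t g) * norm (v - m *\<^sub>R g)" by (rule Cauchy_Schwarz_ineq2)
      also have "\<dots> \<le> M * norm g * norm (v - m *\<^sub>R g)" by (rule mult_right_mono[OF n]) simp
      finally have 1: "\<bar>T t g \<bullet> (v - m *\<^sub>R g)\<bar> \<le> M * norm g * norm (v - m *\<^sub>R g)" .
      have "\<bar>K (T t g) \<bullet> ?I g\<bar> \<le> norm (K (T t g)) * norm (?I g)" by (rule Cauchy_Schwarz_ineq2)
      also have "\<dots> \<le> (k * (M * norm g)) * norm (?I g)"
        using k(2)[of "T t g"] mult_left_mono[OF n k(1)] by (intro mult_right_mono) auto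
      finally have 2: "\<bar>K (T t g) \<bullet> ?I g\<bar> \<le> M * norm g * (k * norm (?I g))" by (simp add: mult_ac)
      have "\<bar>- exp (m * t) * (T t g \<bullet> (v - m *\<^sub>R g) + K (T t g) \<bullet> ?I g)\<bar> = exp (m * t) * \<bar>T t g \<bullet> (v - m *\<^sub>R g) + K (T t g) \<bullet> ?I g\<bar>"
        by (simp add: abs_mult)
      also have "\<dots> \<le> 1 * (M * norm g * norm (v - m *\<^sub>R g) + M * norm g * (k * norm (?I g)))"
        using 1 2 e by (intro mult_mono) auto
      finally show ?thesis by (simp add: \<delta>_def distrib_left)
    qed
    have "continuous_on {0..\<tau>} \<phi>"
    proof (rule continuous_on_eq_continuous_within[THEN iffD2], intro ballI)
      fix t assume t: "t \<in> {0..\<tau>}"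
      show "continuous (at t within {0..\<tau>}) \<phi>"
      proof (cases "t = 0")
        case True
        have "((\<lambda>t. exp (m * t) * (T t g \<bullet> g)) \<longlongrightarrow> exp (m * 0) * (g \<bullet> g)) (at_right 0)"
          using sg by (intro tendsto_mult tendsto_inner tendsto_const tendsto_exp) (auto simp: c0_semigroup_def intro!: tendsto_eq_intros)
        moreover have "T 0 g = g" using sg by (simp add: c0_semigroup_def)
        ultimately show ?thesis using True \<tau> by (simp add: continuous_within at_within_Icc_at_right \<phi>_def[abs_def])
      next
        case False
        then have "0 < t" using t by simp
        from DERIV_isCont[OF der[OF this]] show ?thesis by (rule continuous_at_imp_continuous_at_within)
      qed
    qed
    moreover have "\<phi> differentiable (at t)" if "0 < t" "t < \<tau>" for t
      using der[OF that(1)] real_differentiable_def by blast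
    ultimately obtain d z where z: "0 < z" "z < \<tau>" "(\<phi> has_real_derivative d) (at z)" "\<phi> \<tau> - \<phi> 0 = (\<tau> - 0) * d"
      using MVT[OF \<tau>, of \<phi>] by blast
    have "\<bar>d\<bar> \<le> M * norm g * \<delta>" using DERIV_unique[OF z(3) der[OF z(1)]] derb[OF z(1)] by simp
    then have 1: "\<bar>\<phi> \<tau> - \<phi> 0\<bar> \<le> \<tau> * (M * norm g * \<delta>)" using \<tau> by (simp add: z(4) abs_mult)
    have \<phi>0: "\<phi> 0 = (norm g)\<^sup>2" using sg by (simp add: \<phi>_def c0_semigroup_def power2_norm_eq_inner)
    have "\<bar>\<phi> \<tau>\<bar> \<le> 1 * ((1 / 2 * norm g) * norm g)"
      unfolding \<phi>_def abs_mult
    proof (rule mult_mono)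
      show "\<bar>exp (m * \<tau>)\<bar> \<le> 1" using m \<tau> by (simp add: mult_nonpos_nonneg)
      have "\<bar>T \<tau> g \<bullet> g\<bar> \<le> norm (T \<tau> g) * norm g" by (rule Cauchy_Schwarz_ineq2)
      also have "norm (T \<tau> g) \<le> 1 / 2 * norm g"
        using Tb[of \<tau> g] \<tau> mult_right_mono[OF half, of "norm g"] by simp
      finally show "\<bar>T \<tau> g \<bullet> g\<bar> \<le> 1 / 2 * norm g * norm g" by (simp add: mult_right_mono)
    qed auto
    then have "\<bar>\<phi> \<tau>\<bar> \<le> (norm g)\<^sup>2 / 2" by (simp add: power2_eq_square)
    with 1 have "(norm g)\<^sup>2 / 2 \<le> \<tau> * (M * norm g * \<delta>)" unfolding \<phi>0 by linarith
    then have "norm g * norm g \<le> norm g * (2 * \<tau> * M * \<delta>)" by (simp add: power2_eq_square mult_ac)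
    then have 2: "norm g \<le> 2 * \<tau> * M * \<delta>"
      using \<tau> M \<delta>0 by (cases "norm g = 0") auto
    have "\<delta> \<le> (1 + k) * (norm (v - m *\<^sub>R g) + norm (?I g))"
      using k(1) by (simp add: \<delta>_def algebra_simps)
    from mult_left_mono[OF this, of "2 * \<tau> * M"] \<tau> M
    have "2 * \<tau> * M * \<delta> \<le> C * (norm (v - m *\<^sub>R g) + norm (?I g))" by (simp add: C_def mult.assoc)
    with 2 show "norm g \<le> C * (norm (v - m *\<^sub>R g) + norm (?I g))" by linarith
  qed
qed

section \<open>Wave packets\<close>
text \<open>Modulating the transform by \<open>cis (- (y \<bullet> \<xi>))\<close> translates the function by \<open>y\<close>.\<close>
lemma wave_packet:
  fixes \<xi>\<^sub>0 y :: "'a::euclidean_space" and \<rho> :: real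
  defines "\<phi> \<equiv> (\<lambda>\<xi>. cis (- (y \<bullet> \<xi>)) * indicator (ball \<xi>\<^sub>0 \<rho>) \<xi>)"
  shows "bounded_integrable \<phi>"
    and "AE x in lebesgue. rep_L2 (inverse_fourier_L2 (abs_L2 \<phi>)) x =
      complex_of_real (1 / (2 * pi) ^ DIM('a)) * band_limited (indicator (ball \<xi>\<^sub>0 \<rho>)) (x - y)"
proof -
  have Bm [measurable]: "ball \<xi>\<^sub>0 \<rho> \<in> sets borel" by simp
  have i: "integrable lborel (indicator (ball \<xi>\<^sub>0 \<rho>) :: 'a \<Rightarrow> complex)"
    using ball_bounded_integrable[of \<xi>\<^sub>0 \<rho>] by (simp add: bounded_integrable_def)
  have \<phi>m [measurable]: "\<phi> \<in> borel_measurable borel" unfolding \<phi>_def by measurable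
  have \<phi>i: "integrable lborel \<phi>" unfolding \<phi>_def by (intro integrable_cis_mult i) measurable
  show b: "bounded_integrable \<phi>"
    unfolding bounded_integrable_def
    by (intro conjI \<phi>m \<phi>i exI[of _ 1] allI) (simp add: \<phi>_def norm_mult indicator_def)
  have eq: "band_limited \<phi> x = band_limited (indicator (ball \<xi>\<^sub>0 \<rho>)) (x - y)" for x
    unfolding band_limited_def \<phi>_def mult.assoc[symmetric] cis_mult
    by (simp add: inner_diff_left)
  show "AE x in lebesgue. rep_L2 (inverse_fourier_L2 (abs_L2 \<phi>)) x =
      complex_of_real (1 / (2 * pi) ^ DIM('a)) * band_limited (indicator (ball \<xi>\<^sub>0 \<rho>)) (x - y)"
    using inverse_fourier_L2_integrable[OF \<phi>m \<phi>i sq_integrable_bounded_integrable[OF b]] by (simp only: eq)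
qed

text \<open>A centred cube of side \<open>L\<close> carries all but \<open>\<beta> / 2\<close> of the mass of \<open>h\<close>. So the part of
  \<open>\<omega>\<close> in the translated cube carries at least \<open>\<beta> / 2\<close>, and \<open>h\<close> is bounded.\<close>
lemma bounded_sq_integrable_concentration:
  fixes h :: "'a::euclidean_space \<Rightarrow> complex"
  assumes [measurable]: "h \<in> borel_measurable borel" and h: "sq_integrable h" and hb: "\<And>x. cmod (h x) \<le> Hm"
    and \<omega>: "\<omega> \<in> sets lebesgue" and \<beta>: "0 < \<beta>"
    and low: "\<And>y. \<beta> \<le> (LINT x|lebesgue. indicator \<omega> x * (cmod (h (x - y)))\<^sup>2)"
  obtains a L where "0 < a" "0 < L" "\<And>x::'a. a \<le> measure lebesgue (\<omega> \<inter> cbox x (x + L *\<^sub>R One))"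
proof -
  let ?Q = "\<lambda>L::real. cbox (- (L / 2) *\<^sub>R One) ((L / 2) *\<^sub>R One) :: 'a set"
  have hi: "integrable lborel (\<lambda>x. (cmod (h x))\<^sup>2)" using h by (simp add: sq_integrable_borel)
  have Qm: "?Q L \<in> sets borel" for L by simp
  have "(\<lambda>k::nat. LINT x|lborel. indicator (- ?Q (2 * real (Suc k))) x * (cmod (h x))\<^sup>2) \<longlonglongrightarrow> (LINT x::'a|lborel. 0)"
  proof (rule integral_dominated_convergence[where w = "\<lambda>x. (cmod (h x))\<^sup>2"])
    show "AE x in lborel. (\<lambda>k. indicator (- ?Q (2 * real (Suc k))) x * (cmod (h x))\<^sup>2) \<longlonglongrightarrow> 0"
    proof (intro AE_I2 tendsto_eventually)
      fix x :: 'a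
      obtain N :: nat where N: "norm x \<le> real N" using real_arch_simple by blast
      have "x \<in> ?Q (2 * real (Suc k))" if "k \<ge> N" for k
      proof -
        have *: "- real (Suc k) \<le> x \<bullet> b \<and> x \<bullet> b \<le> real (Suc k)" if "b \<in> Basis" for b
          using Basis_le_norm[OF that, of x] N \<open>k \<ge> N\<close> by linarith
        show ?thesis
          unfolding mem_box
        proof (intro ballI conjI)
          fix b :: 'a assume b: "b \<in> Basis"
          show "(- (2 * real (Suc k) / 2) *\<^sub>R One) \<bullet> b \<le> x \<bullet> b" "x \<bullet> b \<le> ((2 * real (Suc k) / 2) *\<^sub>R One) \<bullet> b"
            using *[OF b] b by (simp_all add: field_simps)
        qed
      qed
      then have "indicator (- ?Q (2 * real (Suc k))) x * (cmod (h x))\<^sup>2 = 0" if "k \<ge> N" for k using that by simp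
      then show "\<forall>\<^sub>F k in sequentially. indicator (- ?Q (2 * real (Suc k))) x * (cmod (h x))\<^sup>2 = 0"
        unfolding eventually_sequentially by blast
    qed
    show "(\<lambda>x. indicator (- ?Q (2 * real (Suc k))) x * (cmod (h x))\<^sup>2) \<in> borel_measurable lborel" for k
    proof -
      have [measurable]: "- ?Q (2 * real (Suc k)) \<in> sets borel" using Qm by (simp add: borel_comp)
      show ?thesis by measurable
    qed
  qed (auto simp: indicator_def hi)
  then have "\<forall>\<^sub>F k in sequentially. (LINT x|lborel. indicator (- ?Q (2 * real (Suc k))) x * (cmod (h x))\<^sup>2) < \<beta> / 2"
    using \<beta> by (intro order_tendstoD(2)) auto
  then obtain k where k: "(LINT x|lborel. indicator (- ?Q (2 * real (Suc k))) x * (cmod (h x))\<^sup>2) < \<beta> / 2"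
    by (auto simp: eventually_sequentially)
  define L where "L = 2 * real (Suc k)"
  have L: "0 < L" by (simp add: L_def)
  have Hm0: "0 \<le> Hm" using hb[of 0] norm_ge_zero order_trans by blast
  define a where "a = \<beta> / 2 / (Hm\<^sup>2 + 1)"
  have den: "0 < Hm\<^sup>2 + 1" by (simp add: add_nonneg_pos)
  have a: "0 < a" using \<beta> den by (simp add: a_def)
  show ?thesis
  proof (rule that[OF a L])
    fix x :: 'a
    define y where "y = x + (L / 2) *\<^sub>R One"
    let ?C = "cbox x (x + L *\<^sub>R One)"
    have Cq: "z \<in> ?C \<longleftrightarrow> z - y \<in> ?Q L" for z
      by (auto simp: mem_box y_def inner_add_left inner_diff_left algebra_simps)
    have C_lm: "\<omega> \<inter> ?C \<in> lmeasurable"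
      by (rule fmeasurableI2[of ?C]) (use \<omega> in auto)
    have hy: "integrable lborel (\<lambda>z. (cmod (h (z - y)))\<^sup>2)" by (rule integrable_lborel_translate[OF _ hi]) measurable
    have Qcm [measurable]: "- ?Q L \<in> sets borel" using Qm by (simp add: borel_comp)
    have outm: "(\<lambda>z. indicator (- ?Q L) (z - y) * (cmod (h (z - y)))\<^sup>2) \<in> borel_measurable borel" by measurable
    have outi: "integrable lborel (\<lambda>z. indicator (- ?Q L) (z - y) * (cmod (h (z - y)))\<^sup>2)"
      by (rule Bochner_Integration.integrable_bound[OF hy]) (use outm in \<open>auto simp: indicator_def\<close>)
    have outi': "integrable lebesgue (\<lambda>z. indicator (- ?Q L) (z - y) * (cmod (h (z - y)))\<^sup>2)"
      using outi outm by (subst integrable_completion) auto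
    have ini: "integrable lebesgue (\<lambda>z. Hm\<^sup>2 * indicator (\<omega> \<inter> ?C) z)"
      using C_lm by (intro integrable_mult_right) (auto simp: fmeasurable_def integrable_indicator_iff)
    have "\<beta> \<le> (LINT z|lebesgue. indicator \<omega> z * (cmod (h (z - y)))\<^sup>2)" by (rule low)
    also have "\<dots> \<le> (LINT z|lebesgue. Hm\<^sup>2 * indicator (\<omega> \<inter> ?C) z + indicator (- ?Q L) (z - y) * (cmod (h (z - y)))\<^sup>2)"
    proof (rule integral_mono)
      have hy': "integrable lebesgue (\<lambda>z. (cmod (h (z - y)))\<^sup>2)"
        using hy by (subst integrable_completion) auto
      then show "integrable lebesgue (\<lambda>z. indicator \<omega> z * (cmod (h (z - y)))\<^sup>2)"
        using integrable_mult_indicator[OF \<omega> hy'] by simp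
      show "integrable lebesgue (\<lambda>z. Hm\<^sup>2 * indicator (\<omega> \<inter> ?C) z + indicator (- ?Q L) (z - y) * (cmod (h (z - y)))\<^sup>2)"
        by (intro Bochner_Integration.integrable_add ini outi')
      fix z
      have "(cmod (h (z - y)))\<^sup>2 \<le> Hm\<^sup>2" by (intro power_mono hb) auto
      then show "indicator \<omega> z * (cmod (h (z - y)))\<^sup>2 \<le> Hm\<^sup>2 * indicator (\<omega> \<inter> ?C) z + indicator (- ?Q L) (z - y) * (cmod (h (z - y)))\<^sup>2"
        by (cases "z \<in> \<omega>"; cases "z \<in> ?C") (use Cq[of z] in \<open>auto simp: indicator_def\<close>)
    qed
    also have "\<dots> = Hm\<^sup>2 * measure lebesgue (\<omega> \<inter> ?C) + (LINT z|lebesgue. indicator (- ?Q L) (z - y) * (cmod (h (z - y)))\<^sup>2)"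
      using ini outi' by (subst Bochner_Integration.integral_add) auto
    also have "(LINT z|lebesgue. indicator (- ?Q L) (z - y) * (cmod (h (z - y)))\<^sup>2) = (LINT z|lborel. indicator (- ?Q L) z * (cmod (h z))\<^sup>2)"
    proof -
      have "(LINT z|lebesgue. indicator (- ?Q L) (z - y) * (cmod (h (z - y)))\<^sup>2) = (LINT z|lborel. indicator (- ?Q L) (z - y) * (cmod (h (z - y)))\<^sup>2)"
        by (rule integral_completion) (use outm in simp)
      also have "\<dots> = (LINT z|lborel. indicator (- ?Q L) z * (cmod (h z))\<^sup>2)"
        by (rule integral_lborel_translate[of "\<lambda>z. indicator (- ?Q L) z * (cmod (h z))\<^sup>2"]) measurable
      finally show ?thesis .
    qed
    finally have "\<beta> / 2 \<le> Hm\<^sup>2 * measure lebesgue (\<omega> \<inter> ?C)" using k by (simp add: L_def)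
    also have "\<dots> \<le> (Hm\<^sup>2 + 1) * measure lebesgue (\<omega> \<inter> ?C)" by (intro mult_right_mono) auto
    finally show "a \<le> measure lebesgue (\<omega> \<inter> ?C)" using den by (simp add: a_def pos_divide_le_eq algebra_simps)
  qed
qed

text \<open>The packets \<open>g y\<close> are the translates of one function whose transform is the indicator of a small
  ball centred at a point \<open>\<xi>\<^sub>0\<close> where \<open>F (norm \<xi>\<^sub>0)\<close> is almost minimal. On this ball
  \<open>|F(|\<xi>|) - m| \<le> \<epsilon> = 1 / (2 C)\<close>, so half of the norm of \<open>g y\<close> must come from \<open>\<omega>\<close>.\<close>
theorem stabilizable_imp_uniform_mass:
  fixes \<omega> :: "'a::euclidean_space set"
  assumes st: "exp_stabilizable_at_rate F \<omega> \<alpha>" and \<alpha>: "0 < \<alpha>" and \<omega>: "\<omega> \<in> sets lebesgue"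
    and F: "continuous_on {0..} F" and bdd: "bdd_below (F ` {0..})" and inf: "(INF r\<in>{0..}. F r) \<le> 0"
  obtains a L where "0 < a" "0 < L" "\<And>x::'a. a \<le> measure lebesgue (\<omega> \<inter> cbox x (x + L *\<^sub>R One))"
proof -
  define m where "m = (INF r\<in>{0..}. F r)"
  have mF: "m \<le> F r" if "0 \<le> r" for r unfolding m_def using that by (intro cINF_lower bdd) auto
  have m0: "m \<le> 0" using inf by (simp add: m_def)
  let ?A = "fourier_multiplier (\<lambda>\<xi>::'a. F (norm \<xi>))"
  obtain C where C: "0 < C" "\<And>g v :: 'a L2. (g, v) \<in> ?A \<Longrightarrow> norm g \<le> C * (norm (v - m *\<^sub>R g) + norm (mult_indicator \<omega> g))"
    using stabilizable_imp_observable[OF st \<alpha> \<omega> m0] by blast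
  define \<epsilon> where "\<epsilon> = 1 / (2 * C)"
  have \<epsilon>: "0 < \<epsilon>" using C(1) by (simp add: \<epsilon>_def)
  have "\<exists>r\<in>{0..}. F r < m + \<epsilon> / 2"
  proof (rule ccontr)
    assume "\<not> ?thesis"
    then have "m + \<epsilon> / 2 \<le> F r" if "r \<in> {0..}" for r using that by force
    then have "m + \<epsilon> / 2 \<le> m" unfolding m_def by (intro cINF_greatest) auto
    then show False using \<epsilon> by simp
  qed
  then obtain r0 where r0: "0 \<le> r0" "F r0 < m + \<epsilon> / 2" by auto
  from F r0(1) have "\<exists>d>0. \<forall>r\<in>{0..}. dist r r0 < d \<longrightarrow> dist (F r) (F r0) < \<epsilon> / 2"
    unfolding continuous_on_iff using \<epsilon> by (metis atLeast_iff half_gt_zero)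
  then obtain \<rho> where \<rho>: "0 < \<rho>" "\<And>r. 0 \<le> r \<Longrightarrow> \<bar>r - r0\<bar> < \<rho> \<Longrightarrow> \<bar>F r - F r0\<bar> < \<epsilon> / 2"
    by (auto simp: dist_real_def)
  obtain b :: 'a where b: "b \<in> Basis" using nonempty_Basis by blast
  define \<xi>\<^sub>0 where "\<xi>\<^sub>0 = r0 *\<^sub>R b"
  have n0: "norm \<xi>\<^sub>0 = r0" using b r0(1) by (simp add: \<xi>\<^sub>0_def)
  let ?B = "ball \<xi>\<^sub>0 \<rho>"
  have FB: "\<bar>F (norm \<xi>) - m\<bar> \<le> \<epsilon>" if "\<xi> \<in> ?B" for \<xi>
  proof -
    have "\<bar>norm \<xi> - r0\<bar> \<le> norm (\<xi> - \<xi>\<^sub>0)" unfolding n0[symmetric] by (rule norm_triangle_ineq3)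
    also have "\<dots> < \<rho>" using that by (simp add: dist_norm norm_minus_commute)
    finally have "\<bar>F (norm \<xi>) - F r0\<bar> < \<epsilon> / 2" by (intro \<rho>(2)) auto
    then show ?thesis using r0(2) mF[of "norm \<xi>"] by (simp add: abs_if split: if_splits)
  qed
  define h :: "'a \<Rightarrow> complex" where "h = band_limited (indicator ?B)"
  define c where "c = 1 / (2 * pi) ^ DIM('a)"
  have c: "0 < c" by (simp add: c_def)
  have Bm [measurable]: "?B \<in> sets borel" by simp
  have hm [measurable]: "h \<in> borel_measurable borel" unfolding h_def by (intro band_limited_measurable borel_measurable_indicator Bm)
  define \<phi> where "\<phi> y \<xi> = cis (- (y \<bullet> \<xi>)) * indicator ?B \<xi>" for y \<xi> :: 'a
  define g where "g y = inverse_fourier_L2 (abs_L2 (\<phi> y))" for y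
  have \<phi>: "bounded_integrable (\<phi> y)" for y unfolding \<phi>_def by (rule wave_packet(1))
  have g_rep: "AE x in lebesgue. rep_L2 (g y) x = complex_of_real c * h (x - y)" for y
    using wave_packet(2)[of y \<xi>\<^sub>0 \<rho>] unfolding g_def \<phi>_def h_def c_def by simp
  have g_hat: "AE \<xi> in lebesgue. fhat (g y) \<xi> = \<phi> y \<xi>" for y
    unfolding g_def using rep_abs_L2[OF sq_integrable_bounded_integrable[OF \<phi>[of y]]] by simp
  have ng: "norm (g y) = norm (g 0)" for y
  proof -
    have "norm (fourier_L2 (g y)) = norm (fourier_L2 (g 0))"
      by (rule norm_L2_cong, use g_hat[of y] g_hat[of 0] in eventually_elim) (simp add: \<phi>_def norm_mult)
    then show ?thesis by (simp add: norm_fourier_L2)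
  qed
  have Fm [measurable]: "(\<lambda>\<xi>::'a. F (norm \<xi>)) \<in> borel_measurable borel"
    by (intro borel_measurable_continuous_onI continuous_on_compose2[OF F]) (auto intro: continuous_intros)
  define q where "q \<xi> = indicator ?B \<xi> * F (norm \<xi>)" for \<xi> :: 'a
  have q: "bounded_symbol q"
    unfolding bounded_symbol_def
  proof (intro conjI exI[of _ "\<bar>m\<bar> + \<epsilon>"] allI)
    show "q \<in> borel_measurable borel" unfolding q_def by measurable
    show "\<bar>q \<xi>\<bar> \<le> \<bar>m\<bar> + \<epsilon>" for \<xi> using FB[of \<xi>] \<epsilon> by (auto simp: q_def indicator_def)
  qed
  have obs: "norm (g 0) \<le> 2 * C * norm (mult_indicator \<omega> (g y))" for y
  proof -
    define v where "v = multiplier_op q (g y)"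
    have v: "AE \<xi> in lebesgue. fhat v \<xi> = complex_of_real (q \<xi>) * fhat (g y) \<xi>"
      unfolding v_def by (rule rep_multiplier_op[OF q])
    have "(g y, v) \<in> ?A"
      unfolding fourier_multiplier_iff using v g_hat[of y] by eventually_elim (simp add: q_def \<phi>_def indicator_def)
    from C(2)[OF this] have 1: "norm (g y) \<le> C * (norm (v - m *\<^sub>R g y) + norm (mult_indicator \<omega> (g y)))" .
    have "norm (v - m *\<^sub>R g y) \<le> \<epsilon> * norm (g y)"
    proof (rule norm_le_fourier)
      show "AE \<xi> in lebesgue. cmod (fhat (v - m *\<^sub>R g y) \<xi>) \<le> \<epsilon> * cmod (fhat (g y) \<xi>)"
        using v g_hat[of y] rep_fourier_diff[of v "m *\<^sub>R g y"] rep_fourier_scaleR[of m "g y"]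
      proof eventually_elim
        case (elim \<xi>)
        show ?case
        proof (cases "\<xi> \<in> ?B")
          case True
          then have "fhat (v - m *\<^sub>R g y) \<xi> = complex_of_real (F (norm \<xi>) - m) * fhat (g y) \<xi>"
            using elim by (simp add: q_def algebra_simps)
          then show ?thesis using FB[OF True] by (simp only: norm_mult norm_of_real) (rule mult_right_mono, auto)
        next
          case False
          then have "fhat (g y) \<xi> = 0" using elim(2) by (simp add: \<phi>_def)
          then show ?thesis using elim by simp
        qed
      qed
    qed (use \<epsilon> in simp)
    then have "C * (norm (v - m *\<^sub>R g y) + norm (mult_indicator \<omega> (g y))) \<le> C * (\<epsilon> * norm (g y) + norm (mult_indicator \<omega> (g y)))"
      using C(1) by (intro mult_left_mono) auto
    also have "\<dots> = norm (g y) / 2 + C * norm (mult_indicator \<omega> (g y))" using C(1) by (simp add: \<epsilon>_def distrib_left)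
    finally have "norm (g y) \<le> 2 * C * norm (mult_indicator \<omega> (g y))" using 1 by linarith
    then show ?thesis by (simp only: ng[of y])
  qed
  have hs: "sq_integrable h"
  proof (rule sq_integrable_bound[OF rep_L2_sq_integrable[of "g 0"], where c = "1 / c"])
    show "h \<in> borel_measurable lebesgue" by (rule borel_imp_lebesgue_measurable[OF hm])
    show "AE x in lebesgue. cmod (h x) \<le> 1 / c * cmod (rep_L2 (g 0) x)"
      using g_rep[of 0] by eventually_elim (use c in \<open>simp add: norm_mult\<close>)
  qed
  have hb: "cmod (h x) \<le> measure lborel ?B" for x
  proof -
    have "cmod (h x) \<le> (LINT \<xi>|lborel. cmod (cis (x \<bullet> \<xi>) * indicator ?B \<xi>))"
      unfolding h_def band_limited_def by (rule integral_norm_bound)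
    also have "(\<lambda>\<xi>. cmod (cis (x \<bullet> \<xi>) * indicator ?B \<xi>)) = indicator ?B" by (auto simp: indicator_def norm_mult)
    finally show ?thesis by simp
  qed
  have g0: "0 < norm (g 0)"
  proof (rule ccontr)
    assume "\<not> ?thesis"
    then have "g 0 = 0" by simp
    then have "fourier_L2 (g 0) = 0" using bounded_linear_fourier_L2 linear_simps(3) by metis
    then have "AE \<xi> in lebesgue. \<phi> 0 \<xi> = 0" using g_hat[of 0] rep_L2_zero by (auto elim: AE_mp)
    then have "AE \<xi> in lebesgue. \<xi> \<notin> ?B" by eventually_elim (auto simp: \<phi>_def indicator_def)
    then have "AE \<xi> in lborel. \<xi> \<notin> ?B" by (simp add: AE_completion_iff)
    then have "emeasure lborel ?B = 0" by (subst (asm) AE_iff_measurable[OF _ refl]) (auto simp: ball_def)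
    then have "measure lborel ?B = 0" by (simp add: measure_def)
    then show False using content_ball_pos[OF \<rho>(1), of \<xi>\<^sub>0] by simp
  qed
  define \<beta> where "\<beta> = (norm (g 0) / (2 * C * c))\<^sup>2"
  have \<beta>: "0 < \<beta>" using g0 C(1) c by (simp add: \<beta>_def)
  have low: "\<beta> \<le> (LINT x|lebesgue. indicator \<omega> x * (cmod (h (x - y)))\<^sup>2)" for y
  proof -
    have [measurable]: "(\<lambda>x::'a. x) \<in> borel_measurable lebesgue" by (rule borel_imp_lebesgue_measurable) measurable
    have [measurable]: "(\<lambda>x. h (x - y)) \<in> borel_measurable lebesgue" by (rule borel_imp_lebesgue_measurable) measurable
    note [measurable] = \<omega>
    have "(norm (mult_indicator \<omega> (g y)))\<^sup>2 = (LINT x|lebesgue. c\<^sup>2 * (indicator \<omega> x * (cmod (h (x - y)))\<^sup>2))"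
      unfolding norm_L2_power2
      by (rule integral_cong_AE, measurable, use g_rep[of y] rep_mult_indicator[OF \<omega>, of "g y"] in eventually_elim)
         (use c in \<open>auto simp: norm_mult power_mult_distrib indicator_def\<close>)
    then have e: "(norm (mult_indicator \<omega> (g y)))\<^sup>2 = c\<^sup>2 * (LINT x|lebesgue. indicator \<omega> x * (cmod (h (x - y)))\<^sup>2)" by simp
    have "(norm (g 0))\<^sup>2 \<le> (2 * C * norm (mult_indicator \<omega> (g y)))\<^sup>2" by (intro power_mono obs) simp
    also have "\<dots> = (2 * C * c)\<^sup>2 * (LINT x|lebesgue. indicator \<omega> x * (cmod (h (x - y)))\<^sup>2)" by (simp add: power_mult_distrib e)
    finally show ?thesis using C(1) c unfolding \<beta>_def power_divide by (simp add: divide_le_eq mult.commute)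
  qed
  show ?thesis by (rule bounded_sq_integrable_concentration[OF hm hs hb \<omega> \<beta> low]) (rule that)
qed

section \<open>The characterization\<close>

lemma One_vec: "(\<chi> i. L) = (L *\<^sub>R One :: real ^ 'n)"
proof -
  have "(One :: real ^ 'n) $ i = 1" for i
    by (simp add: cart_eq_inner_axis axis_in_Basis_iff)
  then show ?thesis by (simp add: vec_eq_iff)
qed

lemma thick_at_scale_iff:
  fixes \<omega> :: "(real ^ 'n) set"
  shows "thick_at_scale \<gamma> L \<omega> \<longleftrightarrow> \<omega> \<in> sets lebesgue \<and> (\<forall>x. \<gamma> * L ^ CARD('n) \<le> measure lebesgue (\<omega> \<inter> cbox x (x + L *\<^sub>R One)))"
proof -
  have "(+) x ` cbox 0 (\<chi> i. L) = cbox x (x + L *\<^sub>R One)" for x :: "real ^ 'n"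
    using cbox_translation[of x 0 "L *\<^sub>R One"] by (simp add: One_vec)
  then show ?thesis by (simp add: thick_at_scale_def)
qed

text \<open>Both directions translate thickness into lower bounds for the measure of \<open>\<omega>\<close> in translated cubes.
  A Lebesgue measurable \<open>\<omega>\<close> contains a Borel set \<open>W\<close> of the same measure in every cube, to which
  the Logvinenko--Sereda inequality applies.\<close>
theorem corollary2p2:
  fixes F :: "real \<Rightarrow> real" and \<omega> :: "(real ^ 'n) set"
  assumes "continuous_on {0..} F"
    and "bdd_below (F ` {0..})"
    and "(INF r\<in>{0..}. F r) \<le> 0"
    and "Liminf at_top (\<lambda>r. ereal (F r)) > ereal (- (INF r\<in>{0..}. F r))"
    and "\<omega> \<in> sets lebesgue"
  shows "exp_stabilizable F \<omega> \<longleftrightarrow> thick \<omega>"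
proof
  assume "exp_stabilizable F \<omega>"
  then obtain \<alpha> where "0 < \<alpha>" "exp_stabilizable_at_rate F \<omega> \<alpha>" by (auto simp: exp_stabilizable_def)
  from stabilizable_imp_uniform_mass[OF this(2,1) assms(5,1,2,3)] obtain a L where
    a: "0 < a" "0 < L" "\<And>x. a \<le> measure lebesgue (\<omega> \<inter> cbox x (x + L *\<^sub>R One))" by blast
  define \<gamma> where "\<gamma> = min (1 / 2) (a / L ^ CARD('n))"
  have "0 < \<gamma>" "\<gamma> < 1" using a by (auto simp: \<gamma>_def min_def)
  moreover have "\<gamma> * L ^ CARD('n) \<le> measure lebesgue (\<omega> \<inter> cbox x (x + L *\<^sub>R One))" for x
  proof -
    have "\<gamma> * L ^ CARD('n) \<le> a / L ^ CARD('n) * L ^ CARD('n)" using a(2) by (intro mult_right_mono) (auto simp: \<gamma>_def)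
    also have "\<dots> = a" using a(2) by simp
    finally show ?thesis using a(3) order_trans by blast
  qed
  ultimately show "thick \<omega>" unfolding thick_def thick_at_scale_iff using a(2) assms(5) by blast
next
  assume "thick \<omega>"
  then obtain \<gamma> L where \<gamma>: "0 < \<gamma>" and L: "0 < L" and th: "\<And>x. \<gamma> * L ^ CARD('n) \<le> measure lebesgue (\<omega> \<inter> cbox x (x + L *\<^sub>R One))"
    unfolding thick_def thick_at_scale_iff by blast
  have "ereal 0 \<le> ereal (- (INF r\<in>{0..}. F r))" using assms(3) by simp
  then have "ereal 0 < Liminf at_top (\<lambda>r. ereal (F r))" using assms(4) by (rule le_less_trans)
  then obtain y where y: "ereal 0 < ereal y" "ereal y < Liminf at_top (\<lambda>r. ereal (F r))" using ereal_dense2 by blast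
  have "\<forall>\<^sub>F r in at_top. ereal y < ereal (F r)" using y(2) by (rule less_LiminfD)
  then obtain R0 where R0: "\<And>r. R0 \<le> r \<Longrightarrow> y < F r" by (auto simp: eventually_at_top_linorder)
  define R where "R = max 0 R0"
  define \<mu> where "\<mu> = y / 2"
  have \<mu>: "0 < \<mu>" and R: "0 \<le> R" using y(1) by (auto simp: \<mu>_def R_def)
  have high: "2 * \<mu> \<le> F r" if "r > R" for r using R0[of r] that by (simp add: \<mu>_def R_def)
  define W where "W = main_part lborel \<omega>"
  have split: "\<omega> = W \<union> null_part lborel \<omega>" using assms(5) by (simp add: W_def)
  have W: "W \<in> sets borel" using assms(5) main_part_sets[of \<omega> lborel] by (simp add: W_def)
  have nul: "null_part lborel \<omega> \<in> null_sets lebesgue" using assms(5) by (simp add: null_part_null_sets)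
  have Wl: "W \<in> sets lebesgue" using W by simp
  have thW: "\<gamma> * L ^ DIM(real ^ 'n) \<le> measure lborel (W \<inter> cbox q (q + L *\<^sub>R One))" for q
  proof -
    have Wq: "W \<inter> cbox q (q + L *\<^sub>R One) \<in> sets borel" using W by simp
    have "\<omega> \<inter> cbox q (q + L *\<^sub>R One) = W \<inter> cbox q (q + L *\<^sub>R One) \<union> null_part lborel \<omega> \<inter> cbox q (q + L *\<^sub>R One)"
      using split by auto
    moreover have "null_part lborel \<omega> \<inter> cbox q (q + L *\<^sub>R One) \<in> null_sets lebesgue"
      using nul by (intro null_set_Int2) auto
    ultimately have "measure lebesgue (\<omega> \<inter> cbox q (q + L *\<^sub>R One)) = measure lebesgue (W \<inter> cbox q (q + L *\<^sub>R One))"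
      using Wq by (simp add: measure_Un_null_set)
    also have "\<dots> = measure lborel (W \<inter> cbox q (q + L *\<^sub>R One))" using Wq by (intro measure_completion) simp
    finally show ?thesis using th[of q] by simp
  qed
  show "exp_stabilizable F \<omega>"
  proof (rule logvinenko_sereda[OF W \<gamma> L R thW])
    fix c :: real
    assume c: "0 < c" and ls: "\<And>u :: (real ^ 'n) L2. (AE \<xi> in lebesgue. norm \<xi> > R \<longrightarrow> fhat u \<xi> = 0) \<Longrightarrow>
      c * (norm u)\<^sup>2 \<le> (norm (mult_indicator W u))\<^sup>2"
    have "exp_stabilizable_at_rate F \<omega> \<mu>"
    proof (rule stabilizable_if_low_frequencies_observable[OF assms(1,5) \<mu> R high c])
      fix u :: "(real ^ 'n) L2"
      assume "AE \<xi> in lebesgue. norm \<xi> > R \<longrightarrow> fhat u \<xi> = 0"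
      from ls[OF this] have "c * (norm u)\<^sup>2 \<le> (norm (mult_indicator W u))\<^sup>2" .
      moreover have "norm (mult_indicator W u) \<le> 1 * norm (mult_indicator \<omega> u)"
        by (rule norm_L2_le, use rep_mult_indicator[OF Wl, of u] rep_mult_indicator[OF assms(5), of u] in eventually_elim)
           (use split in \<open>auto simp: indicator_def\<close>)
      then have "(norm (mult_indicator W u))\<^sup>2 \<le> (norm (mult_indicator \<omega> u))\<^sup>2" by (intro power_mono) auto
      ultimately show "c * (norm u)\<^sup>2 \<le> (norm (mult_indicator \<omega> u))\<^sup>2" by linarith
    qed
    then show ?thesis using \<mu> by (auto simp: exp_stabilizable_def)
  qed
qed

end
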